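(* Let $m$ be large and let $\mathcal{F}=\{\varphi_a\}_{a\in\Omega_m}$ be a family of $m$-periodic complex valued functions satisfying Assumptions 2 and 3. Then for all real numbers $V$ with $1\le V\le \frac{N}{\pi}\left(\log\log m-2\log\log\log m-B\right)$ we have $$\Phi_{\mathcal{F}}(V)\ge\exp\left(-A_0\exp\left(\frac{\pi}{N}V\right)\left(1+O\left(Ve^{-\pi V/(2N)}\right)\right)\right),$$ where $$A_0=\frac N2\exp\left(-\gamma-1-\frac1{2N}\int_{-\infty}^\infty\frac{f_{\mathbb{X}}(u)}{u^2}\,du\right),\qquad B=\log A_0+9,$$ $\gamma$ is the Euler–Mascheroni constant, and $f_{\mathbb{X}}(t)=\log\mathbb{E}(e^{t\mathbb{X}})$ if $|t|<1$, $f_{\mathbb{X}}(t)=\log\mathbb{E}(e^{t\mathbb{X}})-N|t|$ if $|t|\ge1$, with $\mathbb{X}$ a random variable having the common distribution of the $\mathbb{X}(h)$ of Assumption 3.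
   Context: Let $m\ge2$ be an integer, $e(z)=\exp(2\pi i z)$, $e_m(z)=e(z/m)$. For an $m$-periodic $\varphi:\mathbb{Z}\to\mathbb{C}$ put $\mathcal{M}(\varphi)=\max_{0\le x<m}\left|\sum_{0\le n\le x}\varphi(n)\right|$ and $\widehat{\varphi}(h)=m^{-1/2}\sum_{n\bmod m}\varphi(n)e_m(hn)$. A family $\mathcal{F}=\{\varphi_a\}_{a\in\Omega_m}$ consists of a nonempty finite set $\Omega_m$ and $m$-periodic functions $\varphi_a$; put $\Phi_{\mathcal{F}}(V)=|\Omega_m|^{-1}\left|\{a\in\Omega_m:\mathcal{M}(\varphi_a)/\sqrt m>V\}\right|$. "Absolute constant" means independent of $m$. Assumption 2: there is an absolute constant $N>0$ with $\widehat{\varphi_a}(h)\in[-N,N]$ for all $a\in\Omega_m$, $h\in\mathbb{Z}/m\mathbb{Z}$. Assumption 3: there exist i.i.d. real random variables $\{\mathbb{X}(h)\}_{h\in\mathbb{Z}\setminus\{0\}}$ supported on $[-N,N]$ and absolute constants $\eta\ge1/2$, $C_1>1$ such that for all positive integers $k\le\log m/\log\log m$ and all integer tuples $(h_1,\dots,h_k)\in(-m/2,m/2]^k$ with all $h_i\ne0$, $$\frac{1}{|\Omega_m|}\sum_{a\in\Omega_m}\widehat{\varphi_a}(h_1)\cdots\widehat{\varphi_a}(h_k)=\mathbb{E}(\mathbb{X}(h_1)\cdots\mathbb{X}(h_k))+O\!\left(\frac{C_1^k}{m^\eta}\right);$$ moreover a random variable $\mathbb{X}$ with the common distribution satisfies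 (3a) there is $A>0$ with $\mathbb{P}(\mathbb{X}>N-\varepsilon)\gg\varepsilon^A$ and $\mathbb{P}(\mathbb{X}<-N+\varepsilon)\gg\varepsilon^A$ for all $\varepsilon\in(0,1]$, and (3b) $\mathbb{E}(\mathbb{X}^{2\ell+1})=0$ for all integers $\ell\ge0$. *)

theory Defs
  imports "HOL-Probability.Probability"
begin

definition periodic_fun_mod :: "nat \<Rightarrow> (int \<Rightarrow> complex) \<Rightarrow> bool" where
  "periodic_fun_mod m \<phi> \<longleftrightarrow> (\<forall>n. \<phi> (n + int m) = \<phi> n)"

definition max_partial_sum :: "nat \<Rightarrow> (int \<Rightarrow> complex) \<Rightarrow> real" where
  "max_partial_sum m \<phi> = Max ((\<lambda>x. cmod (\<Sum>n\<in>{0..x}. \<phi> n)) ` {0..<int m})"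

definition e_mod :: "nat \<Rightarrow> int \<Rightarrow> complex" where
  "e_mod m n = exp (2 * of_real pi * \<i> * of_int n / of_nat m)"

definition fourier_mod :: "nat \<Rightarrow> (int \<Rightarrow> complex) \<Rightarrow> int \<Rightarrow> complex" where
  "fourier_mod m \<phi> h = (\<Sum>n\<in>{0..<int m}. \<phi> n * e_mod m (h * n)) / of_real (sqrt (real m))"

definition periodic_family :: "nat \<Rightarrow> 'a set \<Rightarrow> ('a \<Rightarrow> int \<Rightarrow> complex) \<Rightarrow> bool" where
  "periodic_family m \<Omega> \<phi> \<longleftrightarrow> finite \<Omega> \<and> \<Omega> \<noteq> {} \<and> (\<forall>a\<in>\<Omega>. periodic_fun_mod m (\<phi> a))"

definition large_proportion :: "nat \<Rightarrow> 'a set \<Rightarrow> ('a \<Rightarrow> int \<Rightarrow> complex) \<Rightarrow> real \<Rightarrow> real" where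
  "large_proportion m \<Omega> \<phi> V =
     real (card {a \<in> \<Omega>. max_partial_sum m (\<phi> a) / sqrt (real m) > V}) / real (card \<Omega>)"

definition fourier_bounded :: "real \<Rightarrow> nat \<Rightarrow> 'a set \<Rightarrow> ('a \<Rightarrow> int \<Rightarrow> complex) \<Rightarrow> bool" where
  "fourier_bounded N m \<Omega> \<phi> \<longleftrightarrow>
     (\<forall>a\<in>\<Omega>. \<forall>h. fourier_mod m (\<phi> a) h \<in> complex_of_real ` {-N..N})"

text \<open>\<open>Y\<close> is a random variable with the common distribution of the \<open>X h\<close>, \<open>h \<noteq> 0\<close>; the value \<open>X 0\<close> is irrelevant.\<close>

definition random_model ::
    "'b measure \<Rightarrow> (int \<Rightarrow> 'b \<Rightarrow> real) \<Rightarrow> ('b \<Rightarrow> real) \<Rightarrow> real \<Rightarrow> bool" where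
  "random_model M X Y N \<longleftrightarrow>
     prob_space M \<and>
     prob_space.indep_vars M (\<lambda>_. borel) X {h. h \<noteq> 0} \<and>
     Y \<in> borel_measurable M \<and>
     (\<forall>h. h \<noteq> 0 \<longrightarrow> distr M borel (X h) = distr M borel Y) \<and>
     (\<forall>h. h \<noteq> 0 \<longrightarrow> (AE \<omega> in M. X h \<omega> \<in> {-N..N})) \<and>
     (\<exists>A>0. \<exists>c>0. \<forall>\<epsilon>\<in>{0<..1}.
        measure M {\<omega> \<in> space M. Y \<omega> > N - \<epsilon>} \<ge> c * \<epsilon> powr A \<and>
        measure M {\<omega> \<in> space M. Y \<omega> < - N + \<epsilon>} \<ge> c * \<epsilon> powr A) \<and>
     (\<forall>l::nat. (LINT \<omega>|M. Y \<omega> ^ (2 * l + 1)) = 0)"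

text \<open>\<open>D\<close> is the constant implied by the \<open>O\<close>-symbol in the error term \<open>O(C\<^sub>1 ^ k / m powr \<eta>)\<close>.\<close>

definition moments_match ::
    "'b measure \<Rightarrow> (int \<Rightarrow> 'b \<Rightarrow> real) \<Rightarrow> real \<Rightarrow> real \<Rightarrow> real \<Rightarrow>
     nat \<Rightarrow> 'a set \<Rightarrow> ('a \<Rightarrow> int \<Rightarrow> complex) \<Rightarrow> bool" where
  "moments_match M X \<eta> C\<^sub>1 D m \<Omega> \<phi> \<longleftrightarrow>
     (\<forall>k::nat. 0 < k \<and> real k \<le> ln (real m) / ln (ln (real m)) \<longrightarrow>
       (\<forall>h :: nat \<Rightarrow> int.
          (\<forall>i<k. h i \<noteq> 0 \<and> - real m / 2 < real_of_int (h i) \<and> real_of_int (h i) \<le> real m / 2) \<longrightarrow>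
          cmod ((\<Sum>a\<in>\<Omega>. \<Prod>i<k. fourier_mod m (\<phi> a) (h i)) / of_nat (card \<Omega>)
                - complex_of_real (LINT \<omega>|M. (\<Prod>i<k. X (h i) \<omega>)))
            \<le> D * (C\<^sub>1 ^ k / real m powr \<eta>)))"

definition f_cgf :: "'b measure \<Rightarrow> ('b \<Rightarrow> real) \<Rightarrow> real \<Rightarrow> real \<Rightarrow> real" where
  "f_cgf M Y N t =
     (if \<bar>t\<bar> < 1 then ln (LINT \<omega>|M. exp (t * Y \<omega>))
      else ln (LINT \<omega>|M. exp (t * Y \<omega>)) - N * \<bar>t\<bar>)"

definition A0_const :: "'b measure \<Rightarrow> ('b \<Rightarrow> real) \<Rightarrow> real \<Rightarrow> real" where
  "A0_const M Y N =
     N / 2 * exp (- euler_mascheroni - 1 - 1 / (2 * N) * (LINT u|lborel. f_cgf M Y N u / u\<^sup>2))"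

definition B_const :: "'b measure \<Rightarrow> ('b \<Rightarrow> real) \<Rightarrow> real \<Rightarrow> real" where
  "B_const M Y N = ln (A0_const M Y N) + 9"

end

theory Submission imports Defs "HOL-Real_Asymp.Real_Asymp" begin

text \<open>
  Up to normalisation, the imaginary part of the sum of \<open>\<phi>\<^sub>a(n)\<close> over \<open>0 \<le> n \<le> m/2\<close> is
  \<open>S\<^sub>a = \<Sum> b\<^sub>h c\<^sub>a(h)\<close> with \<open>b\<^sub>h = 1/(\<pi>h) + O(1/m)\<close> for odd \<open>h\<close>, \<open>b\<^sub>h = O(1/m)\<close> for even \<open>h\<close>,
  and \<open>c\<^sub>a(h)\<close> the Fourier coefficients, so it
  suffices to bound from below the proportion of \<open>a\<close> with \<open>S\<^sub>a > V\<close>.  For the random model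
  \<open>S = \<Sum> b\<^sub>h X(h)\<close>, independence and a comparison of sums over odd integers with integrals give
  \<open>log E exp(sS) = (N/\<pi>) s (log s + c) + O(log s)\<close>; the constant \<open>c\<close> contains the integral of
  \<open>f\<^sub>X(u)/u\<^sup>2\<close>.  The moments up to order \<open>K\<close>, about \<open>log m / (4 log log m)\<close>, determine the Laplace
  transform of \<open>S\<^sub>a\<close> (restricted to those \<open>a\<close> for which \<open>S\<^sub>a\<close> is not abnormally large) up to an error
  of \<open>1/2\<close> for all \<open>s\<close> up to a multiple of \<open>log m / (log log m)\<^sup>2\<close>.  Exponential tilting at the saddle
  point then shows that most of the tilted mass has \<open>S\<^sub>a\<close> in a window of width
  \<open>O(V exp(-\<pi>V/(2N)))\<close> above \<open>V\<close>, and this width is the source of the error term.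
\<close>

subsection \<open>Truncated exponential series\<close>

text \<open>For a single \<open>a\<close> only \<open>S\<^sub>a = O(log m)\<close> is available, so
  with \<open>s\<close> near \<open>log m / (log log m)^2\<close> the value
  \<open>exp (s * S\<^sub>a)\<close> may exceed every power of \<open>m\<close>; moments up to order
  \<open>K\<close> do not control it. Discarding such \<open>a\<close> is harmless for a lower
  bound: tilting compares the transform over one fixed set at three parameters, while the count may
  run over all of \<open>\<Omega>\<close>. The size of \<open>K\<close> comes from the moment
  errors, which are \<open>m powr (-1/2)\<close> times at most about \<open>(log m)^K\<close>; the
  latter is kept below \<open>m powr (1/4)\<close>. With
  \<open>R s = (N/\<pi>) s (log s + c)\<close> the saddle point \<open>s0\<close> solves
  \<open>R' s0 = V\<close>, and
  \<open>R s0 - s0 V = - (N/\<pi>) s0 = - A0 exp (\<pi> V / N)\<close>; this is where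
  \<open>A0\<close> comes from. The transform is known up to a factor \<open>exp (O(V))\<close>. A
  window of width \<open>w\<close> costs about \<open>exp (- s0 w)\<close> and shrinks both tails by
  \<open>exp (- const s0 w^2)\<close>, so \<open>s0 w^2\<close> must dominate \<open>V\<close>;
  \<open>w = V exp (- \<pi> V / (2 N))\<close> makes it a multiple of \<open>V^2\<close>. The
  summand 9 in \<open>B\<close> keeps all parameters, which are at most \<open>2 s0\<close>, in the
  range where the transform is known.\<close>

definition exp_trunc :: "nat \<Rightarrow> real \<Rightarrow> real" where
  "exp_trunc K x = (\<Sum>j\<le>K. x ^ j / fact j)"

lemma exp_trunc_abs_le_exp: "\<bar>exp_trunc K x\<bar> \<le> exp \<bar>x\<bar>"
proof -
  have "\<bar>exp_trunc K x\<bar> \<le> (\<Sum>j\<le>K. \<bar>x\<bar> ^ j / fact j)"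
    unfolding exp_trunc_def by (rule order_trans[OF sum_abs]) (simp add: power_abs)
  also have "\<dots> \<le> (\<Sum>j. \<bar>x\<bar> ^ j / fact j)"
    using summable_exp[of "\<bar>x\<bar>"] by (intro sum_le_suminf) (auto simp: divide_inverse mult.commute)
  finally show ?thesis by (simp add: exp_def divide_inverse mult.commute)
qed

text \<open>Every omitted term has index above \<open>K\<close>, so replacing \<open>x\<close> by
  \<open>\<rho> * \<bar>x\<bar>\<close> enlarges it by at least \<open>\<rho> ^ K\<close>, and the
  enlarged tail is at most the full exponential series. The free \<open>\<rho>\<close> will be 3 for
  the family and 48 for the random model.\<close>

lemma abs_exp_minus_trunc_le:
  assumes "\<rho> \<ge> 1"
  shows "\<bar>exp x - exp_trunc K x\<bar> \<le> exp (\<rho> * \<bar>x\<bar>) / \<rho> ^ K"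
proof -
  let ?t = "\<lambda>x j. x ^ j / fact j :: real"
  have S: "?t x sums exp x" for x :: real
    using exp_converges[of x] by (simp add: divide_inverse mult.commute)
  have "(\<lambda>j. ?t x (j + Suc K)) sums (exp x - (\<Sum>j<Suc K. ?t x j))"
    using S sums_iff_shift[of "?t x" "Suc K"] by simp
  hence 1: "(\<lambda>j. ?t x (j + Suc K)) sums (exp x - exp_trunc K x)"
    by (simp only: lessThan_Suc_atMost exp_trunc_def)
  have "(\<lambda>j. ?t (\<rho> * \<bar>x\<bar>) (j + Suc K)) sums (exp (\<rho> * \<bar>x\<bar>) - (\<Sum>j<Suc K. ?t (\<rho> * \<bar>x\<bar>) j))"
    using S sums_iff_shift[of "?t (\<rho> * \<bar>x\<bar>)" "Suc K"] by simp
  hence 2: "(\<lambda>j. ?t (\<rho> * \<bar>x\<bar>) (j + Suc K) / \<rho> ^ K) sums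
      ((exp (\<rho> * \<bar>x\<bar>) - (\<Sum>j<Suc K. ?t (\<rho> * \<bar>x\<bar>) j)) / \<rho> ^ K)"
    by (rule sums_divide)
  have le: "norm (?t x (j + Suc K)) \<le> ?t (\<rho> * \<bar>x\<bar>) (j + Suc K) / \<rho> ^ K" for j
  proof -
    have "1 \<le> \<rho> ^ Suc j" using assms by (rule one_le_power)
    hence "\<bar>x\<bar> ^ (j + Suc K) / fact (j + Suc K) * 1 \<le> \<bar>x\<bar> ^ (j + Suc K) / fact (j + Suc K) * \<rho> ^ Suc j"
      by (intro mult_left_mono) auto
    also have "\<dots> = ?t (\<rho> * \<bar>x\<bar>) (j + Suc K) / \<rho> ^ K"
      using assms by (simp add: power_mult_distrib power_add del: fact_Suc)
    finally show ?thesis by (simp add: power_abs abs_mult del: fact_Suc)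
  qed
  have "norm (exp x - exp_trunc K x) \<le> (\<Sum>j. ?t (\<rho> * \<bar>x\<bar>) (j + Suc K) / \<rho> ^ K)"
    unfolding sums_unique[OF 1] by (rule norm_suminf_le[OF le sums_summable[OF 2]])
  also have "\<dots> = (exp (\<rho> * \<bar>x\<bar>) - (\<Sum>j<Suc K. ?t (\<rho> * \<bar>x\<bar>) j)) / \<rho> ^ K"
    using 2 by (rule sums_unique[symmetric])
  also have "\<dots> \<le> exp (\<rho> * \<bar>x\<bar>) / \<rho> ^ K"
    using assms by (intro divide_right_mono) (auto intro!: sum_nonneg simp del: sum.lessThan_Suc)
  finally show ?thesis by simp
qed

text \<open>Since \<open>z / x0 \<ge> 1\<close>, each power \<open>(z / x0) ^ j\<close> may be
  raised to exponent \<open>K\<close>. This turns a polynomial in a large argument into a pure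
  \<open>K\<close>-th power, to which the \<open>K\<close>-th moment applies.\<close>

lemma exp_trunc_abs_le_power:
  assumes "\<bar>x\<bar> \<le> z" "0 < x0" "x0 \<le> z"
  shows "\<bar>exp_trunc K x\<bar> \<le> (z / x0) ^ K * exp x0"
proof -
  have "\<bar>exp_trunc K x\<bar> \<le> (\<Sum>j\<le>K. \<bar>x\<bar> ^ j / fact j)"
    unfolding exp_trunc_def by (rule order_trans[OF sum_abs]) (simp add: power_abs)
  also have "\<dots> \<le> (\<Sum>j\<le>K. (z / x0) ^ K * (x0 ^ j / fact j))"
  proof (rule sum_mono)
    fix j assume "j \<in> {..K}"
    have "\<bar>x\<bar> ^ j \<le> z ^ j" using assms by (intro power_mono) auto
    also have "\<dots> = (z / x0) ^ j * x0 ^ j" using assms by (simp add: power_divide)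
    also have "\<dots> \<le> (z / x0) ^ K * x0 ^ j"
      using assms \<open>j \<in> {..K}\<close> by (intro mult_right_mono power_increasing) auto
    finally show "\<bar>x\<bar> ^ j / fact j \<le> (z / x0) ^ K * (x0 ^ j / fact j)"
      by (simp add: field_simps)
  qed
  also have "\<dots> = (z / x0) ^ K * exp_trunc K x0"
    by (simp add: exp_trunc_def sum_distrib_left)
  also have "\<dots> \<le> (z / x0) ^ K * exp x0"
    using exp_trunc_abs_le_exp[of K x0] assms by (intro mult_left_mono) auto
  finally show ?thesis .
qed

text \<open>A single term of the exponential series; it bounds the \<open>K\<close>-th moment of the
  random sum by an exponential moment.\<close>

lemma power_le_fact_exp:
  fixes x \<rho> :: real
  assumes "\<rho> > 0"
  shows "\<bar>x\<bar> ^ K \<le> fact K / \<rho> ^ K * exp (\<rho> * \<bar>x\<bar>)"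
proof -
  have "(\<rho> * \<bar>x\<bar>) ^ K / fact K = (\<Sum>j\<in>{K}. (\<rho> * \<bar>x\<bar>) ^ j / fact j)" by simp
  also have "\<dots> \<le> exp_trunc K (\<rho> * \<bar>x\<bar>)"
    unfolding exp_trunc_def using assms by (intro sum_mono2) auto
  also have "\<dots> \<le> exp (\<rho> * \<bar>x\<bar>)"
    using exp_trunc_abs_le_exp[of K "\<rho> * \<bar>x\<bar>"] assms by (simp add: abs_mult)
  finally show ?thesis using assms by (simp add: field_simps power_mult_distrib)
qed

subsection \<open>Exponential tilting\<close>

text \<open>Chernoff bounds on both sides of the window from \<open>V\<close> to \<open>V'\<close>:
  below \<open>V\<close> the weight \<open>exp (\<delta> * (V - u))\<close> is at least 1, above
  \<open>V'\<close> the weight \<open>exp (\<delta> * (u - V'))\<close> is, and inside only the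
  indicator term is needed.\<close>

lemma exp_tilt_pointwise:
  fixes u s \<delta> V V' :: real
  assumes "\<delta> \<ge> 0" "s \<ge> 0"
  shows "exp (s * u) \<le> (if V < u then exp (s * V') else 0)
      + exp (\<delta> * V) * exp ((s - \<delta>) * u) + exp (- \<delta> * V') * exp ((s + \<delta>) * u)"
proof -
  consider "u \<le> V" | "V < u" "u \<le> V'" | "V' < u" by linarith
  thus ?thesis
  proof cases
    case 1
    have "s * u \<le> \<delta> * V + (s - \<delta>) * u"
      using mult_left_mono[OF 1 assms(1)] by (simp add: algebra_simps)
    hence "exp (s * u) \<le> exp (\<delta> * V) * exp ((s - \<delta>) * u)" by (simp flip: exp_add)
    thus ?thesis by (smt (verit) exp_gt_zero mult_pos_pos)
  next
    case 2
    thus ?thesis using mult_left_mono[OF 2(2) assms(2)]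
      by (smt (verit) exp_gt_zero mult_pos_pos exp_le_cancel_iff)
  next
    case 3
    have "s * u \<le> - \<delta> * V' + (s + \<delta>) * u"
      using mult_left_mono[OF less_imp_le[OF 3] assms(1)] by (simp add: algebra_simps)
    hence "exp (s * u) \<le> exp (- \<delta> * V') * exp ((s + \<delta>) * u)" by (simp flip: exp_add)
    thus ?thesis by (smt (verit) exp_gt_zero mult_pos_pos)
  qed
qed

text \<open>The transforms run over \<open>T\<close> but the count over \<open>\<Omega>\<close>,
  because enlarging the set only helps the counting term. Hence no information on \<open>U\<close>
  outside \<open>T\<close> is required.\<close>

lemma exp_tilt_count:
  fixes U :: "'a \<Rightarrow> real" and \<Omega> T :: "'a set"
  assumes "finite \<Omega>" "T \<subseteq> \<Omega>" "\<delta> \<ge> 0" "s \<ge> 0"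
  shows "(\<Sum>a\<in>T. exp (s * U a)) / card \<Omega>
    \<le> exp (s * V') * (card {a\<in>\<Omega>. V < U a} / card \<Omega>)
      + exp (\<delta> * V) * ((\<Sum>a\<in>T. exp ((s - \<delta>) * U a)) / card \<Omega>)
      + exp (- \<delta> * V') * ((\<Sum>a\<in>T. exp ((s + \<delta>) * U a)) / card \<Omega>)"
proof -
  have fT: "finite T" using assms finite_subset by blast
  have "(\<Sum>a\<in>T. exp (s * U a)) \<le> (\<Sum>a\<in>T. (if V < U a then exp (s * V') else 0)
      + exp (\<delta> * V) * exp ((s - \<delta>) * U a) + exp (- \<delta> * V') * exp ((s + \<delta>) * U a))"
    by (intro sum_mono exp_tilt_pointwise assms)
  also have "\<dots> = exp (s * V') * card {a\<in>T. V < U a}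
      + exp (\<delta> * V) * (\<Sum>a\<in>T. exp ((s - \<delta>) * U a))
      + exp (- \<delta> * V') * (\<Sum>a\<in>T. exp ((s + \<delta>) * U a))"
    using fT by (simp add: sum.distrib sum_distrib_left sum.If_cases Int_def mult.commute)
  also have "\<dots> \<le> exp (s * V') * card {a\<in>\<Omega>. V < U a}
      + exp (\<delta> * V) * (\<Sum>a\<in>T. exp ((s - \<delta>) * U a))
      + exp (- \<delta> * V') * (\<Sum>a\<in>T. exp ((s + \<delta>) * U a))"
    using assms by (intro add_mono mult_left_mono order_refl of_nat_mono card_mono) auto
  finally show ?thesis
    by (simp add: divide_right_mono add_divide_distrib[symmetric])
qed

subsection \<open>The sine coefficients of the sum up to m/2\<close>

text \<open>Zero is removed because the moment hypothesis covers nonzero frequencies only; nothing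
  is lost, as the sine coefficient at 0 vanishes.\<close>

definition freqs :: "nat \<Rightarrow> int set" where
  "freqs m = {h. - real m / 2 < real_of_int h \<and> real_of_int h \<le> real m / 2} - {0}"

text \<open>The division by \<open>m\<close> combines one factor \<open>1 / sqrt m\<close> from
  Fourier inversion with one from the normalisation of the maximal partial sum.\<close>

definition sine_coeff :: "nat \<Rightarrow> int \<Rightarrow> real" where
  "sine_coeff m h = (\<Sum>n\<in>{0..int (m div 2)}. sin (2 * pi * of_int h * of_int n / of_nat m)) / m"

text \<open>Written as a block of \<open>m\<close> consecutive integers, the frequencies allow
  geometric summation. The lower end is \<open>(m - 1) div 2\<close>, not \<open>m div 2\<close>,
  because \<open>- m / 2\<close> is excluded for even \<open>m\<close>.\<close>

lemma insert_0_freqs: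
  assumes "m > 0"
  shows "insert 0 (freqs m) = {- int ((m - 1) div 2)..<- int ((m - 1) div 2) + int m}"
proof -
  have "(- real m / 2 < real_of_int h \<and> real_of_int h \<le> real m / 2) \<longleftrightarrow>
     h \<in> {- int ((m - 1) div 2)..<- int ((m - 1) div 2) + int m}" for h
  proof -
    have "- real m / 2 < real_of_int h \<longleftrightarrow> - int m < 2 * h" by linarith
    moreover have "real_of_int h \<le> real m / 2 \<longleftrightarrow> 2 * h \<le> int m" by linarith
    ultimately show ?thesis using assms by auto
  qed
  moreover have "- real m / 2 < real_of_int 0 \<and> real_of_int 0 \<le> real m / 2"
    using assms by simp
  ultimately show ?thesis unfolding freqs_def by blast
qed

lemma finite_freqs: "finite (freqs m)"
proof (cases "m = 0")
  case False
  hence "finite (insert 0 (freqs m))" by (simp add: insert_0_freqs)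
  thus ?thesis by simp
qed (auto simp: freqs_def)

lemma card_freqs_le: "card (freqs m) \<le> m"
proof (cases "m = 0")
  case False
  hence "card (insert 0 (freqs m)) = m" by (simp add: insert_0_freqs)
  thus ?thesis using finite_freqs[of m] by (metis card_insert_le)
qed (auto simp: freqs_def)

lemma freqs_abs_le: "h \<in> freqs m \<Longrightarrow> \<bar>real_of_int h\<bar> \<le> real m / 2"
  by (auto simp: freqs_def)

section \<open>Finite Fourier inversion and the reduction to a sine sum\<close>

lemma e_mod_add: "e_mod m (a + b) = e_mod m a * e_mod m b"
  by (simp add: e_mod_def exp_add[symmetric] add_divide_distrib algebra_simps)

lemma e_mod_mult_nat: "e_mod m (d * int j) = e_mod m d ^ j"
  by (simp add: e_mod_def exp_of_nat_mult[symmetric] algebra_simps)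

lemma e_mod_eq_1_iff:
  assumes "m > 0"
  shows "e_mod m d = 1 \<longleftrightarrow> int m dvd d"
proof -
  have "e_mod m d = exp (2 * of_real pi * \<i> * of_real (of_int d / of_nat m))"
    by (simp add: e_mod_def)
  also have "\<dots> = 1 \<longleftrightarrow> (\<exists>n::int. real_of_int d / real m = n)"
  proof -
    have "Im (2 * of_real pi * \<i> * of_real (of_int d / of_nat m)) = of_int (2 * n) * pi \<longleftrightarrow>
        real_of_int d / real m = n" for n :: int
    proof -
      have "Im (2 * of_real pi * \<i> * of_real (of_int d / of_nat m)) = (2 * pi) * (real_of_int d / real m)" by simp
      moreover have "of_int (2 * n) * pi = (2 * pi) * of_int n" by simp
      ultimately show ?thesis by (metis mult_cancel_left pi_neq_zero mult_eq_0_iff zero_neq_numeral)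
    qed
    thus ?thesis unfolding exp_eq_1 by simp
  qed
  also have "\<dots> \<longleftrightarrow> (\<exists>n::int. real_of_int d = real_of_int (int m * n))"
    using assms by (simp add: field_simps)
  also have "\<dots> \<longleftrightarrow> int m dvd d"
    unfolding of_int_eq_iff by (auto simp: dvd_def)
  finally show ?thesis .
qed

lemma sum_e_mod:
  assumes "m > 0"
  shows "(\<Sum>h\<in>{l..<l + int m}. e_mod m (d * h)) = (if int m dvd d then of_nat m else 0)"
proof -
  have "(\<Sum>h\<in>{l..<l + int m}. e_mod m (d * h)) = (\<Sum>j<m. e_mod m (d * (l + int j)))"
    by (rule sum.reindex_bij_witness[of _ "\<lambda>j. l + int j" "\<lambda>h. nat (h - l)"]) auto
  also have "\<dots> = e_mod m (d * l) * (\<Sum>j<m. e_mod m d ^ j)"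
    by (simp add: distrib_left e_mod_add e_mod_mult_nat sum_distrib_left)
  also have "\<dots> = (if int m dvd d then of_nat m else 0)"
  proof (cases "int m dvd d")
    case True
    hence "e_mod m d = 1" "e_mod m (d * l) = 1" by (simp_all add: e_mod_eq_1_iff[OF assms])
    thus ?thesis using True by simp
  next
    case False
    hence "e_mod m d \<noteq> 1" by (simp add: e_mod_eq_1_iff[OF assms])
    moreover have "e_mod m d ^ m = 1"
      using e_mod_mult_nat[of m d m] e_mod_eq_1_iff[OF assms, of "d * int m"] by simp
    ultimately show ?thesis using False by (simp add: sum_gp_strict)
  qed
  finally show ?thesis .
qed

text \<open>Orthogonality of the additive characters. The transform carries
  \<open>e_mod m (h * n)\<close> with a plus sign, so the inverse carries a minus sign, which later
  reappears in front of the imaginary part.\<close>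

lemma fourier_inversion:
  assumes "m > 0" "0 \<le> n" "n < int m"
  shows "\<phi> n = (\<Sum>h\<in>insert 0 (freqs m). fourier_mod m \<phi> h * e_mod m (- (h * n))) / of_real (sqrt (real m))"
proof -
  let ?q = "complex_of_real (sqrt (real m))"
  have "(\<Sum>h\<in>insert 0 (freqs m). fourier_mod m \<phi> h * e_mod m (- (h * n)))
     = (\<Sum>h\<in>insert 0 (freqs m). \<Sum>k\<in>{0..<int m}. \<phi> k * e_mod m ((k - n) * h) / ?q)"
  proof (rule sum.cong[OF refl])
    fix h
    have "e_mod m (h * k) * e_mod m (- (h * n)) = e_mod m ((k - n) * h)" for k
      unfolding e_mod_add[symmetric] by (simp add: algebra_simps)
    thus "fourier_mod m \<phi> h * e_mod m (- (h * n)) = (\<Sum>k\<in>{0..<int m}. \<phi> k * e_mod m ((k - n) * h) / ?q)"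
      unfolding fourier_mod_def sum_divide_distrib sum_distrib_right by (simp add: mult.assoc)
  qed
  also have "\<dots> = (\<Sum>k\<in>{0..<int m}. \<Sum>h\<in>insert 0 (freqs m). \<phi> k * e_mod m ((k - n) * h) / ?q)"
    by (rule sum.swap)
  also have "\<dots> = (\<Sum>k\<in>{0..<int m}. \<phi> k / ?q * (\<Sum>h\<in>insert 0 (freqs m). e_mod m ((k - n) * h)))"
    by (simp only: sum_distrib_left times_divide_eq_left)
  also have "\<dots> = (\<Sum>k\<in>{0..<int m}. if k = n then \<phi> k / ?q * of_nat m else 0)"
  proof (rule sum.cong[OF refl])
    fix k assume "k \<in> {0..<int m}"
    hence "int m dvd (k - n) \<longleftrightarrow> k = n"
      using assms zdvd_imp_le[of "int m" "k - n"] zdvd_imp_le[of "int m" "n - k"]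
      by (cases k n rule: linorder_cases) (auto simp: dvd_diff_commute[of _ k n])
    thus "\<phi> k / ?q * (\<Sum>h\<in>insert 0 (freqs m). e_mod m ((k - n) * h)) =
       (if k = n then \<phi> k / ?q * of_nat m else 0)"
      unfolding insert_0_freqs[OF assms(1)] sum_e_mod[OF assms(1)] by simp
  qed
  also have "\<dots> = \<phi> n / ?q * of_nat m" using assms by simp
  also have "\<dots> = \<phi> n * ?q"
  proof -
    have "complex_of_nat m = ?q * ?q" by (metis of_nat_0_le_iff of_real_mult of_real_of_nat_eq real_sqrt_mult_self abs_of_nonneg)
    moreover have "?q \<noteq> 0" using assms by simp
    ultimately show ?thesis by simp
  qed
  finally show ?thesis using assms by simp
qed

text \<open>The maximum is bounded below by the partial sum up to \<open>m div 2\<close>, and its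
  modulus by minus its imaginary part. As the Fourier coefficients are real, only the sines survive
  in that imaginary part.\<close>

lemma max_partial_sum_ge_sine_sum:
  assumes "m \<ge> 2" and real: "\<And>h. fourier_mod m \<phi> h \<in> \<real>"
  shows "(\<Sum>h\<in>freqs m. sine_coeff m h * Re (fourier_mod m \<phi> h)) \<le> max_partial_sum m \<phi> / sqrt (real m)"
proof -
  let ?q = "sqrt (real m)" and ?I = "{0..int (m div 2)}"
  have m: "m > 0" and x: "int (m div 2) < int m" using assms by auto
  have re: "fourier_mod m \<phi> h = of_real (Re (fourier_mod m \<phi> h))" for h
    using real[of h] by (simp add: of_real_Re)
  have im: "Im (e_mod m (- (h * n))) = - sin (2 * pi * of_int h * of_int n / of_nat m)" for h n
    by (simp add: e_mod_def Im_exp algebra_simps Re_divide Im_divide power2_eq_square)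
  have "Im (\<Sum>n\<in>?I. \<phi> n) = (\<Sum>n\<in>?I. \<Sum>h\<in>insert 0 (freqs m). - (Re (fourier_mod m \<phi> h) * sin (2 * pi * of_int h * of_int n / of_nat m) / ?q))"
    unfolding Im_sum
  proof (rule sum.cong[OF refl])
    fix n assume n: "n \<in> ?I"
    have "Im (\<phi> n) = Im ((\<Sum>h\<in>insert 0 (freqs m). of_real (Re (fourier_mod m \<phi> h)) * e_mod m (- (h * n))) / of_real ?q)"
      using n x by (subst fourier_inversion[OF m, of n \<phi>], simp, simp) (subst re, rule refl)
    also have "\<dots> = (\<Sum>h\<in>insert 0 (freqs m). - (Re (fourier_mod m \<phi> h) * sin (2 * pi * of_int h * of_int n / of_nat m) / ?q))"
      unfolding sum_divide_distrib Im_sum by (intro sum.cong refl) (simp add: im)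
    finally show "Im (\<phi> n) = \<dots>" .
  qed
  also have "\<dots> = (\<Sum>h\<in>insert 0 (freqs m). \<Sum>n\<in>?I. - (Re (fourier_mod m \<phi> h) * sin (2 * pi * of_int h * of_int n / of_nat m) / ?q))"
    by (rule sum.swap)
  also have "\<dots> = (\<Sum>h\<in>insert 0 (freqs m). - ?q * (sine_coeff m h * Re (fourier_mod m \<phi> h)))"
  proof (rule sum.cong[OF refl])
    fix h
    have "?q * ?q = m" by simp
    hence "m / ?q = ?q" using m by (simp add: field_simps del: real_sqrt_mult_self)
    thus "(\<Sum>n\<in>?I. - (Re (fourier_mod m \<phi> h) * sin (2 * pi * of_int h * of_int n / of_nat m) / ?q))
      = - ?q * (sine_coeff m h * Re (fourier_mod m \<phi> h))"
      using m by (simp add: sine_coeff_def sum_negf sum_distrib_left[symmetric] sum_divide_distrib[symmetric] field_simps)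
  qed
  also have "\<dots> = - ?q * (\<Sum>h\<in>freqs m. sine_coeff m h * Re (fourier_mod m \<phi> h))"
    using finite_freqs[of m] by (subst sum.insert) (auto simp: freqs_def sine_coeff_def sum_distrib_left)
  finally have "?q * (\<Sum>h\<in>freqs m. sine_coeff m h * Re (fourier_mod m \<phi> h)) = - Im (\<Sum>n\<in>?I. \<phi> n)" by simp
  also have "\<dots> \<le> cmod (\<Sum>n\<in>?I. \<phi> n)"
    using abs_Im_le_cmod[of "\<Sum>n\<in>?I. \<phi> n"] by linarith
  also have "\<dots> \<le> max_partial_sum m \<phi>"
    unfolding max_partial_sum_def using x by (intro Max_ge) auto
  finally show ?thesis using m by (simp add: field_simps)
qed

section \<open>Closed form and approximation of the sine coefficients\<close>

lemma sum_sin_telescope: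
  "2 * sin (\<theta> / 2) * (\<Sum>n\<in>{0..int x}. sin (of_int n * \<theta>)) = cos (\<theta> / 2) - cos ((real x + 1 / 2) * \<theta>)"
proof (induction x)
  case (Suc x)
  have "{0..int (Suc x)} = insert (int (Suc x)) {0..int x}" by auto
  hence "2 * sin (\<theta> / 2) * (\<Sum>n\<in>{0..int (Suc x)}. sin (of_int n * \<theta>))
     = 2 * (sin (\<theta> / 2) * sin (real (Suc x) * \<theta>)) + (cos (\<theta> / 2) - cos ((real x + 1 / 2) * \<theta>))"
    unfolding Suc.IH[symmetric] by (simp add: algebra_simps)
  also have "2 * (sin (\<theta> / 2) * sin (real (Suc x) * \<theta>)) =
     cos ((real x + 1 / 2) * \<theta>) - cos ((real (Suc x) + 1 / 2) * \<theta>)"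
  proof -
    have "\<theta> / 2 - real (Suc x) * \<theta> = - ((real x + 1 / 2) * \<theta>)" by (simp add: algebra_simps)
    moreover have "\<theta> / 2 + real (Suc x) * \<theta> = (real (Suc x) + 1 / 2) * \<theta>" by (simp add: algebra_simps)
    ultimately show ?thesis unfolding sin_times_sin by simp
  qed
  finally show ?case by simp
qed simp

lemma sin_ge_cubic:
  fixes u :: real
  assumes "0 \<le> u"
  shows "u - u ^ 3 / 6 \<le> sin u"
proof -
  have c: "1 - x\<^sup>2 / 2 \<le> cos x" if "0 \<le> x" for x :: real
  proof -
    have "\<exists>d. ((\<lambda>x. cos x - 1 + x\<^sup>2 / 2) has_real_derivative d) (at t) \<and> 0 \<le> d" if "0 \<le> t" for t :: real
      by (rule exI[of _ "- sin t + t"]) (use sin_x_le_x[OF that] in \<open>auto intro!: derivative_eq_intros\<close>)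
    thus ?thesis using DERIV_nonneg_imp_nondecreasing[OF that, of "\<lambda>x. cos x - 1 + x\<^sup>2 / 2"] by force
  qed
  have "\<exists>d. ((\<lambda>x. sin x - x + x ^ 3 / 6) has_real_derivative d) (at t) \<and> 0 \<le> d" if "0 \<le> t" for t :: real
    by (rule exI[of _ "cos t - 1 + t\<^sup>2 / 2"]) (use c[OF that] in \<open>auto intro!: derivative_eq_intros\<close>)
  thus ?thesis using DERIV_nonneg_imp_nondecreasing[OF assms, of "\<lambda>x. sin x - x + x ^ 3 / 6"] by force
qed

lemma sin_ge_half:
  fixes u :: real
  assumes "0 \<le> u" "u \<le> pi / 2"
  shows "u / 2 \<le> sin u"
proof -
  have "u \<le> 8/5" using assms pi_less_4 pi_approx by (simp add: field_simps)
  hence "u * u \<le> (8/5) * (8/5)" using assms by (intro mult_mono) auto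
  hence "u * (u * u) \<le> u * 3" using assms by (intro mult_left_mono) auto
  hence "u ^ 3 \<le> 3 * u" by (simp add: power3_eq_cube mult.assoc mult.commute)
  thus ?thesis using sin_ge_cubic[OF assms(1)] by simp
qed

lemma abs_inverse_sin_minus_inverse_le:
  fixes u :: real
  assumes "u \<noteq> 0" "\<bar>u\<bar> \<le> pi / 2"
  shows "\<bar>1 / sin u - 1 / u\<bar> \<le> 1"
proof -
  have pos: "\<bar>1 / sin v - 1 / v\<bar> \<le> 1" if "0 < v" "v \<le> pi / 2" for v :: real
  proof -
    have s: "v / 2 \<le> sin v" "sin v \<le> v" "v - sin v \<le> v ^ 3 / 6"
      using that sin_ge_half[of v] sin_x_le_x[of v] sin_ge_cubic[of v] by auto
    have "v \<le> 3" using that pi_less_4 by linarith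
    have "v - sin v \<le> v * (v * (v / 6))" using s(3) by (simp add: power3_eq_cube)
    also have "\<dots> \<le> v * (v * (1 / 2))" using that \<open>v \<le> 3\<close> by (intro mult_left_mono) auto
    also have "\<dots> \<le> v * sin v" using s(1) that by (intro mult_left_mono) auto
    finally have "(v - sin v) / (v * sin v) \<le> 1" using that s by (simp add: field_simps)
    moreover have "1 / sin v - 1 / v = (v - sin v) / (v * sin v)"
      using that s by (simp add: field_simps)
    moreover have "(v - sin v) / (v * sin v) \<ge> 0" using that s by simp
    ultimately show ?thesis by simp
  qed
  show ?thesis
  proof (cases "u > 0")
    case False
    thus ?thesis using pos[of "-u"] assms by (simp add: abs_minus_commute)
  qed (use pos[of u] assms in auto)
qed

lemma abs_cos_diff_le: "\<bar>cos x - cos y\<bar> \<le> \<bar>x - y\<bar>" for x y :: real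
proof -
  have "cos x - cos y = 2 * (sin ((x + y) / 2) * sin ((y - x) / 2))"
    by (simp add: cos_diff_cos)
  hence "\<bar>cos x - cos y\<bar> = 2 * (\<bar>sin ((x + y) / 2)\<bar> * \<bar>sin ((y - x) / 2)\<bar>)"
    by (simp add: abs_mult)
  also have "\<dots> \<le> 2 * (1 * \<bar>(y - x) / 2\<bar>)"
    by (intro mult_left_mono mult_mono abs_sin_x_le_abs_x) auto
  finally show ?thesis by simp
qed

text \<open>The telescoped sum is a difference of cosines over
  \<open>2 * sin (\<theta> / 2)\<close>. Its upper angle lies within
  \<open>\<bar>\<theta>\<bar> / 2\<close> of \<open>\<pi> h\<close>, so the numerator is
  \<open>1 - (-1)^h\<close> up to \<open>\<bar>\<theta>\<bar>\<close>, which is why even frequencies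
  drop out. Replacing \<open>1 / sin (\<theta> / 2)\<close> by \<open>2 / \<theta>\<close> costs at
  most 1, and the remainder over the sine at most 2.\<close>

lemma sine_coeff_approx:
  assumes "m > 0" "h \<in> freqs m"
  shows "\<bar>sine_coeff m h - (if odd h then 1 / (pi * of_int h) else 0)\<bar> \<le> 3 / m"
proof -
  define \<theta> where "\<theta> = 2 * pi * of_int h / m"
  define x where "x = m div 2"
  define I :: real where "I = (if odd h then 1 else 0)"
  have h: "h \<noteq> 0" "\<bar>real_of_int h\<bar> \<le> real m / 2" using assms freqs_abs_le by (auto simp: freqs_def)
  have \<theta>0: "\<theta> \<noteq> 0" using h assms by (simp add: \<theta>_def)
  have \<theta>: "\<bar>\<theta> / 2\<bar> = pi * (\<bar>real_of_int h\<bar> / m)" using assms by (simp add: \<theta>_def abs_mult)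
  also have "\<dots> \<le> pi * (1 / 2)" using h assms by (intro mult_left_mono) (auto simp: field_simps)
  finally have \<theta>2: "\<bar>\<theta> / 2\<bar> \<le> pi / 2" by simp
  have sge: "\<bar>\<theta>\<bar> / 4 \<le> \<bar>sin (\<theta> / 2)\<bar>"
    using sin_ge_half[of "\<theta> / 2"] sin_ge_half[of "- \<theta> / 2"] \<theta>2 by (cases "\<theta> > 0") (auto simp: abs_if)
  have s0: "sin (\<theta> / 2) \<noteq> 0" using sge \<theta>0 by auto
  define D where "D = (\<Sum>n\<in>{0..int x}. sin (of_int n * \<theta>))"
  have D: "D = (cos (\<theta> / 2) - cos ((real x + 1 / 2) * \<theta>)) / (2 * sin (\<theta> / 2))"
    using sum_sin_telescope[of \<theta> x] s0 by (simp add: D_def field_simps)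
  have cosh: "cos (pi * real_of_int h) = 1 - 2 * I"
    by (cases "even h") (auto simp: I_def elim!: evenE oddE simp: algebra_simps cos_add) 
  \<comment> \<open>The first case is odd \<open>m\<close>, the second even \<open>m\<close>; either
    way the upper angle misses \<open>\<pi> h\<close> by at most half a step
    \<open>\<theta>\<close>.\<close>
  have "2 * x + 1 = m \<or> 2 * x + 1 = m + 1" unfolding x_def by presburger
  hence "\<bar>2 * real x + 1 - real m\<bar> \<le> 1" by auto
  moreover have "(real x + 1 / 2) * \<theta> - pi * of_int h = (2 * real x + 1 - real m) * (\<theta> / 2)"
    using assms by (simp add: \<theta>_def field_simps)
  ultimately have ang: "\<bar>(real x + 1 / 2) * \<theta> - pi * of_int h\<bar> \<le> \<bar>\<theta>\<bar> / 2"
    using mult_right_mono[of "\<bar>2 * real x + 1 - real m\<bar>" 1 "\<bar>\<theta> / 2\<bar>"] by (simp only: abs_mult) simp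
  define R where "R = cos (\<theta> / 2) - cos ((real x + 1 / 2) * \<theta>) - 2 * I"
  have "R = (cos (\<theta> / 2) - cos 0) - (cos ((real x + 1 / 2) * \<theta>) - cos (pi * of_int h))"
    unfolding R_def cosh by simp
  hence R: "\<bar>R\<bar> \<le> \<bar>\<theta>\<bar>"
    using abs_cos_diff_le[of "\<theta> / 2" 0] abs_cos_diff_le[of "(real x + 1 / 2) * \<theta>" "pi * of_int h"] ang
    by linarith
  have "D = I * (1 / sin (\<theta> / 2)) + R / (2 * sin (\<theta> / 2))"
    unfolding D R_def using s0 by (simp add: field_simps)
  hence "D - I * (2 / \<theta>) = I * (1 / sin (\<theta> / 2) - 1 / (\<theta> / 2)) + R / (2 * sin (\<theta> / 2))"
    by (simp add: algebra_simps)
  also have "\<bar>\<dots>\<bar> \<le> 1 + 2"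
  proof (rule order_trans[OF abs_triangle_ineq add_mono])
    show "\<bar>I * (1 / sin (\<theta> / 2) - 1 / (\<theta> / 2))\<bar> \<le> 1"
      using abs_inverse_sin_minus_inverse_le[of "\<theta> / 2"] \<theta>0 \<theta>2 by (auto simp: I_def)
    show "\<bar>R / (2 * sin (\<theta> / 2))\<bar> \<le> 2"
      using R sge s0 by (simp add: abs_mult field_simps)
  qed
  finally have "\<bar>D - I * (2 / \<theta>)\<bar> \<le> 3" by simp
  moreover have "sine_coeff m h = D / m"
    unfolding sine_coeff_def D_def x_def by (simp add: \<theta>_def mult_ac)
  moreover have "(if odd h then 1 / (pi * of_int h) else 0) = I * (2 / \<theta>) / m"
    using assms by (simp add: I_def \<theta>_def)
  ultimately have "sine_coeff m h - (if odd h then 1 / (pi * of_int h) else 0) = (D - I * (2 / \<theta>)) / m"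
    by (simp only: diff_divide_distrib)
  thus ?thesis using \<open>\<bar>D - I * (2 / \<theta>)\<bar> \<le> 3\<close> assms by (simp add: divide_right_mono)
qed

text \<open>Because \<open>\<bar>h\<bar> \<le> m / 2\<close>, the error \<open>3 / m\<close> is
  itself \<open>O(1 / \<bar>h\<bar>)\<close>. This decay is what remains useful for large
  \<open>h\<close>, where the approximation by \<open>1 / (\<pi> h)\<close> carries no
  information.\<close>

lemma sine_coeff_abs_le:
  assumes "h \<in> freqs m"
  shows "\<bar>sine_coeff m h\<bar> \<le> 2 / \<bar>real_of_int h\<bar>"
proof -
  have h: "h \<noteq> 0" "\<bar>real_of_int h\<bar> \<le> real m / 2" using assms freqs_abs_le by (auto simp: freqs_def)
  have h1: "\<bar>real_of_int h\<bar> \<ge> 1" using h(1) by linarith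
  hence m: "m > 0" using h by (cases m) auto
  have "\<bar>if odd h then 1 / (pi * of_int h) else 0\<bar> \<le> (1/2) / \<bar>real_of_int h\<bar>"
    using pi_gt3 h1 by (auto simp: abs_mult field_simps intro: mult_mono)
  moreover have "3 / real m \<le> (3/2) / \<bar>real_of_int h\<bar>"
    using h h1 m by (simp add: field_simps)
  ultimately show ?thesis using sine_coeff_approx[OF m assms] by (simp add: field_simps)
qed

subsection \<open>Sums of monotone functions over odd harmonic points\<close>

lemma lint_inverse_square:
  fixes x y :: real
  assumes "0 < x" "x \<le> y"
  shows "set_integrable lborel {x..y} (\<lambda>v. c / v\<^sup>2)"
    and "(LINT v:{x..y}|lborel. c / v\<^sup>2) = c * (1 / x - 1 / y)"
proof -
  have "has_bochner_integral lborel (\<lambda>v. (1 / v\<^sup>2) * indicator {x..y} v) ((- 1 / y) - (- 1 / x))"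
    using assms
    by (intro has_bochner_integral_FTC_Icc_nonneg)
       (auto intro!: derivative_eq_intros simp: power2_eq_square)
  hence "has_bochner_integral lborel (\<lambda>v. c * ((1 / v\<^sup>2) * indicator {x..y} v)) (c * (1 / x - 1 / y))"
    using has_bochner_integral_mult_right[of c lborel "\<lambda>v. (1 / v\<^sup>2) * indicator {x..y} v"] by simp
  hence "has_bochner_integral lborel (\<lambda>v. indicator {x..y} v *\<^sub>R (c / v\<^sup>2)) (c * (1 / x - 1 / y))"
    by (simp add: mult_ac)
  thus "set_integrable lborel {x..y} (\<lambda>v. c / v\<^sup>2)"
    and "(LINT v:{x..y}|lborel. c / v\<^sup>2) = c * (1 / x - 1 / y)"
    unfolding set_integrable_def set_lebesgue_integral_def
    by (auto simp: has_bochner_integral_iff)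
qed

lemma lint_log_over_square:
  fixes a :: real
  assumes "1 \<le> a"
  shows "set_integrable lborel {a..} (\<lambda>v. c * (1 + ln v) / v\<^sup>2)"
    and "(LINT v:{a..}|lborel. c * (1 + ln v) / v\<^sup>2) = c * (2 + ln a) / a"
proof -
  let ?f = "\<lambda>v::real. (1 + ln v) / v\<^sup>2 * indicator {1..} v"
  have "(\<integral>\<^sup>+v. ennreal (?f v) * indicator {a..} v \<partial>lborel) = ennreal ((2 + ln a) / a)"
  proof (rule trans[OF nn_integral_FTC_atLeast[where T = 0 and F = "\<lambda>v. - (2 + ln v) / v"]])
    show "ennreal (0 - - (2 + ln a) / a) = ennreal ((2 + ln a) / a)" by (simp only: minus_divide_left minus_minus diff_0)
    show "?f \<in> borel_measurable borel" by measurable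
    show "((\<lambda>v. - (2 + ln v) / v) has_real_derivative ?f v) (at v)" if "a \<le> v" for v
      using that assms
      by (auto intro!: derivative_eq_intros simp: power2_eq_square field_simps)
    show "0 \<le> ?f v" if "a \<le> v" for v using that assms by auto
    show "((\<lambda>v. - (2 + ln v) / v) \<longlongrightarrow> (0::real)) at_top" by real_asymp
  qed
  also have "(\<integral>\<^sup>+v. ennreal (?f v) * indicator {a..} v \<partial>lborel)
     = (\<integral>\<^sup>+v. ennreal (indicator {a..} v *\<^sub>R ((1 + ln v) / v\<^sup>2)) \<partial>lborel)"
    using assms by (intro nn_integral_cong) (auto simp: indicator_def)
  finally have "has_bochner_integral lborel (\<lambda>v. indicator {a..} v *\<^sub>R ((1 + ln v) / v\<^sup>2)) ((2 + ln a) / a)"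
    using assms by (intro has_bochner_integral_nn_integral) (auto simp: indicator_def)
  hence "has_bochner_integral lborel (\<lambda>v. c * (indicator {a..} v *\<^sub>R ((1 + ln v) / v\<^sup>2))) (c * ((2 + ln a) / a))"
    by (rule has_bochner_integral_mult_right)
  hence "has_bochner_integral lborel (\<lambda>v. indicator {a..} v *\<^sub>R (c * (1 + ln v) / v\<^sup>2)) (c * (2 + ln a) / a)"
    by (simp add: mult_ac)
  thus "set_integrable lborel {a..} (\<lambda>v. c * (1 + ln v) / v\<^sup>2)"
    and "(LINT v:{a..}|lborel. c * (1 + ln v) / v\<^sup>2) = c * (2 + ln a) / a"
    unfolding set_integrable_def set_lebesgue_integral_def
    by (auto simp: has_bochner_integral_iff)
qed

lemma set_integrable_const_Ioo: "set_integrable lborel {x<..<y::real} (\<lambda>_. c::real)"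
  unfolding set_integrable_def by (intro integrable_scaleR_left integrable_real_indicator emeasure_bounded_finite) auto

lemma lint_const_Ioo: "x \<le> y \<Longrightarrow> (LINT v:{x<..<y::real}|lborel. (c::real)) = c * (y - x)"
  unfolding set_lebesgue_integral_def by simp

text \<open>The weight \<open>1 / v\<^sup>2\<close> is the density of the points
  \<open>a / (2 j + 1)\<close>: substituting \<open>v = a / (2 t + 1)\<close> turns
  \<open>dt\<close> into \<open>a / 2\<close> times \<open>dv / v\<^sup>2\<close>. The bounds
  \<open>small\<close> and \<open>large\<close> make the integral converge at 0 and at infinity, and
  keep the discretisation error logarithmic in \<open>a\<close>.\<close>

locale mono_over_square =
  fixes \<phi> :: "real \<Rightarrow> real" and B C :: real
  assumes mono: "mono \<phi>" and nonneg: "\<And>v. 0 \<le> \<phi> v"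
    and small: "\<And>v. 0 < v \<Longrightarrow> v < 1 \<Longrightarrow> \<phi> v \<le> B * v\<^sup>2"
    and large: "\<And>v. 1 \<le> v \<Longrightarrow> \<phi> v \<le> C * (1 + ln v)"
begin

lemma measurable [measurable]: "\<phi> \<in> borel_measurable borel"
  using mono by (rule borel_measurable_mono)

lemma C_nonneg: "0 \<le> C" using large[of 1] nonneg[of 1] by simp
lemma B_nonneg: "0 \<le> B" using small[of "1/2"] nonneg[of "1/2"] by (simp add: power2_eq_square)

lemma set_integrable: "set_integrable lborel {0<..} (\<lambda>v. \<phi> v / v\<^sup>2)"
proof -
  have "set_integrable lborel {0<..<1} (\<lambda>v. \<phi> v / v\<^sup>2)"
  proof (rule set_integrable_bound[OF set_integrable_const_Ioo[of 0 1 B]])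
    show "set_borel_measurable lborel {0<..<1} (\<lambda>v. \<phi> v / v\<^sup>2)"
      unfolding set_borel_measurable_def by measurable
    show "AE x in lborel. x \<in> {0<..<1} \<longrightarrow> norm (\<phi> x / x\<^sup>2) \<le> norm B"
      using small nonneg B_nonneg by (intro AE_I2) (auto simp: field_simps)
  qed
  moreover have "set_integrable lborel {1..} (\<lambda>v. \<phi> v / v\<^sup>2)"
  proof (rule set_integrable_bound[OF lint_log_over_square(1)[of 1 C]])
    show "set_borel_measurable lborel {1..} (\<lambda>v. \<phi> v / v\<^sup>2)"
      unfolding set_borel_measurable_def by measurable
    show "AE x in lborel. x \<in> {1..} \<longrightarrow> norm (\<phi> x / x\<^sup>2) \<le> norm (C * (1 + ln x) / x\<^sup>2)"
      using large nonneg C_nonneg by (intro AE_I2) (auto intro!: divide_right_mono)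
  qed simp
  ultimately have "set_integrable lborel ({0<..<1} \<union> {1..}) (\<lambda>v. \<phi> v / v\<^sup>2)"
    by (rule set_integrable_Un) auto
  moreover have "{0<..<1} \<union> {1..} = {0::real<..}" by auto
  ultimately show ?thesis by simp
qed

lemma set_integrable_sub: "A \<subseteq> {0<..} \<Longrightarrow> A \<in> sets borel \<Longrightarrow> set_integrable lborel A (\<lambda>v. \<phi> v / v\<^sup>2)"
  by (rule set_integrable_subset[OF set_integrable]) auto

text \<open>Between two consecutive points the integral of \<open>1 / v\<^sup>2\<close> is exactly
  \<open>2 / a\<close>, so by monotonicity the scaled integral over that interval lies between the
  values of \<open>\<phi>\<close> at its end points. The two sums are the resulting Riemann sums,
  one shifted by an index.\<close>

lemma sum_vs_integral_finite:
  assumes a: "a > 0"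
  shows "(a / 2) * (LINT v:{a / (2 * real n + 1)..a}|lborel. \<phi> v / v\<^sup>2) \<le> (\<Sum>j<n. \<phi> (a / (2 * real j + 1)))"
    and "(\<Sum>j<n. \<phi> (a / (2 * real (Suc j) + 1))) \<le> (a / 2) * (LINT v:{a / (2 * real n + 1)..a}|lborel. \<phi> v / v\<^sup>2)"
proof (induction n)
  case 0
  have "(LINT v:{a..a}|lborel. \<phi> v / v\<^sup>2) = 0"
    unfolding set_lebesgue_integral_def using AE_lborel_singleton[of a]
    by (intro integral_eq_zero_AE) (auto elim!: eventually_mono)
  thus "(a / 2) * (LINT v:{a / (2 * real 0 + 1)..a}|lborel. \<phi> v / v\<^sup>2) \<le> (\<Sum>j<0. \<phi> (a / (2 * real j + 1)))"
    and "(\<Sum>j<0. \<phi> (a / (2 * real (Suc j) + 1))) \<le> (a / 2) * (LINT v:{a / (2 * real 0 + 1)..a}|lborel. \<phi> v / v\<^sup>2)"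
    by auto
next
  case (Suc n)
  define x y where "x = a / (2 * real (Suc n) + 1)" and "y = a / (2 * real n + 1)"
  have xy: "0 < x" "x \<le> y" "y \<le> a" using a by (auto simp: x_def y_def field_simps)
  have d: "1 / x - 1 / y = 2 / a" using a by (simp add: x_def y_def field_simps)
  let ?L = "\<lambda>A. LINT v:A|lborel. \<phi> v / v\<^sup>2"
  have "{x..a} = {x..y} \<union> {y..a}" using xy by auto
  hence split: "?L {x..a} = ?L {x..y} + ?L {y..a}"
  proof -
    have "AE v in lborel. \<not> (v \<in> {x..y} \<and> v \<in> {y..a})"
      using AE_lborel_singleton[of y] by (auto elim!: eventually_mono)
    hence "?L ({x..y} \<union> {y..a}) = ?L {x..y} + ?L {y..a}"
      using xy by (intro set_integral_Un_AE set_integrable_sub) auto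
    thus ?thesis using \<open>{x..a} = {x..y} \<union> {y..a}\<close> by metis
  qed
  have "?L {x..y} \<le> (LINT v:{x..y}|lborel. \<phi> y / v\<^sup>2)"
    using xy monoD[OF mono] by (intro set_integral_mono set_integrable_sub lint_inverse_square) (auto intro!: divide_right_mono)
  also have "\<dots> = \<phi> y * (2 / a)" using xy d by (simp only: lint_inverse_square)
  finally have up: "(a / 2) * ?L {x..y} \<le> \<phi> y" using a by (simp add: field_simps)
  have "\<phi> x * (2 / a) = (LINT v:{x..y}|lborel. \<phi> x / v\<^sup>2)" using xy d by (simp only: lint_inverse_square)
  also have "\<dots> \<le> ?L {x..y}"
    using xy monoD[OF mono] by (intro set_integral_mono set_integrable_sub lint_inverse_square) (auto intro!: divide_right_mono)
  finally have lo: "\<phi> x \<le> (a / 2) * ?L {x..y}" using a by (simp add: field_simps)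
  show "(a / 2) * (LINT v:{a / (2 * real (Suc n) + 1)..a}|lborel. \<phi> v / v\<^sup>2) \<le> (\<Sum>j<Suc n. \<phi> (a / (2 * real j + 1)))"
    using Suc(1) up split unfolding x_def[symmetric] sum.lessThan_Suc y_def[symmetric] by (simp add: distrib_left)
  show "(\<Sum>j<Suc n. \<phi> (a / (2 * real (Suc j) + 1))) \<le> (a / 2) * (LINT v:{a / (2 * real (Suc n) + 1)..a}|lborel. \<phi> v / v\<^sup>2)"
    using Suc(2) lo split unfolding sum.lessThan_Suc x_def[symmetric] y_def[symmetric] by (simp add: distrib_left)
qed

text \<open>Three errors arise: the piece beyond \<open>a\<close> and the boundary term
  \<open>\<phi> a\<close>, both \<open>O(1 + ln a)\<close> by \<open>large\<close>, and the piece
  below the last point \<open>y\<close>. The condition \<open>a\<^sup>2 \<le> n\<close> forces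
  \<open>a * y \<le> 1\<close>, which makes that last piece \<open>O(B)\<close> by
  \<open>small\<close>.\<close>

lemma sum_vs_integral:
  assumes a: "1 \<le> a" and n: "a\<^sup>2 \<le> real n"
  shows "\<bar>(\<Sum>j<n. \<phi> (a / (2 * real j + 1))) - (a / 2) * (LINT v:{0<..}|lborel. \<phi> v / v\<^sup>2)\<bar>
     \<le> 2 * C * (1 + ln a) + B"
proof -
  let ?L = "\<lambda>A. LINT v:A|lborel. \<phi> v / v\<^sup>2"
  define y where "y = a / (2 * real n + 1)"
  have "a * 1 \<le> a * a" using a by (intro mult_left_mono) auto
  hence "a \<le> real n" using n by (simp add: power2_eq_square)
  hence y: "0 < y" "y < 1" "y \<le> a" "a * y \<le> 1" 
    using a n by (auto simp: y_def field_simps power2_eq_square)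
  have "{0<..} = {0<..<y} \<union> {y..a} \<union> {a<..}" using y a by auto
  hence "?L {0<..} = ?L ({0<..<y} \<union> {y..a} \<union> {a<..})" by (rule arg_cong)
  also have "\<dots> = ?L ({0<..<y} \<union> {y..a}) + ?L {a<..}"
    using y a by (intro set_integral_Un set_integrable_sub) auto
  also have "?L ({0<..<y} \<union> {y..a}) = ?L {0<..<y} + ?L {y..a}"
    using y a by (intro set_integral_Un set_integrable_sub) auto
  finally have split: "?L {0<..} = ?L {0<..<y} + ?L {y..a} + ?L {a<..}" .
  have "?L {0<..<y} \<le> (LINT v:{0<..<y}|lborel. B)"
    using y small by (intro set_integral_mono set_integrable_sub set_integrable_const_Ioo) (auto simp: field_simps)
  also have "\<dots> = B * y" using y by (simp add: lint_const_Ioo)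
  finally have "a * ?L {0<..<y} \<le> B * (a * y)" using a by (simp add: field_simps)
  also have "\<dots> \<le> B * 1" using y B_nonneg by (intro mult_left_mono)
  finally have 1: "a * ?L {0<..<y} \<le> B" by simp
  have "?L {a<..} \<le> (LINT v:{a<..}|lborel. C * (1 + ln v) / v\<^sup>2)"
    using a large
    by (intro set_integral_mono set_integrable_sub set_integrable_subset[OF lint_log_over_square(1)[OF a]])
       (auto intro!: divide_right_mono)
  also have "\<dots> = (LINT v:{a..}|lborel. C * (1 + ln v) / v\<^sup>2)"
    unfolding set_lebesgue_integral_def using AE_lborel_singleton[of a]
    by (intro integral_cong_AE) (auto simp: indicator_def elim!: eventually_mono)
  also have "\<dots> = C * (2 + ln a) / a" by (rule lint_log_over_square(2)[OF a])
  finally have 2: "a * ?L {a<..} \<le> C * (2 + ln a)" using a by (simp add: field_simps)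
  have nn: "0 \<le> ?L A" for A
    unfolding set_lebesgue_integral_def using nonneg by (intro integral_nonneg_AE AE_I2) auto
  have "(\<Sum>j<n. \<phi> (a / (2 * real j + 1))) \<le> (\<Sum>j<Suc n. \<phi> (a / (2 * real j + 1)))"
    using nonneg by simp
  also have "\<dots> = \<phi> a + (\<Sum>j<n. \<phi> (a / (2 * real (Suc j) + 1)))"
    by (subst sum.lessThan_Suc_shift) simp
  finally have up: "(\<Sum>j<n. \<phi> (a / (2 * real j + 1))) \<le> C * (1 + ln a) + (a / 2) * ?L {y..a}"
    using sum_vs_integral_finite(2)[of a n] large[OF a] a unfolding y_def by linarith
  have lo: "(a / 2) * ?L {y..a} \<le> (\<Sum>j<n. \<phi> (a / (2 * real j + 1)))"
    using sum_vs_integral_finite(1)[of a n] a unfolding y_def by linarith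
  have A: "2 * ((a / 2) * ?L {0<..}) = 2 * ((a / 2) * ?L {y..a}) + a * ?L {0<..<y} + a * ?L {a<..}"
    unfolding split by (simp add: algebra_simps)
  have p: "0 \<le> a * ?L {0<..<y}" "0 \<le> a * ?L {a<..}" using nn a by auto
  have q: "0 \<le> C * ln a" using C_nonneg a by simp
  have "C * (2 + ln a) = 2 * C + C * ln a" "C * (1 + ln a) = C + C * ln a"
    "2 * C * (1 + ln a) = 2 * C + 2 * (C * ln a)" by (auto simp: algebra_simps)
  note eqs = this
  have lin: "\<bar>S - Z\<bar> \<le> 2 * c + 2 * l + B"
    if "2 * Z = 2 * Y + p + q" "0 \<le> p" "0 \<le> q" "p \<le> B" "q \<le> 2 * c + l" "S \<le> c + l + Y" "Y \<le> S" "0 \<le> l" "0 \<le> c"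
    for S Z Y p q c l :: real
    using that by linarith
  show ?thesis
    using lin[OF A p 1 2[unfolded eqs(1)] up[unfolded eqs(2)] lo q C_nonneg] unfolding eqs(3) .
qed

end

section \<open>Odd harmonic sums and the asymptotics for an abstract cumulant generating
  function\<close>

lemma odd_harmonic_eq: "(\<Sum>j<k. 1 / (2 * real j + 1)) = harm (2 * k) - harm k / 2"
proof (induction k)
  case (Suc k)
  have "harm (2 * Suc k) = harm (2 * k) + 1 / (2 * real k + 1) + 1 / (2 * (real k + 1))"
    by (simp add: harm_Suc inverse_eq_divide add_ac)
  moreover have "harm (Suc k) / 2 = harm k / 2 + 1 / (2 * (real k + 1))"
    by (simp add: harm_Suc inverse_eq_divide add_divide_distrib add_ac)
  ultimately show ?case using Suc.IH unfolding sum.lessThan_Suc by linarith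
qed (simp add: harm_expand)

text \<open>Here \<open>k\<close> is the number of odd integers up to \<open>a\<close>. In
  \<open>harm (2 * k) - harm k / 2\<close> half of the Euler-Mascheroni constant survives, and the
  logarithms combine to \<open>ln (2 * a) / 2\<close> because \<open>2 * k + 1\<close> and
  \<open>2 * (k + 1)\<close> both differ from \<open>a\<close> by a bounded amount.\<close>

lemma odd_harmonic_approx:
  fixes a :: real
  assumes "a \<ge> 1" "2 * real k - 1 \<le> a" "a < 2 * real k + 1"
  shows "\<bar>(\<Sum>j<k. 1 / (2 * real j + 1)) - (ln (2 * a) + euler_mascheroni) / 2\<bar> \<le> 2 / a"
proof -
  have k: "k \<ge> 1" using assms by (cases k) auto
  define e where "e = (\<lambda>k. ln (real k + 1) + euler_mascheroni - harm k)"
  have e: "0 \<le> e k" "e k \<le> 1 / (2 * real k)" if "1 \<le> k" for k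
  proof -
    obtain n where n: "k = Suc n" using \<open>1 \<le> k\<close> by (metis not0_implies_Suc not_one_le_zero)
    have "0 \<le> 1 / real (2 * (n + 2))" by simp
    hence "harm (Suc n) - ln (real (n + 2)) \<le> euler_mascheroni"
      using euler_mascheroni_lower[of n] by linarith
    thus "0 \<le> e k" unfolding e_def n by (simp add: add_ac)
    show "e k \<le> 1 / (2 * real k)"
      using euler_mascheroni_upper[of n] unfolding e_def n by (simp add: add_ac)
  qed
  define x where "x = 2 * real k + 1"
  have x: "x > 0" "x \<le> a + 2" "a < x" "x \<ge> 3" using assms k by (auto simp: x_def)
  have h: "harm (2 * k) - harm k / 2 - (ln (2 * a) + euler_mascheroni) / 2
     = ln x - ln (real k + 1) / 2 - ln (2 * a) / 2 + (e k / 2 - e (2 * k))"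
    by (simp add: e_def x_def field_simps)
  have "ln (real k + 1) + ln (2 * a) = ln ((x + 1) * a)"
    using assms x by (subst ln_mult_pos[symmetric]) (auto simp: x_def algebra_simps)
  also have "\<dots> = ln (x + 1) + ln a" using assms x by (simp add: ln_mult_pos)
  finally have l: "ln x - ln (real k + 1) / 2 - ln (2 * a) / 2 = ((ln x - ln (x + 1)) + (ln x - ln a)) / 2"
    by (simp add: field_simps)
  have "ln (x + 1) - ln x \<le> (x + 1 - x) / x" using x by (intro ln_diff_le) auto
  also have "\<dots> \<le> 1 / a" using x assms by (simp add: field_simps)
  finally have 1: "ln (x + 1) - ln x \<le> 1 / a" .
  have 2: "ln x \<le> ln (x + 1)" "ln a \<le> ln x" using x assms by auto
  have "ln x - ln a \<le> (x - a) / a" using x assms by (intro ln_diff_le) auto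
  also have "\<dots> \<le> 2 / a" using x assms by (intro divide_right_mono) auto
  finally have 3: "ln x - ln a \<le> 2 / a" .
  have 4: "1 / (4 * real k) \<le> 1 / a"
    using assms k by (intro divide_left_mono mult_pos_pos) auto
  have e1: "0 \<le> e k" "e k / 2 \<le> 1 / (4 * real k)" using e[of k] k by auto
  have e2: "0 \<le> e (2 * k)" "e (2 * k) \<le> 1 / (4 * real k)" using e[of "2 * k"] k by auto
  show ?thesis unfolding odd_harmonic_eq h l using 1 2 3 4 e1 e2
    by (simp only: abs_le_iff) (auto simp: field_simps)
qed

text \<open>The hypotheses on \<open>g\<close> hold for the cumulant generating functions of both
  \<open>Y\<close> and \<open>- Y\<close>, so the lemma serves twice. For arguments at least 1 the
  linear part \<open>N * u\<close> is split off; it produces an odd harmonic sum and thus the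
  logarithm and the Euler-Mascheroni constant. What remains is \<open>f\<close>, whose sum becomes
  an integral up to a logarithmic error.\<close>

lemma odd_sum_cgf_asymptotics:
  fixes g :: "real \<Rightarrow> real" and N C :: real
  assumes N: "N > 0" and g0: "g 0 = 0"
    and mono: "\<And>x y. 0 \<le> x \<Longrightarrow> x \<le> y \<Longrightarrow> g x \<le> g y"
    and lip: "\<And>x y. 0 \<le> x \<Longrightarrow> x \<le> y \<Longrightarrow> g y - g x \<le> N * (y - x)"
    and quad: "\<And>x. 0 \<le> x \<Longrightarrow> g x \<le> N\<^sup>2 * x\<^sup>2 / 2"
    and tail: "\<And>x. 1 \<le> x \<Longrightarrow> N * x - g x \<le> C * (1 + ln x)"
  defines "f \<equiv> \<lambda>t. if t < 1 then g t else g t - N * t"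
  shows "set_integrable lborel {0<..} (\<lambda>u. f u / u\<^sup>2)"
    and "\<exists>C'. \<forall>a\<ge>1. \<forall>n. a\<^sup>2 \<le> real n \<longrightarrow>
      \<bar>(\<Sum>j<n. g (a / (2 * real j + 1))) - (N * a / 2 * (ln (2 * a) + euler_mascheroni)
          + a / 2 * (LINT u:{0<..}|lborel. f u / u\<^sup>2))\<bar> \<le> C' * (1 + ln a)"
proof -
  \<comment> \<open>\<open>f\<close> is neither monotone nor continuous at \<open>1\<close>; on \<open>u > 0\<close> it is the difference of the increasing functions \<open>f1\<close>, \<open>f2\<close>.\<close>
  define f1 where "f1 = (\<lambda>u. g (min (max u 0) 1))"
  define f2 where "f2 = (\<lambda>u. if u < 1 then 0 else g 1 + N * u - g u)"
  have g1: "0 \<le> g 1" "g 1 \<le> N" using mono[of 0 1] lip[of 0 1] g0 by auto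
  interpret f1: mono_over_square f1 "N\<^sup>2 / 2" N
  proof
    show "mono f1" unfolding f1_def by (intro monoI mono) auto
    show "0 \<le> f1 v" for v unfolding f1_def using mono[of 0 "min (max v 0) 1"] g0 by auto
    show "f1 v \<le> N\<^sup>2 / 2 * v\<^sup>2" if "0 < v" "v < 1" for v using quad[of v] that by (simp add: f1_def)
    show "f1 v \<le> N * (1 + ln v)" if "1 \<le> v" for v
    proof -
      have "f1 v = g 1" using that by (simp add: f1_def)
      also have "\<dots> \<le> N * 1" using g1 by simp
      also have "\<dots> \<le> N * (1 + ln v)" using N that by (intro mult_left_mono) auto
      finally show ?thesis .
    qed
  qed
  interpret f2: mono_over_square f2 0 "N + C"
  proof
    show "mono f2"
    proof
      fix x y :: real assume "x \<le> y"
      thus "f2 x \<le> f2 y" using lip[of x y] lip[of 1 y] g1 N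
        by (auto simp: f2_def algebra_simps)
    qed
    show "0 \<le> f2 v" for v using lip[of 1 v] N g1 by (auto simp: f2_def algebra_simps)
    show "f2 v \<le> 0 * v\<^sup>2" if "0 < v" "v < 1" for v using that by (simp add: f2_def)
    show "f2 v \<le> (N + C) * (1 + ln v)" if "1 \<le> v" for v
    proof -
      have "f2 v \<le> N * 1 + C * (1 + ln v)" using that tail[of v] g1 by (simp add: f2_def)
      also have "\<dots> \<le> N * (1 + ln v) + C * (1 + ln v)"
        using N that by (intro add_right_mono mult_left_mono) auto
      finally show ?thesis by (simp add: algebra_simps)
    qed
  qed
  have f: "f u / u\<^sup>2 = f1 u / u\<^sup>2 - f2 u / u\<^sup>2" if "u \<in> {0<..}" for u
    using that by (auto simp: f_def f1_def f2_def min_def max_def field_simps)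
  have "set_integrable lborel {0<..} (\<lambda>u. f1 u / u\<^sup>2 - f2 u / u\<^sup>2)"
    by (intro set_integral_diff f1.set_integrable f2.set_integrable)
  thus "set_integrable lborel {0<..} (\<lambda>u. f u / u\<^sup>2)"
    using f by (subst set_integrable_cong[OF refl refl f])
  define J1 where "J1 = (LINT u:{0<..}|lborel. f1 u / u\<^sup>2)"
  define J2 where "J2 = (LINT u:{0<..}|lborel. f2 u / u\<^sup>2)"
  have "(LINT u:{0<..}|lborel. f u / u\<^sup>2) = (LINT u:{0<..}|lborel. f1 u / u\<^sup>2 - f2 u / u\<^sup>2)"
    using f by (intro set_lebesgue_integral_cong) auto
  also have "\<dots> = J1 - J2"
    unfolding J1_def J2_def by (intro set_integral_diff f1.set_integrable f2.set_integrable)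
  finally have J: "(LINT u:{0<..}|lborel. f u / u\<^sup>2) = J1 - J2" .
  define C' where "C' = 2 * N + N\<^sup>2 / 2 + 2 * (N + C) + 2 * N"
  have "\<bar>(\<Sum>j<n. g (a / (2 * real j + 1))) - (N * a / 2 * (ln (2 * a) + euler_mascheroni)
          + a / 2 * (LINT u:{0<..}|lborel. f u / u\<^sup>2))\<bar> \<le> C' * (1 + ln a)"
    if a: "a \<ge> 1" and n: "a\<^sup>2 \<le> real n" for a n
  proof -
    \<comment> \<open>The points \<open>a / (2 j + 1)\<close> that are at least 1 are those with
      \<open>j < k\<close>, that is, those receiving the linear correction
      \<open>N * u\<close>.\<close>
    define k where "k = nat \<lfloor>(a + 1) / 2\<rfloor>"
    have k: "2 * real k - 1 \<le> a" "a < 2 * real k + 1"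
    proof -
      have "real k = of_int \<lfloor>(a + 1) / 2\<rfloor>" unfolding k_def using a by simp
      thus "2 * real k - 1 \<le> a" "a < 2 * real k + 1"
        using floor_correct[of "(a + 1) / 2"] by (simp_all add: field_simps)
    qed
    have "a * 1 \<le> a * a" using a by (intro mult_left_mono) auto
    hence "a \<le> real n" using n by (simp add: power2_eq_square)
    hence "real k \<le> real n" using k a by linarith
    hence kn: "k \<le> n" by simp
    have in_k: "a / (2 * real j + 1) \<ge> 1 \<longleftrightarrow> j < k" for j
    proof -
      have "a / (2 * real j + 1) \<ge> 1 \<longleftrightarrow> 2 * real j + 1 \<le> a" by (simp add: field_simps)
      also have "\<dots> \<longleftrightarrow> j < k"
      proof
        assume "2 * real j + 1 \<le> a"
        hence "real j < real k" using k by linarith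
        thus "j < k" by simp
      next
        assume "j < k"
        hence "real j + 1 \<le> real k" by linarith
        thus "2 * real j + 1 \<le> a" using k by linarith
      qed
      finally show ?thesis .
    qed
    have dec: "g u = f1 u - f2 u + (if 1 \<le> u then N * u else 0)" if "u > 0" for u
      using that by (auto simp: f1_def f2_def min_def max_def)
    have "(\<Sum>j<n. g (a / (2 * real j + 1)))
       = (\<Sum>j<n. f1 (a / (2 * real j + 1)) - f2 (a / (2 * real j + 1)) + (if j < k then N * (a / (2 * real j + 1)) else 0))"
      using a by (intro sum.cong refl) (subst dec, auto simp: in_k)
    also have "\<dots> = (\<Sum>j<n. f1 (a / (2 * real j + 1))) - (\<Sum>j<n. f2 (a / (2 * real j + 1)))
       + (\<Sum>j<n. if j < k then N * (a / (2 * real j + 1)) else 0)"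
      by (simp add: sum.distrib sum_subtractf)
    also have "(\<Sum>j<n. if j < k then N * (a / (2 * real j + 1)) else 0) = (\<Sum>j<k. N * (a / (2 * real j + 1)))"
      using kn by (intro sum.mono_neutral_cong_right) auto
    also have "\<dots> = N * a * (\<Sum>j<k. 1 / (2 * real j + 1))"
      by (simp add: sum_distrib_left)
    finally have S: "(\<Sum>j<n. g (a / (2 * real j + 1))) = (\<Sum>j<n. f1 (a / (2 * real j + 1))) - (\<Sum>j<n. f2 (a / (2 * real j + 1)))
       + N * a * (\<Sum>j<k. 1 / (2 * real j + 1))" .
    have "\<bar>N * a * (\<Sum>j<k. 1 / (2 * real j + 1)) - N * a * ((ln (2 * a) + euler_mascheroni) / 2)\<bar>
       = N * a * \<bar>(\<Sum>j<k. 1 / (2 * real j + 1)) - (ln (2 * a) + euler_mascheroni) / 2\<bar>"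
      unfolding right_diff_distrib[symmetric] abs_mult using N a by simp
    also have "\<dots> \<le> N * a * (2 / a)"
      using N a odd_harmonic_approx[OF a k] by (intro mult_left_mono) auto
    finally have 3: "\<bar>N * a * (\<Sum>j<k. 1 / (2 * real j + 1)) - N * a * ((ln (2 * a) + euler_mascheroni) / 2)\<bar> \<le> 2 * N"
      using a by simp
    note 1 = f1.sum_vs_integral[OF a n, folded J1_def]
    note 2 = f2.sum_vs_integral[OF a n, folded J2_def]
    have "\<bar>(\<Sum>j<n. g (a / (2 * real j + 1))) - (N * a / 2 * (ln (2 * a) + euler_mascheroni)
          + a / 2 * (LINT u:{0<..}|lborel. f u / u\<^sup>2))\<bar> \<le>
       (2 * N * (1 + ln a) + N\<^sup>2 / 2) + (2 * (N + C) * (1 + ln a) + 0) + 2 * N"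
    proof -
      have lin: "\<bar>S1 - S2 + S3 - (Y3 + Z)\<bar> \<le> e1 + e2 + e3"
        if "\<bar>S1 - Y1\<bar> \<le> e1" "\<bar>S2 - Y2\<bar> \<le> e2" "\<bar>S3 - Y3\<bar> \<le> e3" "Z = Y1 - Y2"
        for S1 S2 S3 Y1 Y2 Y3 Z e1 e2 e3 :: real
        using that by argo
      have "N * a / 2 * (ln (2 * a) + euler_mascheroni) = N * a * ((ln (2 * a) + euler_mascheroni) / 2)" by simp
      thus ?thesis unfolding S J by (simp only:) (rule lin[OF 1 2 3], simp add: right_diff_distrib)
    qed
    also have "\<dots> \<le> C' * (1 + ln a)"
    proof -
      have "(N\<^sup>2 / 2 + 2 * N) * 1 \<le> (N\<^sup>2 / 2 + 2 * N) * (1 + ln a)"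
        using a N by (intro mult_left_mono) auto
      thus ?thesis by (simp add: C'_def algebra_simps)
    qed
    finally show ?thesis .
  qed
  thus "\<exists>C'. \<forall>a\<ge>1. \<forall>n. a\<^sup>2 \<le> real n \<longrightarrow>
      \<bar>(\<Sum>j<n. g (a / (2 * real j + 1))) - (N * a / 2 * (ln (2 * a) + euler_mascheroni)
          + a / 2 * (LINT u:{0<..}|lborel. f u / u\<^sup>2))\<bar> \<le> C' * (1 + ln a)"
    by (intro exI[of _ C']) auto
qed

subsection \<open>Cumulant generating functions of bounded centred variables\<close>

locale bounded_centred = prob_space M for M :: "'b measure" +
  fixes Z :: "'b \<Rightarrow> real" and N :: real
  assumes N_pos: "0 < N" and rv [measurable]: "Z \<in> borel_measurable M"
    and bounded: "AE \<omega> in M. Z \<omega> \<in> {-N..N}" and centred: "(LINT \<omega>|M. Z \<omega>) = 0"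
begin

definition mgf :: "real \<Rightarrow> real" where "mgf t = (LINT \<omega>|M. exp (t * Z \<omega>))"
definition cgf :: "real \<Rightarrow> real" where "cgf t = ln (mgf t)"

lemma integrable_exp: "integrable M (\<lambda>\<omega>. exp (t * Z \<omega>))"
proof (rule integrable_const_bound[where B = "exp (\<bar>t\<bar> * N)"])
  show "AE \<omega> in M. norm (exp (t * Z \<omega>)) \<le> exp (\<bar>t\<bar> * N)"
    using bounded
  proof eventually_elim
    case (elim \<omega>)
    have "t * Z \<omega> \<le> \<bar>t\<bar> * \<bar>Z \<omega>\<bar>" by (metis abs_ge_self abs_mult)
    also have "\<dots> \<le> \<bar>t\<bar> * N" using elim by (intro mult_left_mono) auto
    finally show ?case by simp
  qed
qed simp

lemma integrable_rv: "integrable M Z"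
proof (rule integrable_const_bound[where B = N])
  show "AE \<omega> in M. norm (Z \<omega>) \<le> N" using bounded by eventually_elim auto
qed simp

lemma mgf_ge_1: "1 \<le> mgf t"
proof -
  have "1 = (LINT \<omega>|M. 1 + t * Z \<omega>)"
    using integrable_rv by (simp add: centred prob_space)
  also have "\<dots> \<le> mgf t"
    unfolding mgf_def using integrable_rv
    by (intro integral_mono_AE integrable_exp) (auto intro!: AE_I2 exp_ge_add_one_self)
  finally show ?thesis .
qed

lemma cgf_nonneg: "0 \<le> cgf t" using mgf_ge_1 by (simp add: cgf_def)

lemma cgf_0: "cgf 0 = 0" by (simp add: cgf_def mgf_def prob_space)

text \<open>The bound \<open>pw\<close> replaces differentiation: its left side has mean zero. It
  rests on \<open>z \<le> z * exp (x * z)\<close>, valid for both signs of \<open>z\<close> because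
  \<open>x \<ge> 0\<close>.\<close>

lemma cgf_mono:
  assumes "0 \<le> x" "x \<le> y"
  shows "cgf x \<le> cgf y"
proof -
  have pw: "(y - x) * z \<le> exp (y * z) - exp (x * z)" for z :: real
  proof -
    have "z \<le> z * exp (x * z)"
    proof (cases "0 \<le> z")
      case True
      thus ?thesis using assms mult_left_mono[of 1 "exp (x * z)" z] by simp
    next
      case False
      hence "x * z \<le> 0" using assms by (simp add: mult_nonneg_nonpos)
      thus ?thesis using False mult_left_mono_neg[of "exp (x * z)" 1 z] by simp
    qed
    hence "(y - x) * z \<le> (y - x) * (z * exp (x * z))" using assms by (intro mult_left_mono) auto
    also have "\<dots> = exp (x * z) * ((y - x) * z)" by simp
    also have "\<dots> \<le> exp (x * z) * (exp ((y - x) * z) - 1)"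
    proof (rule mult_left_mono)
      show "(y - x) * z \<le> exp ((y - x) * z) - 1" using exp_ge_add_one_self[of "(y - x) * z"] by linarith
    qed simp
    also have "\<dots> = exp (y * z) - exp (x * z)" by (simp add: algebra_simps flip: exp_add)
    finally show ?thesis .
  qed
  have "0 = (LINT \<omega>|M. (y - x) * Z \<omega>)" by (simp add: centred)
  also have "\<dots> \<le> (LINT \<omega>|M. exp (y * Z \<omega>) - exp (x * Z \<omega>))"
    using integrable_rv pw by (intro integral_mono_AE) (auto intro!: AE_I2 integrable_exp)
  also have "\<dots> = mgf y - mgf x" unfolding mgf_def by (intro Bochner_Integration.integral_diff integrable_exp)
  finally show ?thesis using mgf_ge_1[of x] mgf_ge_1[of y] by (simp add: cgf_def)
qed

text \<open>The slope bound \<open>N\<close> has two uses: it makes \<open>N * t - cgf t\<close>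
  increasing for \<open>t \<ge> 0\<close>, and it controls the replacement of the sine coefficients
  by \<open>1 / (\<pi> h)\<close>.\<close>

lemma cgf_lipschitz: "cgf y - cgf x \<le> N * \<bar>y - x\<bar>"
proof -
  have "mgf y \<le> (LINT \<omega>|M. exp (N * \<bar>y - x\<bar>) * exp (x * Z \<omega>))"
    unfolding mgf_def
  proof (intro integral_mono_AE integrable_exp integrable_mult_right)
    show "AE \<omega> in M. exp (y * Z \<omega>) \<le> exp (N * \<bar>y - x\<bar>) * exp (x * Z \<omega>)"
      using bounded
    proof eventually_elim
      case (elim \<omega>)
      have "(y - x) * Z \<omega> \<le> \<bar>y - x\<bar> * \<bar>Z \<omega>\<bar>" by (metis abs_ge_self abs_mult)
      also have "\<dots> \<le> \<bar>y - x\<bar> * N" using elim by (intro mult_left_mono) auto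
      finally show ?case by (simp add: algebra_simps flip: exp_add)
    qed
  qed
  also have "\<dots> = exp (N * \<bar>y - x\<bar>) * mgf x" unfolding mgf_def by simp
  finally have "ln (mgf y) \<le> ln (exp (N * \<bar>y - x\<bar>) * mgf x)"
    using mgf_ge_1[of x] mgf_ge_1[of y] by (subst ln_le_cancel_iff) (auto intro!: mult_pos_pos)
  also have "\<dots> = N * \<bar>y - x\<bar> + ln (mgf x)"
    using mgf_ge_1[of x] by (subst ln_mult_pos) auto
  finally show ?thesis by (simp add: cgf_def)
qed

lemma cgf_quadratic_pos:
  assumes "0 \<le> t"
  shows "cgf t \<le> N\<^sup>2 * t\<^sup>2 / 2"
proof (cases "t = 0")
  case False
  interpret interval_bounded_random_variable M Z "-N" N
    by unfold_locales (use bounded in auto)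
  have "ennreal (mgf t) = nn_integral M (\<lambda>x. exp (t * Z x))"
    unfolding mgf_def by (intro nn_integral_eq_integral[symmetric] integrable_exp) auto
  also have "\<dots> \<le> ennreal (exp (t\<^sup>2 * (N - - N)\<^sup>2 / 8))"
    using False assms centred by (intro Hoeffdings_lemma_nn_integral_0) auto
  also have "t\<^sup>2 * (N - - N)\<^sup>2 / 8 = N\<^sup>2 * t\<^sup>2 / 2" by (simp add: power2_eq_square)
  finally have "mgf t \<le> exp (N\<^sup>2 * t\<^sup>2 / 2)" by (simp add: ennreal_le_iff)
  thus ?thesis using mgf_ge_1[of t] ln_le_cancel_iff[of "mgf t" "exp (N\<^sup>2 * t\<^sup>2 / 2)"] by (simp add: cgf_def)
qed (simp add: cgf_0)

text \<open>The event that \<open>Z\<close> is within \<open>1 / t\<close> of \<open>N\<close> has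
  probability at least \<open>c * t powr (-A)\<close> and contributes at least
  \<open>exp (N * t - 1)\<close> there. Polynomial mass near the end point therefore costs only a
  logarithm.\<close>

lemma cgf_tail:
  assumes A: "A > 0" and c: "c > 0"
    and P: "\<And>\<epsilon>. \<epsilon> \<in> {0<..1} \<Longrightarrow> c * \<epsilon> powr A \<le> measure M {\<omega> \<in> space M. Z \<omega> > N - \<epsilon>}"
  shows "\<exists>C. \<forall>t\<ge>1. N * t - cgf t \<le> C * (1 + ln t)"
proof (intro exI allI impI)
  fix t :: real assume t: "t \<ge> 1"
  let ?E = "{\<omega> \<in> space M. Z \<omega> > N - 1 / t}"
  have "c * (1 / t) powr A * exp (t * (N - 1 / t)) \<le> measure M ?E * exp (t * (N - 1 / t))"
    using t by (intro mult_right_mono P) auto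
  also have "\<dots> = (LINT \<omega>|M. indicator ?E \<omega> * exp (t * (N - 1 / t)))" by simp
  also have "\<dots> \<le> mgf t"
    unfolding mgf_def
  proof (intro integral_mono_AE integrable_exp AE_I2)
    show "integrable M (\<lambda>\<omega>. indicator ?E \<omega> * exp (t * (N - 1 / t)))"
      by (intro integrable_mult_left integrable_real_indicator) (auto simp: emeasure_eq_measure)
    show "indicator ?E \<omega> * exp (t * (N - 1 / t)) \<le> exp (t * Z \<omega>)" for \<omega>
      using t by (auto simp: indicator_def intro!: mult_left_mono)
  qed
  finally have "ln (c * (1 / t) powr A * exp (t * (N - 1 / t))) \<le> ln (mgf t)"
    using c t mgf_ge_1[of t] by (subst ln_le_cancel_iff) (auto intro!: mult_pos_pos)
  also have "ln (c * (1 / t) powr A * exp (t * (N - 1 / t))) = ln c - A * ln t + (N * t - 1)"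
    using c t by (simp add: ln_mult_pos ln_powr ln_div algebra_simps)
  finally have "N * t - cgf t \<le> 1 - ln c + A * ln t" by (simp add: cgf_def)
  also have "\<dots> \<le> (1 + \<bar>ln c\<bar>) * 1 + A * (1 + ln t)" using A by (simp add: algebra_simps)
  also have "\<dots> \<le> (1 + \<bar>ln c\<bar>) * (1 + ln t) + A * (1 + ln t)"
    using t by (intro add_right_mono mult_left_mono) auto
  finally show "N * t - cgf t \<le> (1 + \<bar>ln c\<bar> + A) * (1 + ln t)" by (simp add: algebra_simps)
qed

end

section \<open>Reflection of integrals and sums to the positive half\<close>

lemma LINT_halves:
  fixes F :: "real \<Rightarrow> real"
  assumes pos: "set_integrable lborel {0<..} F" and neg: "set_integrable lborel {0<..} (\<lambda>u. F (- u))"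
  shows "(LINT u|lborel. F u) = (LINT u:{0<..}|lborel. F u) + (LINT u:{0<..}|lborel. F (- u))"
proof -
  let ?i = "\<lambda>u::real. indicator {0<..} u :: real"
  have neg': "integrable lborel (\<lambda>u. ?i (-u) * F u)"
    using lborel_integrable_real_affine[OF neg[unfolded set_integrable_def], of "-1" 0] by simp
  have "(LINT u|lborel. F u) = (LINT u|lborel. ?i u * F u + ?i (-u) * F u)"
    using AE_lborel_singleton[of 0]
  proof (intro integral_cong_AE)
    have m: "(\<lambda>u. ?i u * F u + ?i (-u) * F u) \<in> borel_measurable lborel"
      using pos neg' unfolding set_integrable_def by (auto dest!: borel_measurable_integrable)
    thus "(\<lambda>u. ?i u * F u + ?i (-u) * F u) \<in> borel_measurable lborel" .
    \<comment> \<open>Measurability of \<open>F\<close> on the whole line is not assumed; it is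
      recovered from the two halves, which determine \<open>F\<close> away from 0.\<close>
    have "F = (\<lambda>u. if u = 0 then F 0 else ?i u * F u + ?i (-u) * F u)"
      by (auto simp: fun_eq_iff indicator_def)
    also have "\<dots> \<in> borel_measurable lborel" using m by measurable
    finally show "F \<in> borel_measurable lborel" .
    show "AE u in lborel. F u = ?i u * F u + ?i (-u) * F u"
      using AE_lborel_singleton[of 0] by eventually_elim (auto simp: indicator_def)
  qed
  also have "\<dots> = (LINT u|lborel. ?i u * F u) + (LINT u|lborel. ?i (-u) * F u)"
    using pos neg' unfolding set_integrable_def by (intro Bochner_Integration.integral_add) auto
  also have "(LINT u|lborel. ?i (-u) * F u) = (LINT u|lborel. ?i u * F (-u))"
    using lborel_integral_real_affine[of "-1" "\<lambda>u. ?i (-u) * F u" 0] by simp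
  finally show ?thesis by (simp add: set_lebesgue_integral_def)
qed

lemma sum_odd_symmetric:
  fixes F :: "int \<Rightarrow> real"
  assumes "\<And>h. even h \<Longrightarrow> F h = 0"
  shows "(\<Sum>h\<in>{h. h \<noteq> 0 \<and> \<bar>h\<bar> < 2 * int n}. F h) = (\<Sum>j<n. F (2 * int j + 1) + F (- (2 * int j + 1)))"
proof (induction n)
  case (Suc n)
  define k where "k = 2 * int n"
  \<comment> \<open>Passing from \<open>n\<close> to \<open>Suc n\<close> adds an even and an odd
    pair. For \<open>n = 0\<close> the even pair degenerates to 0, hence the removal of 0.\<close>
  have "{h. h \<noteq> 0 \<and> \<bar>h\<bar> < 2 * int (Suc n)} = {h. h \<noteq> 0 \<and> \<bar>h\<bar> < 2 * int n} \<union> (({k, -k} - {0}) \<union> {k + 1, - (k + 1)})"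
    unfolding k_def by auto
  moreover have "(\<Sum>h\<in>\<dots>. F h) = (\<Sum>h\<in>{h. h \<noteq> 0 \<and> \<bar>h\<bar> < 2 * int n}. F h) + (\<Sum>h\<in>(({k, -k} - {0}) \<union> {k + 1, - (k + 1)}). F h)"
  proof (rule sum.union_disjoint)
    show "finite {h. h \<noteq> 0 \<and> \<bar>h\<bar> < 2 * int n}"
      by (rule finite_subset[of _ "{- (2 * int n)..2 * int n}"]) auto
  qed (auto simp: k_def)
  moreover have "(\<Sum>h\<in>(({k, -k} - {0}) \<union> {k + 1, - (k + 1)}). F h) = (\<Sum>h\<in>{k, -k} - {0}. F h) + (\<Sum>h\<in>{k + 1, - (k + 1)}. F h)"
    by (rule sum.union_disjoint) (auto simp: k_def)
  moreover have "(\<Sum>h\<in>{k, -k} - {0}. F h) = 0"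
    by (intro sum.neutral ballI assms) (auto simp: k_def)
  moreover have "(\<Sum>h\<in>{k + 1, - (k + 1)}. F h) = F (k + 1) + F (- (k + 1))"
    by (subst sum.insert) (auto simp: k_def)
  ultimately show ?case using Suc.IH by (simp add: k_def)
qed simp


subsection \<open>The random model\<close>

locale trace_model =
  fixes M :: "'b measure" and X :: "int \<Rightarrow> 'b \<Rightarrow> real" and Y :: "'b \<Rightarrow> real" and N :: real
  assumes N_pos: "0 < N" and model: "random_model M X Y N"
begin

sublocale prob_space M using model by (simp add: random_model_def)

lemma indep: "indep_vars (\<lambda>_. borel) X {h. h \<noteq> 0}"
  and rv_Y [measurable]: "Y \<in> borel_measurable M"
  using model unfolding random_model_def by simp_all

lemma same_distr: "h \<noteq> 0 \<Longrightarrow> distr M borel (X h) = distr M borel Y"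
  and bounded_X: "h \<noteq> 0 \<Longrightarrow> AE \<omega> in M. X h \<omega> \<in> {-N..N}"
  and odd_moment: "(LINT \<omega>|M. Y \<omega> ^ (2 * l + 1)) = 0"
  using model unfolding random_model_def by simp_all

lemma tails: "\<exists>A>0. \<exists>c>0. \<forall>\<epsilon>\<in>{0<..1}.
     c * \<epsilon> powr A \<le> measure M {\<omega> \<in> space M. Y \<omega> > N - \<epsilon>} \<and>
     c * \<epsilon> powr A \<le> measure M {\<omega> \<in> space M. Y \<omega> < - N + \<epsilon>}"
  using model unfolding random_model_def by (elim conjE)

lemma rv_X: "h \<noteq> 0 \<Longrightarrow> X h \<in> borel_measurable M"
  using indep unfolding indep_vars_def by auto

lemma bounded_Y: "AE \<omega> in M. Y \<omega> \<in> {-N..N}"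
proof -
  have "AE x in distr M borel (X 1). x \<in> {-N..N}"
    using bounded_X[of 1] rv_X[of 1] by (subst AE_distr_iff) auto
  thus ?thesis unfolding same_distr[of 1, simplified] by (subst (asm) AE_distr_iff) auto
qed

sublocale pos: bounded_centred M Y N
  by unfold_locales (use N_pos bounded_Y odd_moment[of 0] in auto)

sublocale neg: bounded_centred M "\<lambda>\<omega>. - Y \<omega>" N
proof unfold_locales
  show "AE \<omega> in M. - Y \<omega> \<in> {-N..N}" using bounded_Y by eventually_elim auto
qed (use N_pos odd_moment[of 0] in auto)

abbreviation "cgf \<equiv> pos.cgf"

lemma neg_cgf: "neg.cgf t = cgf (- t)"
  by (simp add: neg.cgf_def pos.cgf_def neg.mgf_def pos.mgf_def)

lemma cgf_quadratic: "cgf t \<le> N\<^sup>2 * t\<^sup>2 / 2"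
  using pos.cgf_quadratic_pos[of t] neg.cgf_quadratic_pos[of "-t"] by (cases "0 \<le> t") (auto simp: neg_cgf)

lemma cgf_abs_diff: "\<bar>cgf x - cgf y\<bar> \<le> N * \<bar>x - y\<bar>"
  using pos.cgf_lipschitz[of x y] pos.cgf_lipschitz[of y x] by (simp add: abs_minus_commute abs_le_iff)

lemma lint_exp_X: "h \<noteq> 0 \<Longrightarrow> (LINT \<omega>|M. exp (t * X h \<omega>)) = pos.mgf t"
  using integral_distr[OF rv_X[of h], of "\<lambda>x. exp (t * x)"] integral_distr[OF rv_Y, of "\<lambda>x. exp (t * x)"] same_distr[of h]
  by (simp add: pos.mgf_def)

text \<open>The constant beside \<open>ln s\<close> in the leading term. Its part
  \<open>ln (2 / pi)\<close> stems from \<open>ln (2 * a)\<close> at \<open>a = s / pi\<close>, and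
  the full-line integral is the sum of the half-line integrals belonging to \<open>Y\<close> and
  \<open>- Y\<close>.\<close>

definition rate_const :: real where
  "rate_const = ln (2 / pi) + euler_mascheroni + (LINT u|lborel. f_cgf M Y N u / u\<^sup>2) / (2 * N)"

text \<open>The leading term of the cumulant generating function of the random sum.\<close>

definition rate :: "real \<Rightarrow> real" where
  "rate s = N / pi * s * (ln s + rate_const)"

text \<open>The abstract asymptotics are applied at \<open>a = s / pi\<close> to \<open>Y\<close>
  for positive and to \<open>- Y\<close> for negative frequencies; this is where mass near both ends
  of the interval from \<open>- N\<close> to \<open>N\<close> is used. For \<open>s \<ge> 4\<close>
  one has \<open>a \<ge> 1\<close> and \<open>1 \<le> ln s\<close>, so \<open>1 + ln a\<close> is
  absorbed into \<open>2 * ln s\<close>.\<close>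

lemma odd_cgf_sum:
  "\<exists>C. \<forall>s\<ge>4. \<forall>n. s\<^sup>2 \<le> real n \<longrightarrow>
     \<bar>(\<Sum>j<n. cgf (s / pi / (2 * real j + 1)) + cgf (- (s / pi / (2 * real j + 1)))) - rate s\<bar> \<le> C * ln s"
proof -
  obtain A c where A: "A > 0" "c > 0" and
    P: "\<forall>\<epsilon>\<in>{0<..1}. c * \<epsilon> powr A \<le> measure M {\<omega> \<in> space M. Y \<omega> > N - \<epsilon>} \<and>
        c * \<epsilon> powr A \<le> measure M {\<omega> \<in> space M. Y \<omega> < - N + \<epsilon>}"
    using tails by (elim exE conjE) (rule that)
  have P1: "c * \<epsilon> powr A \<le> measure M {\<omega> \<in> space M. Y \<omega> > N - \<epsilon>}" if "\<epsilon> \<in> {0<..1}" for \<epsilon>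
    using P that by blast
  obtain C1 where C1: "\<forall>t\<ge>1. N * t - cgf t \<le> C1 * (1 + ln t)"
    using pos.cgf_tail[OF A P1] by auto
  have P2: "c * \<epsilon> powr A \<le> measure M {\<omega> \<in> space M. - Y \<omega> > N - \<epsilon>}" if "\<epsilon> \<in> {0<..1}" for \<epsilon>
  proof -
    have "{\<omega> \<in> space M. - Y \<omega> > N - \<epsilon>} = {\<omega> \<in> space M. Y \<omega> < - N + \<epsilon>}" by auto
    thus ?thesis using P that by (simp only:)
  qed
  obtain C2 where C2: "\<forall>t\<ge>1. N * t - neg.cgf t \<le> C2 * (1 + ln t)"
    using neg.cgf_tail[OF A P2] by auto
  define f1 where "f1 = (\<lambda>t. if t < 1 then cgf t else cgf t - N * t)"
  define f2 where "f2 = (\<lambda>t. if t < 1 then neg.cgf t else neg.cgf t - N * t)"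
  have lip1: "cgf y - cgf x \<le> N * (y - x)" if "0 \<le> x" "x \<le> y" for x y
    using pos.cgf_lipschitz[of y x] that by simp
  have lip2: "neg.cgf y - neg.cgf x \<le> N * (y - x)" if "0 \<le> x" "x \<le> y" for x y
    using neg.cgf_lipschitz[of y x] that by simp
  define J1 where "J1 = (LINT u:{0<..}|lborel. f1 u / u\<^sup>2)"
  define J2 where "J2 = (LINT u:{0<..}|lborel. f2 u / u\<^sup>2)"
  note hyps1 = N_pos pos.cgf_0 pos.cgf_mono lip1 pos.cgf_quadratic_pos C1[rule_format]
  note hyps2 = N_pos neg.cgf_0 neg.cgf_mono lip2 neg.cgf_quadratic_pos C2[rule_format]
  have int1: "set_integrable lborel {0<..} (\<lambda>u. f1 u / u\<^sup>2)"
    unfolding f1_def by (rule odd_sum_cgf_asymptotics(1)[where C = C1]) (fact hyps1)+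
  have int2: "set_integrable lborel {0<..} (\<lambda>u. f2 u / u\<^sup>2)"
    unfolding f2_def by (rule odd_sum_cgf_asymptotics(1)[where C = C2]) (fact hyps2)+
  have "\<exists>D. \<forall>a\<ge>1. \<forall>n. a\<^sup>2 \<le> real n \<longrightarrow> \<bar>(\<Sum>j<n. cgf (a / (2 * real j + 1))) - (N * a / 2 * (ln (2 * a) + euler_mascheroni) + a / 2 * J1)\<bar> \<le> D * (1 + ln a)"
    unfolding J1_def f1_def by (rule odd_sum_cgf_asymptotics(2)[where C = C1]) (fact hyps1)+
  then obtain D1 where D1: "\<And>a n. a \<ge> 1 \<Longrightarrow> a\<^sup>2 \<le> real n \<Longrightarrow> \<bar>(\<Sum>j<n. cgf (a / (2 * real j + 1))) - (N * a / 2 * (ln (2 * a) + euler_mascheroni) + a / 2 * J1)\<bar> \<le> D1 * (1 + ln a)"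
    by auto
  have "\<exists>D. \<forall>a\<ge>1. \<forall>n. a\<^sup>2 \<le> real n \<longrightarrow> \<bar>(\<Sum>j<n. neg.cgf (a / (2 * real j + 1))) - (N * a / 2 * (ln (2 * a) + euler_mascheroni) + a / 2 * J2)\<bar> \<le> D * (1 + ln a)"
    unfolding J2_def f2_def by (rule odd_sum_cgf_asymptotics(2)[where C = C2]) (fact hyps2)+
  then obtain D2 where D2: "\<And>a n. a \<ge> 1 \<Longrightarrow> a\<^sup>2 \<le> real n \<Longrightarrow> \<bar>(\<Sum>j<n. neg.cgf (a / (2 * real j + 1))) - (N * a / 2 * (ln (2 * a) + euler_mascheroni) + a / 2 * J2)\<bar> \<le> D2 * (1 + ln a)"
    by auto
  have e1: "f_cgf M Y N u / u\<^sup>2 = f1 u / u\<^sup>2" if "u \<in> {0<..}" for u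
    using that by (auto simp: f_cgf_def f1_def pos.cgf_def pos.mgf_def)
  have e2: "f_cgf M Y N (- u) / (- u)\<^sup>2 = f2 u / u\<^sup>2" if "u \<in> {0<..}" for u
    using that by (auto simp: f_cgf_def f2_def neg_cgf pos.cgf_def pos.mgf_def)
  have "(LINT u|lborel. f_cgf M Y N u / u\<^sup>2) = (LINT u:{0<..}|lborel. f_cgf M Y N u / u\<^sup>2) + (LINT u:{0<..}|lborel. f_cgf M Y N (- u) / (- u)\<^sup>2)"
    using int1 int2 by (intro LINT_halves) (simp_all only: set_integrable_cong[OF refl refl e1] set_integrable_cong[OF refl refl e2])
  also have "(LINT u:{0<..}|lborel. f_cgf M Y N u / u\<^sup>2) = J1"
    unfolding J1_def using e1 by (intro set_lebesgue_integral_cong) auto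
  also have "(LINT u:{0<..}|lborel. f_cgf M Y N (- u) / (- u)\<^sup>2) = J2"
    unfolding J2_def using e2 by (intro set_lebesgue_integral_cong) auto
  finally have I: "(LINT u|lborel. f_cgf M Y N u / u\<^sup>2) = J1 + J2" .
  have "\<bar>(\<Sum>j<n. cgf (s / pi / (2 * real j + 1)) + cgf (- (s / pi / (2 * real j + 1)))) - rate s\<bar> \<le> 2 * (\<bar>D1\<bar> + \<bar>D2\<bar>) * ln s"
    if s: "s \<ge> 4" and n: "s\<^sup>2 \<le> real n" for s n
  proof -
    define a where "a = s / pi"
    have a: "a \<ge> 1" "a \<le> s" using s pi_gt3 pi_less_4 by (auto simp: a_def field_simps)
    have "a\<^sup>2 \<le> s\<^sup>2" using a by (intro power_mono) auto
    hence an: "a\<^sup>2 \<le> real n" using n by linarith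
    have "1 + ln a \<le> 2 * ln s"
    proof -
      have "exp 1 \<le> s" using exp_le s by linarith
      hence "1 \<le> ln s" using s by (subst ln_ge_iff) auto
      moreover have "ln a \<le> ln s" using a by simp
      ultimately show ?thesis by linarith
    qed
    moreover have "0 \<le> 1 + ln a" using a by simp
    ultimately have "D1 * (1 + ln a) \<le> \<bar>D1\<bar> * (2 * ln s)" "D2 * (1 + ln a) \<le> \<bar>D2\<bar> * (2 * ln s)"
      by (auto intro!: mult_mono)
    moreover have "rate s = (N * a / 2 * (ln (2 * a) + euler_mascheroni) + a / 2 * J1) + (N * a / 2 * (ln (2 * a) + euler_mascheroni) + a / 2 * J2)"
    proof -
      have "ln (2 * a) = ln s + ln (2 / pi)"
        using s by (simp add: a_def ln_mult_pos ln_div)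
      thus ?thesis using N_pos by (simp add: rate_def rate_const_def I a_def field_simps)
    qed
    moreover have "(\<Sum>j<n. cgf (s / pi / (2 * real j + 1)) + cgf (- (s / pi / (2 * real j + 1)))) =
       (\<Sum>j<n. cgf (a / (2 * real j + 1))) + (\<Sum>j<n. neg.cgf (a / (2 * real j + 1)))"
      by (simp add: sum.distrib neg_cgf a_def)
    moreover have "2 * (\<bar>D1\<bar> + \<bar>D2\<bar>) * ln s = \<bar>D1\<bar> * (2 * ln s) + \<bar>D2\<bar> * (2 * ln s)" by (simp add: algebra_simps)
    ultimately show ?thesis using D1[OF a(1) an] D2[OF a(1) an] by linarith
  qed
  thus ?thesis by blast
qed

text \<open>With cut-off \<open>n\<close>, frequencies below it contribute an error of order
  \<open>s * n / m\<close> and those above it at most order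
  \<open>m * s\<^sup>2 / n\<^sup>2\<close>. Since \<open>s \<le> ln m\<close>, any power of
  \<open>m\<close> with exponent strictly between 1/2 and 1 works for \<open>n\<close>; 3/4 is
  taken. The sign \<open>\<sigma>\<close> merely exchanges \<open>h\<close> and \<open>- h\<close>
  in the main part; both signs are needed later to bound the exponential moment of the absolute
  value.\<close>

lemma cgf_sum_asymptotics:
  "\<exists>C. \<forall>\<^sub>F m in sequentially. \<forall>s \<sigma>. 4 \<le> s \<and> s \<le> ln (real m) \<and> \<sigma> \<in> {1, -1} \<longrightarrow>
     \<bar>(\<Sum>h\<in>freqs m. cgf (\<sigma> * s * sine_coeff m h)) - rate s\<bar> \<le> C * ln s"
proof -
  obtain C where C: "\<And>s n. s \<ge> 4 \<Longrightarrow> s\<^sup>2 \<le> real n \<Longrightarrow>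
     \<bar>(\<Sum>j<n. cgf (s / pi / (2 * real j + 1)) + cgf (- (s / pi / (2 * real j + 1)))) - rate s\<bar> \<le> C * ln s"
    using odd_cgf_sum by blast
  have ev: "\<forall>\<^sub>F m in sequentially. (ln (real m))\<^sup>2 \<le> real m powr (3/4) - 1 \<and> 4 * real m powr (3/4) \<le> real m
      \<and> 12 * N * (real m powr (3/4)) * ln (real m) / real m \<le> 1
      \<and> real m * (N\<^sup>2 * (ln (real m))\<^sup>2 / (2 * (real m powr (3/4) - 1)\<^sup>2)) \<le> 1 \<and> real m \<ge> 2"
    using N_pos by (intro eventually_conj; real_asymp)
  have "\<forall>\<^sub>F m in sequentially. \<forall>s \<sigma>. 4 \<le> s \<and> s \<le> ln (real m) \<and> \<sigma> \<in> {1, -1} \<longrightarrow>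
     \<bar>(\<Sum>h\<in>freqs m. cgf (\<sigma> * s * sine_coeff m h)) - rate s\<bar> \<le> (C + 2) * ln s"
    using ev
  proof (eventually_elim, intro allI impI, elim conjE)
    fix m :: nat and s \<sigma> :: real
    assume e: "(ln (real m))\<^sup>2 \<le> real m powr (3/4) - 1" "4 * real m powr (3/4) \<le> real m"
      "12 * N * (real m powr (3/4)) * ln (real m) / real m \<le> 1"
      "real m * (N\<^sup>2 * (ln (real m))\<^sup>2 / (2 * (real m powr (3/4) - 1)\<^sup>2)) \<le> 1" "real m \<ge> 2"
      and s: "4 \<le> s" "s \<le> ln (real m)" and \<sigma>: "\<sigma> \<in> {1, -1}"
    \<comment> \<open>Below the cut-off the coefficients are replaced by \<open>1/(\<pi>h)\<close> using the Lipschitz bound; above it the quadratic bound for \<open>cgf\<close> suffices.\<close>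
    define p where "p = real m powr (3/4)"
    define n where "n = nat \<lfloor>p\<rfloor>"
    have "p \<ge> 0" by (simp add: p_def)
    hence n: "p - 1 < real n" "real n \<le> p" unfolding n_def by linarith+
    have "s\<^sup>2 \<le> (ln (real m))\<^sup>2" using s by (intro power_mono) auto
    hence sn: "s\<^sup>2 \<le> real n" using e(1) n unfolding p_def by linarith
    have "4 * 4 \<le> s * s" using s by (intro mult_mono) auto
    hence "1 < s\<^sup>2" by (simp add: power2_eq_square)
    hence p1: "p - 1 > 0" using e(1) \<open>s\<^sup>2 \<le> (ln (real m))\<^sup>2\<close> unfolding p_def by linarith
    have n0: "n > 0" using n p1 by (cases n) auto
    have m0: "m > 0" using e(5) by (cases m) auto
    define A where "A = {h::int. h \<noteq> 0 \<and> \<bar>h\<bar> < 2 * int n}"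
    have A: "A \<subseteq> freqs m"
    proof
      fix h assume "h \<in> A"
      hence "h \<noteq> 0" "\<bar>real_of_int h\<bar> < 2 * real n" unfolding A_def by auto
      thus "h \<in> freqs m" using n e(2) unfolding freqs_def p_def by auto
    qed
    have cardA: "real (card A) \<le> 4 * real n"
    proof -
      have "card A \<le> card {- (2 * int n)<..<2 * int n}" unfolding A_def by (intro card_mono) auto
      thus ?thesis by simp
    qed
    define \<iota> where "\<iota> = (\<lambda>h. if odd h then 1 / (pi * of_int h) else 0 :: real)"
    have \<sigma>1: "\<bar>\<sigma>\<bar> = 1" using \<sigma> by auto
    have "\<bar>(\<Sum>h\<in>A. cgf (\<sigma> * s * sine_coeff m h)) - (\<Sum>h\<in>A. cgf (\<sigma> * s * \<iota> h))\<bar>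
       \<le> (\<Sum>h\<in>A. \<bar>cgf (\<sigma> * s * sine_coeff m h) - cgf (\<sigma> * s * \<iota> h)\<bar>)"
      unfolding sum_subtractf[symmetric] by (rule sum_abs)
    also have "\<dots> \<le> (\<Sum>h\<in>A. N * (s * (3 / m)))"
    proof (rule sum_mono)
      fix h assume h: "h \<in> A"
      have "\<bar>cgf (\<sigma> * s * sine_coeff m h) - cgf (\<sigma> * s * \<iota> h)\<bar> \<le> N * \<bar>\<sigma> * s * sine_coeff m h - \<sigma> * s * \<iota> h\<bar>"
        by (rule cgf_abs_diff)
      also have "\<bar>\<sigma> * s * sine_coeff m h - \<sigma> * s * \<iota> h\<bar> = s * \<bar>sine_coeff m h - \<iota> h\<bar>"
        using \<sigma>1 s by (simp add: abs_mult flip: right_diff_distrib)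
      also have "N * \<dots> \<le> N * (s * (3 / m))"
        using sine_coeff_approx[OF m0, of h] A h N_pos s unfolding \<iota>_def by (intro mult_left_mono) auto
      finally show "\<bar>cgf (\<sigma> * s * sine_coeff m h) - cgf (\<sigma> * s * \<iota> h)\<bar> \<le> N * (s * (3 / m))" .
    qed
    also have "\<dots> = real (card A) * (N * (s * (3 / m)))" by simp
    also have "\<dots> \<le> (4 * p) * (N * (ln m * (3 / m)))"
      using cardA n s N_pos by (intro mult_mono) auto
    also have "\<dots> = 12 * N * p * ln m / m" by simp
    also have "\<dots> \<le> 1" using e(3) unfolding p_def .
    finally have 1: "\<bar>(\<Sum>h\<in>A. cgf (\<sigma> * s * sine_coeff m h)) - (\<Sum>h\<in>A. cgf (\<sigma> * s * \<iota> h))\<bar> \<le> 1" .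
    have 2: "(\<Sum>h\<in>A. cgf (\<sigma> * s * \<iota> h)) = (\<Sum>j<n. cgf (s / pi / (2 * real j + 1)) + cgf (- (s / pi / (2 * real j + 1))))"
    proof -
      have "(\<Sum>h\<in>A. cgf (\<sigma> * s * \<iota> h)) = (\<Sum>j<n. cgf (\<sigma> * s * \<iota> (2 * int j + 1)) + cgf (\<sigma> * s * \<iota> (- (2 * int j + 1))))"
        unfolding A_def by (rule sum_odd_symmetric) (simp add: \<iota>_def pos.cgf_0)
      also have "\<dots> = (\<Sum>j<n. cgf (s / pi / (2 * real j + 1)) + cgf (- (s / pi / (2 * real j + 1))))"
      proof (rule sum.cong[OF refl])
        fix j
        have o: "odd (2 * int j + 1)" "odd (- (2 * int j + 1))" by auto
        have "s * \<iota> (2 * int j + 1) = s / pi / (2 * real j + 1)"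
          using o by (simp add: \<iota>_def field_simps)
        moreover have "s * \<iota> (- (2 * int j + 1)) = - (s / pi / (2 * real j + 1))"
        proof -
          have "pi * real_of_int (- (2 * int j + 1)) = - (pi * (2 * real j + 1))" by (simp add: algebra_simps)
          hence "\<iota> (- (2 * int j + 1)) = 1 / (- (pi * (2 * real j + 1)))"
            using o(2) unfolding \<iota>_def by (simp only: if_True not_False_eq_True)
          thus ?thesis by (simp del: mult_minus_right minus_add_distrib)
        qed
        ultimately show "cgf (\<sigma> * s * \<iota> (2 * int j + 1)) + cgf (\<sigma> * s * \<iota> (- (2 * int j + 1))) =
            cgf (s / pi / (2 * real j + 1)) + cgf (- (s / pi / (2 * real j + 1)))"
          using \<sigma> by (auto simp: mult.assoc)
      qed
      finally show ?thesis .
    qed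
    have "(\<Sum>h\<in>freqs m - A. cgf (\<sigma> * s * sine_coeff m h)) \<le> (\<Sum>h\<in>freqs m - A. N\<^sup>2 * s\<^sup>2 / (2 * (real n)\<^sup>2))"
    proof (rule sum_mono)
      fix h assume h: "h \<in> freqs m - A"
      hence "\<bar>h\<bar> \<ge> 2 * int n" unfolding A_def freqs_def by auto
      hence hn: "\<bar>real_of_int h\<bar> \<ge> 2 * real n" by linarith
      have "\<bar>sine_coeff m h\<bar> \<le> 2 / \<bar>real_of_int h\<bar>" using h by (intro sine_coeff_abs_le) auto
      also have "\<dots> \<le> 2 / (2 * real n)" using hn n0 by (intro divide_left_mono mult_pos_pos) auto
      finally have b: "\<bar>sine_coeff m h\<bar> \<le> 1 / real n" by simp
      have "(\<sigma> * s * sine_coeff m h)\<^sup>2 = s\<^sup>2 * \<bar>sine_coeff m h\<bar>\<^sup>2"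
        using \<sigma> by (auto simp: power_mult_distrib)
      also have "\<dots> \<le> s\<^sup>2 * (1 / real n)\<^sup>2" using b by (intro mult_left_mono power_mono) auto
      finally have "N\<^sup>2 * (\<sigma> * s * sine_coeff m h)\<^sup>2 / 2 \<le> N\<^sup>2 * (s\<^sup>2 * (1 / real n)\<^sup>2) / 2"
        by (intro divide_right_mono mult_left_mono) auto
      thus "cgf (\<sigma> * s * sine_coeff m h) \<le> N\<^sup>2 * s\<^sup>2 / (2 * (real n)\<^sup>2)"
        using cgf_quadratic[of "\<sigma> * s * sine_coeff m h"] by (simp add: power_divide)
    qed
    also have "\<dots> = real (card (freqs m - A)) * (N\<^sup>2 * s\<^sup>2 / (2 * (real n)\<^sup>2))" by simp
    also have "\<dots> \<le> real m * (N\<^sup>2 * (ln (real m))\<^sup>2 / (2 * (p - 1)\<^sup>2))"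
    proof (intro mult_mono frac_le mult_left_mono power_mono)
      have "card (freqs m - A) \<le> card (freqs m)" by (intro card_mono finite_freqs) auto
      thus "real (card (freqs m - A)) \<le> real m" using card_freqs_le[of m] by linarith
    qed (use s n p1 N_pos in auto)
    also have "\<dots> \<le> 1" using e(4) unfolding p_def .
    finally have 3: "(\<Sum>h\<in>freqs m - A. cgf (\<sigma> * s * sine_coeff m h)) \<le> 1" .
    have 4: "0 \<le> (\<Sum>h\<in>freqs m - A. cgf (\<sigma> * s * sine_coeff m h))"
      by (intro sum_nonneg pos.cgf_nonneg)
    have 5: "(\<Sum>h\<in>freqs m. cgf (\<sigma> * s * sine_coeff m h)) = (\<Sum>h\<in>freqs m - A. cgf (\<sigma> * s * sine_coeff m h)) + (\<Sum>h\<in>A. cgf (\<sigma> * s * sine_coeff m h))"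
      using A finite_freqs by (rule sum.subset_diff)
    have "exp 1 \<le> s" using exp_le s by linarith
    hence l: "1 \<le> ln s" using s by (subst ln_ge_iff) auto
    have lin: "\<bar>T - r\<bar> \<le> c + 2 * l" if "\<bar>a - b\<bar> \<le> 1" "\<bar>b - r\<bar> \<le> c" "0 \<le> d" "d \<le> 1" "T = d + a" "1 \<le> l"
      for T r c l a b d :: real using that by linarith
    have "(C + 2) * ln s = C * ln s + 2 * ln s" by (simp add: algebra_simps)
    thus "\<bar>(\<Sum>h\<in>freqs m. cgf (\<sigma> * s * sine_coeff m h)) - rate s\<bar> \<le> (C + 2) * ln s"
      using lin[OF 1[unfolded 2] C[OF s(1) sn] 4 3 5 l] by simp
  qed
  thus ?thesis by blast
qed

end

subsection \<open>Transfer from the random model to the family\<close>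

lemma power_sum_PiE:
  fixes f :: "'i \<Rightarrow> 'c :: comm_semiring_1"
  assumes "finite F"
  shows "(\<Sum>h\<in>F. f h) ^ k = (\<Sum>g\<in>PiE {..<k} (\<lambda>_. F). \<Prod>i<k. f (g i))"
  using prod_sum_PiE[of "{..<k}" "\<lambda>_. F" "\<lambda>_ h. f h"] assms by simp

text \<open>Four replacements link the two transforms: the exponential by its Taylor polynomial on
  the restricted set, that set by all of \<open>\<Omega>\<close>, family moments by model moments,
  and the polynomial by the exponential in the model. The thresholds \<open>K / 6\<close> and
  \<open>48 * s1\<close> make the model-independent losses at most
  \<open>(exp (1/2) / 3) ^ K\<close>, \<open>2 * (exp (7/6) / 8) ^ K\<close> and
  \<open>2 * (exp 1 / 48) ^ K\<close>, where \<open>8 = 48 / 6\<close>; each base is below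
  \<open>exp (- 1/2)\<close>.\<close>

lemma (in prob_space) truncated_mgf_transfer:
  fixes U :: "'i \<Rightarrow> real" and S :: "'a \<Rightarrow> real"
  assumes \<Omega>: "finite \<Omega>" "\<Omega> \<noteq> {}" and S [measurable]: "S \<in> borel_measurable M"
    and S_bdd: "AE \<omega> in M. \<bar>S \<omega>\<bar> \<le> L"
    and K: "even K" "0 < K" and s: "0 \<le> s" "s \<le> s1" "0 < s1"
    and \<epsilon>: "0 \<le> \<epsilon>" and \<beta>: "0 \<le> \<beta>" "real K / 6 \<le> s1 * \<beta>"
    and moments: "\<And>j. j \<le> K \<Longrightarrow> \<bar>(\<Sum>a\<in>\<Omega>. U a ^ j) / card \<Omega> - (LINT \<omega>|M. S \<omega> ^ j)\<bar> \<le> \<epsilon> * \<beta> ^ j"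
    and mgf: "(LINT \<omega>|M. exp (48 * s1 * S \<omega>)) \<le> exp (real K)" "(LINT \<omega>|M. exp (- (48 * s1 * S \<omega>))) \<le> exp (real K)"
  shows "\<bar>(\<Sum>a\<in>{a\<in>\<Omega>. \<bar>U a\<bar> \<le> real K / (6 * s1)}. exp (s * U a)) / card \<Omega> - (LINT \<omega>|M. exp (s * S \<omega>))\<bar>
     \<le> 5 * exp (- real K / 2) + 2 * (\<epsilon> * (exp (real K / 6) * (6 * s1 * \<beta> / real K) ^ K))"
proof -
  define x0 where "x0 = real K / 6"
  have x0: "0 < x0" "x0 \<le> s1 * \<beta>" using K \<beta> by (auto simp: x0_def)
  define T where "T = {a\<in>\<Omega>. \<bar>U a\<bar> \<le> real K / (6 * s1)}"
  define c where "c = real (card \<Omega>)"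
  have c: "0 < c" using \<Omega> by (simp add: c_def card_gt_0_iff)
  have fT: "finite T" "T \<subseteq> \<Omega>" using \<Omega> by (auto simp: T_def)
  have cardT: "real (card T) \<le> c" using \<Omega> fT by (simp add: c_def card_mono)
  have int_bdd: "\<And>(f :: 'a \<Rightarrow> real) (b :: real). f \<in> borel_measurable M \<Longrightarrow> (\<And>\<omega>. \<bar>S \<omega>\<bar> \<le> L \<Longrightarrow> \<bar>f \<omega>\<bar> \<le> b) \<Longrightarrow> integrable M f"
  proof -
    fix f :: "'a \<Rightarrow> real" and b :: real
    assume f: "f \<in> borel_measurable M" "\<And>\<omega>. \<bar>S \<omega>\<bar> \<le> L \<Longrightarrow> \<bar>f \<omega>\<bar> \<le> b"
    show "integrable M f"
    proof (rule integrable_const_bound[OF _ f(1)])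
      show "AE \<omega> in M. norm (f \<omega>) \<le> b" using S_bdd by eventually_elim (use f in auto)
    qed
  qed
  have int_pow: "integrable M (\<lambda>\<omega>. S \<omega> ^ j)" for j
    by (rule int_bdd[of _ "L ^ j"]) (auto simp: power_abs intro!: power_mono)
  have int_exp: "integrable M (\<lambda>\<omega>. exp (t * S \<omega>))" for t
  proof (rule int_bdd[of _ "exp (\<bar>t\<bar> * L)"])
    fix \<omega> assume "\<bar>S \<omega>\<bar> \<le> L"
    hence "\<bar>t * S \<omega>\<bar> \<le> \<bar>t\<bar> * L" by (simp add: abs_mult mult_left_mono)
    thus "\<bar>exp (t * S \<omega>)\<bar> \<le> exp (\<bar>t\<bar> * L)" by simp
  qed simp
  have int_expabs: "integrable M (\<lambda>\<omega>. exp (t * \<bar>S \<omega>\<bar>))" for t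
  proof (rule int_bdd[of _ "exp (\<bar>t\<bar> * L)"])
    fix \<omega> assume "\<bar>S \<omega>\<bar> \<le> L"
    hence "\<bar>t * \<bar>S \<omega>\<bar>\<bar> \<le> \<bar>t\<bar> * L" by (simp add: abs_mult mult_left_mono)
    thus "\<bar>exp (t * \<bar>S \<omega>\<bar>)\<bar> \<le> exp (\<bar>t\<bar> * L)" by simp
  qed simp
  have Q: "(LINT \<omega>|M. exp (48 * s1 * \<bar>S \<omega>\<bar>)) \<le> 2 * exp (real K)"
  proof -
    have "(LINT \<omega>|M. exp (48 * s1 * \<bar>S \<omega>\<bar>)) \<le> (LINT \<omega>|M. exp (48 * s1 * S \<omega>) + exp (- (48 * s1 * S \<omega>)))"
      using int_exp[of "48 * s1"] int_exp[of "- (48 * s1)"]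
      by (intro integral_mono_AE AE_I2 int_expabs Bochner_Integration.integrable_add) (auto simp: abs_if)
    also have "\<dots> = (LINT \<omega>|M. exp (48 * s1 * S \<omega>)) + (LINT \<omega>|M. exp (- (48 * s1 * S \<omega>)))"
      using int_exp[of "48 * s1"] int_exp[of "- (48 * s1)"] by (intro Bochner_Integration.integral_add) auto
    finally show ?thesis using mgf by simp
  qed
  define \<mu> where "\<mu> = (\<lambda>j. (\<Sum>a\<in>\<Omega>. U a ^ j) / c)"
  define \<nu> where "\<nu> = (\<lambda>j. LINT \<omega>|M. S \<omega> ^ j)"
  have mom: "\<bar>\<mu> j - \<nu> j\<bar> \<le> \<epsilon> * \<beta> ^ j" if "j \<le> K" for j
    using moments[OF that] by (simp add: \<mu>_def \<nu>_def c_def)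
  \<comment> \<open>The bound of \<open>exp_trunc_abs_le_power\<close> for the polynomial at
    \<open>s1 * \<beta>\<close>. It measures the moment errors twice: in the \<open>K\<close>-th
    moment used outside \<open>T\<close>, and in the comparison of all moments.\<close>
  define E where "E = exp x0 * (6 * s1 * \<beta> / real K) ^ K"
  have Eeq: "E = (s1 * \<beta> / x0) ^ K * exp x0" by (simp add: E_def x0_def mult_ac)
  have eK: "exp (- (1/2)) ^ K = exp (- real K / 2)" by (simp add: exp_of_nat_mult[symmetric])

  have t1: "\<bar>(\<Sum>a\<in>T. exp (s * U a) - exp_trunc K (s * U a)) / c\<bar> \<le> exp (- real K / 2)"
  proof -
    have "\<bar>\<Sum>a\<in>T. exp (s * U a) - exp_trunc K (s * U a)\<bar> \<le> (\<Sum>a\<in>T. exp (- real K / 2))"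
    proof (rule order_trans[OF sum_abs sum_mono])
      fix a assume "a \<in> T"
      hence "\<bar>U a\<bar> \<le> x0 / s1" using s by (simp add: T_def x0_def)
      hence "\<bar>s * U a\<bar> \<le> s1 * (x0 / s1)" using s by (subst abs_mult, intro mult_mono) auto
      hence "\<bar>s * U a\<bar> \<le> x0" using s by simp
      hence "exp (3 * \<bar>s * U a\<bar>) / 3 ^ K \<le> exp (3 * x0) / 3 ^ K" by (intro divide_right_mono) auto
      also have "\<dots> = (exp (1/2) / 3) ^ K"
        by (simp add: x0_def power_divide exp_of_nat_mult[symmetric])
      also have "\<dots> \<le> exp (- (1/2)) ^ K"
      proof (rule power_mono)
        have "exp (1/2) = exp 1 * exp (- (1/2::real))" by (simp flip: exp_add)
        also have "\<dots> \<le> 3 * exp (- (1/2))" using exp_le by (intro mult_right_mono) auto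
        finally show "exp (1/2) / 3 \<le> exp (- (1/2::real))" by simp
      qed simp
      finally show "\<bar>exp (s * U a) - exp_trunc K (s * U a)\<bar> \<le> exp (- real K / 2)"
        using abs_exp_minus_trunc_le[of 3 "s * U a" K] unfolding eK by linarith
    qed
    also have "\<dots> \<le> c * exp (- real K / 2)" using cardT by simp
    finally show ?thesis using c by (simp add: field_simps)
  qed
  have t2: "\<bar>(\<Sum>a\<in>\<Omega> - T. exp_trunc K (s * U a)) / c\<bar> \<le> 2 * exp (- real K / 2) + \<epsilon> * E"
  proof -
    have "\<bar>\<Sum>a\<in>\<Omega> - T. exp_trunc K (s * U a)\<bar> \<le> (\<Sum>a\<in>\<Omega> - T. exp x0 * (s1 / x0) ^ K * U a ^ K)"
    proof (rule order_trans[OF sum_abs sum_mono])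
      fix a assume "a \<in> \<Omega> - T"
      hence "x0 / s1 < \<bar>U a\<bar>" using s by (auto simp: T_def x0_def)
      hence "x0 \<le> s1 * \<bar>U a\<bar>" using s by (simp add: field_simps)
      moreover have "\<bar>s * U a\<bar> \<le> s1 * \<bar>U a\<bar>" using s by (subst abs_mult, intro mult_mono) auto
      ultimately have "\<bar>exp_trunc K (s * U a)\<bar> \<le> (s1 * \<bar>U a\<bar> / x0) ^ K * exp x0"
        using x0 by (intro exp_trunc_abs_le_power) auto
      also have "\<dots> = exp x0 * (s1 / x0) ^ K * \<bar>U a\<bar> ^ K" by (simp add: power_divide power_mult_distrib)
      also have "\<bar>U a\<bar> ^ K = U a ^ K" using K(1) by (rule power_even_abs)
      finally show "\<bar>exp_trunc K (s * U a)\<bar> \<le> exp x0 * (s1 / x0) ^ K * U a ^ K" .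
    qed
    \<comment> \<open>As \<open>K\<close> is even, all terms are nonnegative and the sum may be
      completed to a full moment of the family.\<close>
    also have "\<dots> \<le> (\<Sum>a\<in>\<Omega>. exp x0 * (s1 / x0) ^ K * U a ^ K)"
      using \<Omega> K x0 s by (intro sum_mono2) (auto simp: zero_le_even_power)
    also have "\<dots> = exp x0 * (s1 / x0) ^ K * (c * \<mu> K)"
    proof -
      have "c * \<mu> K = (\<Sum>a\<in>\<Omega>. U a ^ K)" using c by (simp add: \<mu>_def)
      thus ?thesis by (simp add: sum_distrib_left)
    qed
    finally have "\<bar>(\<Sum>a\<in>\<Omega> - T. exp_trunc K (s * U a)) / c\<bar> \<le> exp x0 * (s1 / x0) ^ K * \<mu> K"
      using c by (simp add: field_simps)
    also have "\<dots> \<le> exp x0 * (s1 / x0) ^ K * (\<nu> K + \<epsilon> * \<beta> ^ K)"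
      using mom[of K] x0 s by (intro mult_left_mono) auto
    also have "\<dots> = exp x0 * (s1 / x0) ^ K * \<nu> K + \<epsilon> * E"
      unfolding Eeq by (simp add: algebra_simps power_divide power_mult_distrib add_divide_distrib)
    also have "exp x0 * (s1 / x0) ^ K * \<nu> K \<le> 2 * exp (- real K / 2)"
    proof -
      have "\<nu> K \<le> (LINT \<omega>|M. fact K / (48 * s1) ^ K * exp (48 * s1 * \<bar>S \<omega>\<bar>))"
        unfolding \<nu>_def
      proof (intro integral_mono_AE int_pow integrable_mult_right int_expabs AE_I2)
        fix \<omega>
        show "S \<omega> ^ K \<le> fact K / (48 * s1) ^ K * exp (48 * s1 * \<bar>S \<omega>\<bar>)"
          using power_le_fact_exp[of "48 * s1" "S \<omega>" K] s K by (simp add: power_even_abs)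
      qed
      also have "\<dots> = fact K / (48 * s1) ^ K * (LINT \<omega>|M. exp (48 * s1 * \<bar>S \<omega>\<bar>))" by simp
      also have "\<dots> \<le> real K ^ K / (48 * s1) ^ K * (2 * exp (real K))"
        using Q s fact_le_power[of K, where 'a = real] by (intro mult_mono divide_right_mono) auto
      finally have "exp x0 * (s1 / x0) ^ K * \<nu> K \<le> exp x0 * (s1 / x0) ^ K * (real K ^ K / (48 * s1) ^ K * (2 * exp (real K)))"
        using s x0 by (intro mult_left_mono) auto
      also have "\<dots> = 2 * (exp x0 * exp (real K) * ((s1 / x0) * (real K / (48 * s1))) ^ K)"
        by (simp add: power_divide power_mult_distrib)
      also have "(s1 / x0) * (real K / (48 * s1)) = 1 / 8" using s K by (simp add: x0_def)
      also have "exp x0 * exp (real K) * (1 / 8) ^ K = (exp (7/6) / 8) ^ K"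
        by (simp add: x0_def power_divide exp_of_nat_mult[symmetric] flip: exp_add)
      also have "\<dots> \<le> exp (- (1/2)) ^ K"
      proof (rule power_mono)
        have "exp (5/3 :: real) ^ 3 = exp 1 ^ 5" by (simp add: exp_of_nat_mult[symmetric])
        also have "\<dots> \<le> 3 ^ 5" using exp_le by (intro power_mono) auto
        also have "\<dots> \<le> (8::real) ^ 3" by simp
        finally have "exp (5/3 :: real) ^ 3 \<le> 8 ^ 3" .
        hence "exp (5/3 :: real) \<le> 8" by (subst (asm) power_mono_iff) auto
        hence "exp (5/3) * exp (- (1/2::real)) \<le> 8 * exp (- (1/2))" by (intro mult_right_mono) auto
        thus "exp (7/6) / 8 \<le> exp (- (1/2::real))" by (simp flip: exp_add)
      qed simp
      finally show ?thesis unfolding eK by simp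
    qed
    finally show ?thesis by simp
  qed
  have t3: "\<bar>(\<Sum>a\<in>\<Omega>. exp_trunc K (s * U a)) / c - (LINT \<omega>|M. exp_trunc K (s * S \<omega>))\<bar> \<le> \<epsilon> * E"
  proof -
    have "(\<Sum>a\<in>\<Omega>. exp_trunc K (s * U a)) / c = (\<Sum>j\<le>K. s ^ j / fact j * \<mu> j)"
      unfolding exp_trunc_def \<mu>_def
      by (subst sum.swap) (simp add: sum_divide_distrib sum_distrib_left power_mult_distrib)
    moreover have "(LINT \<omega>|M. exp_trunc K (s * S \<omega>)) = (\<Sum>j\<le>K. s ^ j / fact j * \<nu> j)"
    proof -
      have "(LINT \<omega>|M. exp_trunc K (s * S \<omega>)) = (LINT \<omega>|M. (\<Sum>j\<le>K. s ^ j / fact j * S \<omega> ^ j))"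
        unfolding exp_trunc_def by (simp add: power_mult_distrib)
      thus ?thesis unfolding \<nu>_def by (simp add: Bochner_Integration.integral_sum int_pow)
    qed
    ultimately have "(\<Sum>a\<in>\<Omega>. exp_trunc K (s * U a)) / c - (LINT \<omega>|M. exp_trunc K (s * S \<omega>))
       = (\<Sum>j\<le>K. s ^ j / fact j * (\<mu> j - \<nu> j))" by (simp add: right_diff_distrib sum_subtractf)
    also have "\<bar>\<dots>\<bar> \<le> (\<Sum>j\<le>K. \<epsilon> * ((s1 * \<beta>) ^ j / fact j))"
    proof (rule order_trans[OF sum_abs sum_mono])
      fix j assume "j \<in> {..K}"
      hence "\<bar>s ^ j / fact j * (\<mu> j - \<nu> j)\<bar> \<le> s1 ^ j / fact j * (\<epsilon> * \<beta> ^ j)"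
        using s mom[of j] by (simp only: abs_mult, intro mult_mono) (auto intro!: divide_right_mono power_mono)
      thus "\<bar>s ^ j / fact j * (\<mu> j - \<nu> j)\<bar> \<le> \<epsilon> * ((s1 * \<beta>) ^ j / fact j)"
        by (simp add: power_mult_distrib mult_ac)
    qed
    also have "\<dots> = \<epsilon> * exp_trunc K (s1 * \<beta>)" by (simp add: exp_trunc_def sum_distrib_left)
    also have "\<dots> \<le> \<epsilon> * E"
      unfolding Eeq using exp_trunc_abs_le_power[of "s1 * \<beta>" "s1 * \<beta>" x0 K] x0 s \<beta> \<epsilon>
      by (intro mult_left_mono) auto
    finally show ?thesis .
  qed
  have int_trunc: "integrable M (\<lambda>\<omega>. exp_trunc K (s * S \<omega>))"
    unfolding exp_trunc_def power_mult_distrib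
    by (intro Bochner_Integration.integrable_sum integrable_divide integrable_mult_right int_pow)
  have t4: "\<bar>(LINT \<omega>|M. exp_trunc K (s * S \<omega>)) - (LINT \<omega>|M. exp (s * S \<omega>))\<bar> \<le> 2 * exp (- real K / 2)"
  proof -
    have "\<bar>(LINT \<omega>|M. exp_trunc K (s * S \<omega>)) - (LINT \<omega>|M. exp (s * S \<omega>))\<bar>
       = \<bar>LINT \<omega>|M. exp (s * S \<omega>) - exp_trunc K (s * S \<omega>)\<bar>"
      using int_trunc int_exp[of s] by (simp add: abs_minus_commute)
    also have "\<dots> \<le> (LINT \<omega>|M. exp (48 * s1 * \<bar>S \<omega>\<bar>) / 48 ^ K)"
    proof (rule order_trans[OF integral_abs_bound integral_mono_AE])
      show "integrable M (\<lambda>\<omega>. \<bar>exp (s * S \<omega>) - exp_trunc K (s * S \<omega>)\<bar>)" using int_trunc int_exp[of s] by simp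
      show "integrable M (\<lambda>\<omega>. exp (48 * s1 * \<bar>S \<omega>\<bar>) / 48 ^ K)" using int_expabs by simp
      show "AE \<omega> in M. \<bar>exp (s * S \<omega>) - exp_trunc K (s * S \<omega>)\<bar> \<le> exp (48 * s1 * \<bar>S \<omega>\<bar>) / 48 ^ K"
      proof (rule AE_I2)
        fix \<omega>
        have "\<bar>exp (s * S \<omega>) - exp_trunc K (s * S \<omega>)\<bar> \<le> exp (48 * \<bar>s * S \<omega>\<bar>) / 48 ^ K"
          by (rule abs_exp_minus_trunc_le) simp
        also have "\<dots> \<le> exp (48 * s1 * \<bar>S \<omega>\<bar>) / 48 ^ K"
          using s by (intro divide_right_mono) (auto simp: abs_mult intro!: mult_right_mono)
        finally show "\<bar>exp (s * S \<omega>) - exp_trunc K (s * S \<omega>)\<bar> \<le> exp (48 * s1 * \<bar>S \<omega>\<bar>) / 48 ^ K" .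
      qed
    qed
    also have "\<dots> = (LINT \<omega>|M. exp (48 * s1 * \<bar>S \<omega>\<bar>)) / 48 ^ K" by simp
    also have "\<dots> \<le> 2 * exp (real K) / 48 ^ K" using Q by (intro divide_right_mono) auto
    also have "\<dots> = 2 * (exp 1 / 48) ^ K" by (simp add: power_divide exp_of_nat_mult[symmetric])
    also have "\<dots> \<le> 2 * exp (- (1/2)) ^ K"
    proof (intro mult_left_mono power_mono)
      have "exp (3/2 :: real) \<le> exp 1 ^ 2" by (simp add: exp_of_nat_mult[symmetric])
      also have "\<dots> \<le> 3 ^ 2" using exp_le by (intro power_mono) auto
      finally have "exp (3/2) * exp (- (1/2::real)) \<le> 48 * exp (- (1/2))" by (intro mult_right_mono) auto
      thus "exp 1 / 48 \<le> exp (- (1/2::real))" by (simp flip: exp_add)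
    qed auto
    finally show ?thesis unfolding eK .
  qed
  have split: "(\<Sum>a\<in>T. exp (s * U a)) / c = (\<Sum>a\<in>T. exp (s * U a) - exp_trunc K (s * U a)) / c
     - (\<Sum>a\<in>\<Omega> - T. exp_trunc K (s * U a)) / c + (\<Sum>a\<in>\<Omega>. exp_trunc K (s * U a)) / c"
    using sum.subset_diff[OF fT(2) \<Omega>(1), of "\<lambda>a. exp_trunc K (s * U a)"]
    by (simp add: sum_subtractf diff_divide_distrib add_divide_distrib)
  have lin: "\<bar>Z - I\<bar> \<le> 5 * e + 2 * q"
    if "\<bar>a\<bar> \<le> e" "\<bar>b\<bar> \<le> 2 * e + q" "\<bar>d - f\<bar> \<le> q" "\<bar>f - I\<bar> \<le> 2 * e" "Z = a - b + d" for Z I a b d f e q :: real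
    using that by linarith
  show ?thesis
    using lin[OF t1 t2 t3 t4 split] unfolding T_def c_def E_def x0_def .
qed

section \<open>The random sum, its transform and its moments\<close>

context trace_model
begin

definition rand_sum :: "nat \<Rightarrow> 'b \<Rightarrow> real" where
  "rand_sum m \<omega> = (\<Sum>h\<in>freqs m. sine_coeff m h * X h \<omega>)"

lemma freqs_nonzero: "h \<in> freqs m \<Longrightarrow> h \<noteq> 0" by (simp add: freqs_def)

lemma rv_rand_sum [measurable]: "rand_sum m \<in> borel_measurable M"
  unfolding rand_sum_def by (intro borel_measurable_sum borel_measurable_times borel_measurable_const rv_X freqs_nonzero)

lemma AE_freqs_bounded: "AE \<omega> in M. \<forall>h\<in>freqs m. \<bar>X h \<omega>\<bar> \<le> N"
proof (rule AE_finite_allI[OF finite_freqs])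
  fix h assume "h \<in> freqs m"
  from bounded_X[OF freqs_nonzero[OF this]] show "AE \<omega> in M. \<bar>X h \<omega>\<bar> \<le> N"
    by eventually_elim auto
qed

lemma rand_sum_bounded: "AE \<omega> in M. \<bar>rand_sum m \<omega>\<bar> \<le> (\<Sum>h\<in>freqs m. \<bar>sine_coeff m h\<bar> * N)"
  using AE_freqs_bounded[of m]
proof eventually_elim
  case (elim \<omega>)
  show ?case unfolding rand_sum_def
    by (rule order_trans[OF sum_abs sum_mono]) (use elim in \<open>auto simp: abs_mult intro!: mult_left_mono\<close>)
qed

lemma lint_exp_rand_sum: "(LINT \<omega>|M. exp (t * rand_sum m \<omega>)) = exp (\<Sum>h\<in>freqs m. cgf (t * sine_coeff m h))"
proof -
  have ind: "indep_vars (\<lambda>_. borel) (\<lambda>h \<omega>. exp (t * sine_coeff m h * X h \<omega>)) (freqs m)"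
    by (rule indep_vars_compose2[OF indep_vars_subset[OF indep]]) (auto simp: freqs_def)
  have "(LINT \<omega>|M. exp (t * rand_sum m \<omega>)) = (LINT \<omega>|M. (\<Prod>h\<in>freqs m. exp (t * sine_coeff m h * X h \<omega>)))"
    by (simp add: rand_sum_def exp_sum finite_freqs sum_distrib_left mult.assoc)
  also have "\<dots> = (\<Prod>h\<in>freqs m. LINT \<omega>|M. exp (t * sine_coeff m h * X h \<omega>))"
  proof (rule indep_vars_lebesgue_integral[OF finite_freqs ind])
    fix h assume h: "h \<in> freqs m"
    have "integrable (distr M borel Y) (\<lambda>x. exp (t * sine_coeff m h * x))"
      by (subst integrable_distr_eq) (auto intro: pos.integrable_exp)
    thus "integrable M (\<lambda>\<omega>. exp (t * sine_coeff m h * X h \<omega>))"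
      unfolding same_distr[OF freqs_nonzero[OF h], symmetric]
      by (subst (asm) integrable_distr_eq) (use rv_X[OF freqs_nonzero[OF h]] in auto)
  qed
  also have "\<dots> = (\<Prod>h\<in>freqs m. exp (cgf (t * sine_coeff m h)))"
  proof (rule prod.cong[OF refl])
    fix h assume "h \<in> freqs m"
    thus "(LINT \<omega>|M. exp (t * sine_coeff m h * X h \<omega>)) = exp (cgf (t * sine_coeff m h))"
      using pos.mgf_ge_1[of "t * sine_coeff m h"] by (simp add: lint_exp_X freqs_nonzero pos.cgf_def)
  qed
  finally show ?thesis by (simp add: exp_sum finite_freqs)
qed

lemma integrable_prod_X:
  fixes k :: nat
  assumes "g \<in> PiE {..<k} (\<lambda>_. freqs m)"
  shows "integrable M (\<lambda>\<omega>. \<Prod>i<k. X (g i) \<omega>)"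
proof (rule integrable_const_bound[where B = "N ^ k"])
  have g: "g i \<in> freqs m" if "i < k" for i using assms that by auto
  show "(\<lambda>\<omega>. \<Prod>i<k. X (g i) \<omega>) \<in> borel_measurable M"
    using g by (intro borel_measurable_prod rv_X) (auto dest: freqs_nonzero)
  show "AE \<omega> in M. norm (\<Prod>i<k. X (g i) \<omega>) \<le> N ^ k"
    using AE_freqs_bounded[of m]
  proof eventually_elim
    case (elim \<omega>)
    have "norm (\<Prod>i<k. X (g i) \<omega>) = (\<Prod>i<k. \<bar>X (g i) \<omega>\<bar>)" by (simp add: abs_prod)
    also have "\<dots> \<le> (\<Prod>i<k. N)" using elim g by (intro prod_mono) auto
    finally show ?case by simp
  qed
qed

text \<open>Expanding the power over \<open>k\<close>-tuples of frequencies, the hypothesis applies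
  to each tuple separately. The weights sum in absolute value to the \<open>k\<close>-th power of
  the sum of the \<open>\<bar>sine_coeff m h\<bar>\<close>, whence the factor
  \<open>\<beta> ^ k\<close>.\<close>

lemma moment_transfer:
  fixes \<Omega> :: "'a set" and \<phi> :: "'a \<Rightarrow> int \<Rightarrow> complex"
  assumes fam: "periodic_family m \<Omega> \<phi>" and bdd: "fourier_bounded N m \<Omega> \<phi>"
    and mm: "moments_match M X \<eta> C1 D m \<Omega> \<phi>" and k: "real k \<le> ln (real m) / ln (ln (real m))"
    and C1: "C1 > 1" and \<beta>: "(\<Sum>h\<in>freqs m. \<bar>sine_coeff m h\<bar>) \<le> \<beta>"
  shows "\<bar>(\<Sum>a\<in>\<Omega>. (\<Sum>h\<in>freqs m. sine_coeff m h * Re (fourier_mod m (\<phi> a) h)) ^ k) / card \<Omega>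
      - (LINT \<omega>|M. rand_sum m \<omega> ^ k)\<bar> \<le> (\<bar>D\<bar> / real m powr \<eta>) * (C1 * \<beta>) ^ k"
\<comment> \<open>\<open>moments_match\<close> speaks of positive orders only; at order 0 both sides
  are the total mass 1.\<close>
proof (cases "k = 0")
  case True
  have "card \<Omega> \<noteq> 0" using fam by (auto simp: periodic_family_def)
  thus ?thesis using True by (simp add: prob_space)
next
  case False
  let ?P = "PiE {..<k} (\<lambda>_. freqs m)"
  define r where "r = (\<lambda>a h. Re (fourier_mod m (\<phi> a) h))"
  define b where "b = (\<lambda>g. \<Prod>i<k. sine_coeff m (g i))"
  have re: "fourier_mod m (\<phi> a) h = complex_of_real (r a h)" if "a \<in> \<Omega>" for a h
  proof -
    have "fourier_mod m (\<phi> a) h \<in> complex_of_real ` {-N..N}"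
      using bdd that unfolding fourier_bounded_def by blast
    thus ?thesis by (auto simp: r_def)
  qed
  have "(\<Sum>a\<in>\<Omega>. (\<Sum>h\<in>freqs m. sine_coeff m h * r a h) ^ k) = (\<Sum>a\<in>\<Omega>. \<Sum>g\<in>?P. b g * (\<Prod>i<k. r a (g i)))"
    by (simp add: power_sum_PiE finite_freqs prod.distrib b_def)
  also have "\<dots> = (\<Sum>g\<in>?P. \<Sum>a\<in>\<Omega>. b g * (\<Prod>i<k. r a (g i)))" by (rule sum.swap)
  finally have 1: "(\<Sum>a\<in>\<Omega>. (\<Sum>h\<in>freqs m. sine_coeff m h * r a h) ^ k) / card \<Omega>
     = (\<Sum>g\<in>?P. b g * ((\<Sum>a\<in>\<Omega>. \<Prod>i<k. r a (g i)) / card \<Omega>))"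
    by (simp add: sum_divide_distrib sum_distrib_left)
  have "(LINT \<omega>|M. rand_sum m \<omega> ^ k) = (LINT \<omega>|M. (\<Sum>g\<in>?P. b g * (\<Prod>i<k. X (g i) \<omega>)))"
    by (simp add: rand_sum_def power_sum_PiE finite_freqs prod.distrib b_def)
  also have "\<dots> = (\<Sum>g\<in>?P. b g * (LINT \<omega>|M. (\<Prod>i<k. X (g i) \<omega>)))"
    by (subst Bochner_Integration.integral_sum) (auto intro!: integrable_mult_right integrable_prod_X)
  finally have 2: "(LINT \<omega>|M. rand_sum m \<omega> ^ k) = (\<Sum>g\<in>?P. b g * (LINT \<omega>|M. (\<Prod>i<k. X (g i) \<omega>)))" .
  have close: "\<bar>(\<Sum>a\<in>\<Omega>. \<Prod>i<k. r a (g i)) / card \<Omega> - (LINT \<omega>|M. (\<Prod>i<k. X (g i) \<omega>))\<bar> \<le> \<bar>D\<bar> * (C1 ^ k / real m powr \<eta>)"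
    if "g \<in> ?P" for g
  proof -
    have g: "g i \<in> freqs m" if "i < k" for i using \<open>g \<in> ?P\<close> that by auto
    hence "\<forall>i<k. g i \<noteq> 0 \<and> - real m / 2 < real_of_int (g i) \<and> real_of_int (g i) \<le> real m / 2"
      by (auto simp: freqs_def)
    hence "cmod ((\<Sum>a\<in>\<Omega>. \<Prod>i<k. fourier_mod m (\<phi> a) (g i)) / of_nat (card \<Omega>)
                - complex_of_real (LINT \<omega>|M. (\<Prod>i<k. X (g i) \<omega>))) \<le> D * (C1 ^ k / real m powr \<eta>)"
      using mm False k unfolding moments_match_def by blast
    also have "(\<Sum>a\<in>\<Omega>. \<Prod>i<k. fourier_mod m (\<phi> a) (g i)) / of_nat (card \<Omega>)
                - complex_of_real (LINT \<omega>|M. (\<Prod>i<k. X (g i) \<omega>)) =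
       complex_of_real ((\<Sum>a\<in>\<Omega>. \<Prod>i<k. r a (g i)) / card \<Omega> - (LINT \<omega>|M. (\<Prod>i<k. X (g i) \<omega>)))"
      by (simp add: re)
    also have "D * (C1 ^ k / real m powr \<eta>) \<le> \<bar>D\<bar> * (C1 ^ k / real m powr \<eta>)"
      using C1 by (intro mult_right_mono) auto
    finally show ?thesis by (simp only: norm_of_real real_norm_def)
  qed
  have "\<bar>(\<Sum>a\<in>\<Omega>. (\<Sum>h\<in>freqs m. sine_coeff m h * r a h) ^ k) / card \<Omega> - (LINT \<omega>|M. rand_sum m \<omega> ^ k)\<bar>
     = \<bar>\<Sum>g\<in>?P. b g * ((\<Sum>a\<in>\<Omega>. \<Prod>i<k. r a (g i)) / card \<Omega> - (LINT \<omega>|M. (\<Prod>i<k. X (g i) \<omega>)))\<bar>"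
    unfolding 1 2 by (simp add: sum_subtractf right_diff_distrib)
  also have "\<dots> \<le> (\<Sum>g\<in>?P. \<bar>b g\<bar> * (\<bar>D\<bar> * (C1 ^ k / real m powr \<eta>)))"
    by (rule order_trans[OF sum_abs sum_mono]) (auto simp only: abs_mult intro!: mult_left_mono close abs_ge_zero)
  also have "\<dots> = (\<Sum>g\<in>?P. \<bar>b g\<bar>) * (\<bar>D\<bar> * (C1 ^ k / real m powr \<eta>))" by (simp only: sum_distrib_right)
  also have "(\<Sum>g\<in>?P. \<bar>b g\<bar>) = (\<Sum>h\<in>freqs m. \<bar>sine_coeff m h\<bar>) ^ k"
    by (simp add: power_sum_PiE finite_freqs b_def abs_prod)
  also have "\<dots> * (\<bar>D\<bar> * (C1 ^ k / real m powr \<eta>)) \<le> \<beta> ^ k * (\<bar>D\<bar> * (C1 ^ k / real m powr \<eta>))"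
    using \<beta> C1 by (intro mult_right_mono power_mono) (auto intro: sum_nonneg)
  finally show ?thesis by (simp add: r_def power_mult_distrib mult_ac)
qed

end

lemma sum_abs_sine_coeff_le:
  assumes "m \<ge> 1"
  shows "(\<Sum>h\<in>freqs m. \<bar>sine_coeff m h\<bar>) \<le> 4 * (ln (real m) + 1)"
proof -
  have sub: "freqs m \<subseteq> int ` {1..m} \<union> (\<lambda>j. - int j) ` {1..m}"
  proof
    fix h assume h: "h \<in> freqs m"
    hence "h \<noteq> 0" "\<bar>real_of_int h\<bar> \<le> real m" using freqs_abs_le[OF h] by (auto simp: freqs_def)
    hence "\<bar>h\<bar> \<le> int m" by linarith
    thus "h \<in> int ` {1..m} \<union> (\<lambda>j. - int j) ` {1..m}"
      using \<open>h \<noteq> 0\<close> by (cases h rule: int_cases2) (auto intro!: image_eqI)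
  qed
  have "(\<Sum>h\<in>freqs m. \<bar>sine_coeff m h\<bar>) \<le> (\<Sum>h\<in>freqs m. 2 / \<bar>real_of_int h\<bar>)"
    by (intro sum_mono sine_coeff_abs_le)
  also have "\<dots> \<le> (\<Sum>h\<in>int ` {1..m} \<union> (\<lambda>j. - int j) ` {1..m}. 2 / \<bar>real_of_int h\<bar>)"
    using sub by (intro sum_mono2) auto
  also have "\<dots> \<le> (\<Sum>h\<in>int ` {1..m}. 2 / \<bar>real_of_int h\<bar>) + (\<Sum>h\<in>(\<lambda>j. - int j) ` {1..m}. 2 / \<bar>real_of_int h\<bar>)"
    by (subst sum_Un) (auto intro!: sum_nonneg)
  also have "(\<Sum>h\<in>int ` {1..m}. 2 / \<bar>real_of_int h\<bar>) = 2 * harm m"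
    by (subst sum.reindex) (auto simp: harm_def sum_distrib_left divide_inverse)
  also have "(\<Sum>h\<in>(\<lambda>j. - int j) ` {1..m}. 2 / \<bar>real_of_int h\<bar>) = 2 * harm m"
    by (subst sum.reindex) (auto simp: harm_def sum_distrib_left divide_inverse inj_on_def)
  finally have "(\<Sum>h\<in>freqs m. \<bar>sine_coeff m h\<bar>) \<le> 4 * harm m" by simp
  also have "harm m \<le> ln (real m) + 1"
  proof -
    have "decseq (\<lambda>n. harm (Suc n) - ln (real (Suc n)))" using decseq_harm_diff_ln by simp
    hence "harm (Suc (m - 1)) - ln (real (Suc (m - 1))) \<le> harm (Suc 0) - ln (real (Suc 0))"
      by (rule decseqD) simp
    thus ?thesis using assms by (simp add: harm_expand)
  qed
  finally show ?thesis by simp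
qed

subsection \<open>Large deviations for the family\<close>

text \<open>Here \<open>l\<close> stands for \<open>ln m\<close>, and \<open>l / (4 * ln l)\<close>,
  with and without \<open>- 2\<close>, encloses \<open>K\<close>. The decisive lines are the fifth,
  where the transform at \<open>z = 48 * s1\<close> has logarithm about
  \<open>l / (50 * ln l)\<close>, below \<open>K\<close>, and the last two, where the base in the
  moment error stays below \<open>l\<close> and its \<open>K\<close>-th power
  \<open>exp (l / 4)\<close> loses against \<open>exp (- l / 2)\<close>.\<close>

lemma transfer_range_asymptotics:
  fixes k rc C c D :: real
  assumes "k > 0" "c > 1"
  defines "s1 \<equiv> \<lambda>l. l / (2400 * k * (ln l)\<^sup>2)"
  defines "z \<equiv> \<lambda>l. l / (50 * k * (ln l)\<^sup>2)"
  shows "\<forall>\<^sub>F l::real in at_top. 0 < ln l" "\<forall>\<^sub>F l::real in at_top. 2 < l / (4 * ln l) - 2"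
    "\<forall>\<^sub>F l::real in at_top. 4 \<le> z l" "\<forall>\<^sub>F l::real in at_top. z l \<le> l"
    "\<forall>\<^sub>F l::real in at_top. k * z l * (ln (z l) + rc) + C * ln (z l) \<le> l / (4 * ln l) - 2"
    "\<forall>\<^sub>F l::real in at_top. l / (4 * ln l) / 6 \<le> s1 l * (c * (4 * (l + 1)))"
    "\<forall>\<^sub>F l::real in at_top. 5 * exp (- (l / (4 * ln l) - 2) / 2) \<le> 1 / 4"
    "\<forall>\<^sub>F l::real in at_top. 6 * s1 l * (c * (4 * (l + 1))) / (l / (4 * ln l) - 2) \<le> l"
    "\<forall>\<^sub>F l::real in at_top. 2 * (\<bar>D\<bar> * exp (- l / 2) * (exp (l / (4 * ln l) / 6) * exp (l / 4))) \<le> 1 / 4"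
  unfolding s1_def z_def by - (use assms(1,2) in real_asymp)+

lemma V_range_asymptotics:
  fixes k b v :: real
  assumes "k > 0"
  shows "\<forall>\<^sub>F m::nat in sequentially. v \<le> k * (ln (ln (real m)) - 2 * ln (ln (ln (real m))) - b)"
proof -
  have "filterlim (\<lambda>m::nat. k * (ln (ln (real m)) - 2 * ln (ln (ln (real m))) - b)) at_top sequentially"
    using assms by real_asymp
  thus ?thesis by (simp add: filterlim_at_top)
qed

text \<open>The right sides of the last two claims are \<open>s0 V * (w V)\<^sup>2 / (4 * k)\<close>
  and \<open>s0 V * w V\<close>: the logarithmic uncertainty of the transform is to be smaller than
  the gain on the tails and than the loss in the window.\<close>

lemma tilting_asymptotics:
  fixes k rc C :: real
  assumes "k > 0"
  defines "s0 \<equiv> \<lambda>V. exp (V / k - rc - 1)" and "w \<equiv> \<lambda>V. V * exp (- V / (2 * k))"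
  shows "\<forall>\<^sub>F V::real in at_top. 16 \<le> s0 V" "\<forall>\<^sub>F V::real in at_top. w V / k \<le> 1 / 4"
    "\<forall>\<^sub>F V::real in at_top. 2 * (C * (ln 2 + (V / k - rc - 1))) + ln 16 \<le> exp (- rc - 1) * V\<^sup>2 / (4 * k)"
    "\<forall>\<^sub>F V::real in at_top. C * (ln 2 + (V / k - rc - 1)) + ln 4 \<le> exp (- rc - 1) * V * exp (V / (2 * k))"
  unfolding s0_def w_def by - (use assms(1) in real_asymp)+

text \<open>The analytic core, detached from the family: \<open>\<Psi>\<close> is any transform
  close to \<open>exp (R t)\<close>, and \<open>P\<close> any number satisfying the tilting
  inequality with it. The derivative of \<open>R\<close> at \<open>s0 V\<close> is \<open>V\<close>.
  Bounds for \<open>\<Psi>\<close> up to \<open>2 * s0 V\<close> suffice, since the largest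
  parameter used is at most \<open>9/8 * 3/2\<close> times \<open>s0 V\<close>.\<close>

lemma tilting_bound:
  fixes \<kappa> rc C :: real
  assumes \<kappa>: "\<kappa> > 0" and C: "C \<ge> 0"
  defines "R \<equiv> \<lambda>t. \<kappa> * t * (ln t + rc)"
  defines "s0 \<equiv> \<lambda>V. exp (V / \<kappa> - rc - 1)" and "w \<equiv> \<lambda>V. V * exp (- V / (2 * \<kappa>))"
  shows "\<exists>V0\<ge>1. \<forall>V\<ge>V0. \<forall>\<Psi> P.
     (\<forall>t. 4 \<le> t \<and> t \<le> 2 * s0 V \<longrightarrow> exp (R t - C * ln t) / 2 \<le> \<Psi> t \<and> \<Psi> t \<le> 2 * exp (R t + C * ln t)) \<longrightarrow>
     (\<forall>s \<delta> V'. 0 \<le> s \<longrightarrow> 0 \<le> \<delta> \<longrightarrow> \<Psi> s \<le> exp (s * V') * P + exp (\<delta> * V) * \<Psi> (s - \<delta>) + exp (- \<delta> * V') * \<Psi> (s + \<delta>)) \<longrightarrow>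
     exp (- (\<kappa> * s0 V * (1 + 9 / (2 * \<kappa>) * w V))) \<le> P"
proof -
  have "\<forall>\<^sub>F V::real in at_top. 16 \<le> s0 V \<and> w V / \<kappa> \<le> 1 / 4
    \<and> 2 * (C * (ln 2 + (V / \<kappa> - rc - 1))) + ln 16 \<le> exp (- rc - 1) * V\<^sup>2 / (4 * \<kappa>)
    \<and> C * (ln 2 + (V / \<kappa> - rc - 1)) + ln 4 \<le> exp (- rc - 1) * V * exp (V / (2 * \<kappa>))"
    unfolding s0_def w_def by (intro eventually_conj tilting_asymptotics \<kappa>)
  then obtain V1 where V1: "\<And>V. V \<ge> V1 \<Longrightarrow> 16 \<le> s0 V \<and> w V / \<kappa> \<le> 1 / 4
    \<and> 2 * (C * (ln 2 + (V / \<kappa> - rc - 1))) + ln 16 \<le> exp (- rc - 1) * V\<^sup>2 / (4 * \<kappa>)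
    \<and> C * (ln 2 + (V / \<kappa> - rc - 1)) + ln 4 \<le> exp (- rc - 1) * V * exp (V / (2 * \<kappa>))"
    unfolding eventually_at_top_linorder by blast
  have bound: "exp (- (\<kappa> * s0 V * (1 + 9 / (2 * \<kappa>) * w V))) \<le> P"
    if V: "V \<ge> max 1 V1"
      and \<Psi>: "\<And>t. 4 \<le> t \<Longrightarrow> t \<le> 2 * s0 V \<Longrightarrow> exp (R t - C * ln t) / 2 \<le> \<Psi> t \<and> \<Psi> t \<le> 2 * exp (R t + C * ln t)"
      and tilt: "\<And>s \<delta> V'. 0 \<le> s \<Longrightarrow> 0 \<le> \<delta> \<Longrightarrow> \<Psi> s \<le> exp (s * V') * P + exp (\<delta> * V) * \<Psi> (s - \<delta>) + exp (- \<delta> * V') * \<Psi> (s + \<delta>)"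
    for V P and \<Psi> :: "real \<Rightarrow> real"
  proof -
    define \<sigma> where "\<sigma> = s0 V"
    define lam where "lam = w V"
    define \<theta> where "\<theta> = lam / (2 * \<kappa>)"
    define s where "s = \<sigma> * exp (lam / \<kappa>)"
    \<comment> \<open>\<open>s\<close> satisfies \<open>R' s = V + lam\<close>, the midpoint of the window from \<open>V\<close> to \<open>V'\<close>; \<open>\<theta>\<close> minimises \<open>\<kappa> \<theta>\<^sup>2 - \<theta> lam\<close>.\<close>
    define V' where "V' = V + 2 * lam"
    \<comment> \<open>This is \<open>C * ln (2 * \<sigma>)\<close>, hence a common bound for
      \<open>C * ln t\<close> over all parameters that occur.\<close>
    define Lg where "Lg = C * (ln 2 + (V / \<kappa> - rc - 1))"
    have c: "16 \<le> \<sigma>" "lam / \<kappa> \<le> 1 / 4" "2 * Lg + ln 16 \<le> exp (- rc - 1) * V\<^sup>2 / (4 * \<kappa>)"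
       "Lg + ln 4 \<le> exp (- rc - 1) * V * exp (V / (2 * \<kappa>))"
      using V1[of V] V by (auto simp: \<sigma>_def lam_def Lg_def)
    have lam: "0 < lam" using V by (simp add: lam_def w_def)
    have lnx: "ln (2 * \<sigma>) = ln 2 + (V / \<kappa> - rc - 1)" by (simp add: \<sigma>_def s0_def ln_mult_pos)
    have e2: "exp (lam / \<kappa>) \<le> 1 + 2 * (lam / \<kappa>)"
    proof -
      have "exp (lam / \<kappa>) \<le> 1 + lam / \<kappa> + (lam / \<kappa>)\<^sup>2" using c(2) lam \<kappa> by (intro exp_bound) auto
      moreover have "(lam / \<kappa>) * (lam / \<kappa>) \<le> (lam / \<kappa>) * 1" using c(2) lam \<kappa> by (intro mult_left_mono) auto
      ultimately show ?thesis by (simp add: power2_eq_square)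
    qed
    have s_lo: "\<sigma> \<le> s" using c(1) lam \<kappa> by (simp add: s_def)
    have s_hi: "s \<le> \<sigma> + 2 * (\<sigma> * lam) / \<kappa>"
      using mult_left_mono[OF e2, of \<sigma>] c(1) by (simp add: s_def algebra_simps)
    have "exp (lam / \<kappa>) \<le> 3 / 2" using e2 c(2) by linarith
    hence "\<sigma> * exp (lam / \<kappa>) \<le> \<sigma> * (3 / 2)" using c(1) by (intro mult_left_mono) auto
    hence s_hi2: "s \<le> 3 / 2 * \<sigma>" by (simp add: s_def)
    have \<theta>: "0 < \<theta>" "\<theta> \<le> 1 / 8" using lam \<kappa> c(2) by (auto simp: \<theta>_def field_simps)
    define \<delta> where "\<delta> = s * \<theta>"
    have s0: "s > 0" using s_lo c by linarith
    have \<delta>: "0 \<le> \<delta>" "\<delta> \<le> s / 8" using s0 \<theta> by (auto simp: \<delta>_def)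
    have ls: "ln s + rc = (V + lam) / \<kappa> - 1"
      using \<kappa> by (simp add: s_def \<sigma>_def s0_def ln_mult_pos add_divide_distrib)
    have Rs: "R s = s * (V + lam) - \<kappa> * s"
      unfolding R_def ls using \<kappa> by (simp add: field_simps)
    have quad: "\<kappa> * \<theta>\<^sup>2 - \<theta> * lam = - lam\<^sup>2 / (4 * \<kappa>)"
      using \<kappa> by (simp add: \<theta>_def power2_eq_square field_simps)
    have key: "exp (- rc - 1) * V\<^sup>2 / (4 * \<kappa>) \<le> s * lam\<^sup>2 / (4 * \<kappa>)"
    proof -
      have "\<sigma> * lam\<^sup>2 = exp (- rc - 1) * V\<^sup>2"
      proof -
        have "exp (V / \<kappa> - rc - 1) * (exp (- V / (2 * \<kappa>)))\<^sup>2 = exp (- rc - 1)"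
          unfolding power2_eq_square exp_add[symmetric] by (simp add: field_simps)
        thus ?thesis by (simp add: \<sigma>_def lam_def s0_def w_def power_mult_distrib)
      qed
      moreover have "\<sigma> * lam\<^sup>2 \<le> s * lam\<^sup>2" using s_lo by (intro mult_right_mono) auto
      ultimately show ?thesis using \<kappa> by (simp add: divide_right_mono)
    qed
    have Lgt: "C * ln t \<le> Lg" if "4 \<le> t" "t \<le> 2 * \<sigma>" for t
      unfolding Lg_def lnx[symmetric] using that C by (intro mult_left_mono) auto
    have range: "4 \<le> s" "s \<le> 2 * \<sigma>" "4 \<le> s - \<delta>" "s - \<delta> \<le> 2 * \<sigma>" "4 \<le> s + \<delta>" "s + \<delta> \<le> 2 * \<sigma>"
      using s_lo s_hi2 c(1) \<delta> by linarith+
    have lower: "exp (R s - Lg) / 2 \<le> \<Psi> s"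
    proof -
      have "exp (R s - Lg) \<le> exp (R s - C * ln s)" using Lgt[of s] range by simp
      moreover have "exp (R s - C * ln s) / 2 \<le> \<Psi> s" using \<Psi>[of s, folded \<sigma>_def] range(1,2) by blast
      ultimately show ?thesis by linarith
    qed
    \<comment> \<open>The gain \<open>s * lam\<^sup>2 / (4 * \<kappa>)\<close> has to pay for
      \<open>Lg\<close> twice, once at \<open>t\<close> and once at \<open>s\<close>, and for
      \<open>16 = 2 * 2 * 4\<close>: a factor 2 in each bound for \<open>\<Psi>\<close>, and 4 to
      leave a quarter.\<close>
    have tail: "exp q * \<Psi> t \<le> 1 / 4 * \<Psi> s"
      if t: "4 \<le> t" "t \<le> 2 * \<sigma>" and q: "q + R t - R s \<le> s * (\<kappa> * \<theta>\<^sup>2 - \<theta> * lam)" for q t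
    proof -
      have "\<Psi> t \<le> 2 * exp (R t + C * ln t)" using \<Psi>[of t, folded \<sigma>_def] t by blast
      also have "\<dots> \<le> 2 * exp (R t + Lg)" using Lgt[OF t] by simp
      finally have "exp q * \<Psi> t \<le> exp q * (2 * exp (R t + Lg))" by (intro mult_left_mono) auto
      also have "\<dots> = 2 * exp (q + R t + Lg)" by (simp add: exp_add)
      also have "\<dots> \<le> 2 * exp (R s - Lg - ln 16)"
        using q key c(3) unfolding quad by simp
      also have "\<dots> = 1 / 4 * (exp (R s - Lg) / 2)" by (simp add: exp_diff)
      also have "\<dots> \<le> 1 / 4 * \<Psi> s" using lower by simp
      finally show ?thesis .
    qed
    have t1: "exp (\<delta> * V) * \<Psi> (s - \<delta>) \<le> 1 / 4 * \<Psi> s"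
    proof (rule tail[OF range(3,4)])
      have "s - \<delta> = s * (1 - \<theta>)" by (simp add: \<delta>_def algebra_simps)
      moreover have "ln (s * (1 - \<theta>)) = ln s + ln (1 - \<theta>)" using s0 \<theta> by (simp add: ln_mult_pos)
      moreover have "ln (1 - \<theta>) \<le> - \<theta>" using ln_le_minus_one[of "1 - \<theta>"] \<theta> by simp
      hence "\<kappa> * (s * (1 - \<theta>)) * ln (1 - \<theta>) \<le> \<kappa> * (s * (1 - \<theta>)) * (- \<theta>)"
        using \<kappa> s0 \<theta> by (intro mult_left_mono) auto
      ultimately have "R (s - \<delta>) \<le> \<kappa> * (s * (1 - \<theta>)) * (ln s + rc) + \<kappa> * (s * (1 - \<theta>)) * (- \<theta>)"
        unfolding R_def by (simp add: algebra_simps)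
      also have "\<kappa> * (s * (1 - \<theta>)) * (ln s + rc) = (1 - \<theta>) * R s" by (simp add: R_def)
      finally show "\<delta> * V + R (s - \<delta>) - R s \<le> s * (\<kappa> * \<theta>\<^sup>2 - \<theta> * lam)"
        unfolding Rs \<delta>_def by (simp add: algebra_simps power2_eq_square)
    qed
    have t2: "exp (- \<delta> * V') * \<Psi> (s + \<delta>) \<le> 1 / 4 * \<Psi> s"
    proof (rule tail[OF range(5,6)])
      have "s + \<delta> = s * (1 + \<theta>)" by (simp add: \<delta>_def algebra_simps)
      moreover have "ln (s * (1 + \<theta>)) = ln s + ln (1 + \<theta>)" using s0 \<theta> by (simp add: ln_mult_pos)
      moreover have "ln (1 + \<theta>) \<le> \<theta>" using ln_le_minus_one[of "1 + \<theta>"] \<theta> by simp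
      hence "\<kappa> * (s * (1 + \<theta>)) * ln (1 + \<theta>) \<le> \<kappa> * (s * (1 + \<theta>)) * \<theta>"
        using \<kappa> s0 \<theta> by (intro mult_left_mono) auto
      ultimately have "R (s + \<delta>) \<le> \<kappa> * (s * (1 + \<theta>)) * (ln s + rc) + \<kappa> * (s * (1 + \<theta>)) * \<theta>"
        unfolding R_def by (simp add: algebra_simps)
      also have "\<kappa> * (s * (1 + \<theta>)) * (ln s + rc) = (1 + \<theta>) * R s" by (simp add: R_def)
      finally show "- \<delta> * V' + R (s + \<delta>) - R s \<le> s * (\<kappa> * \<theta>\<^sup>2 - \<theta> * lam)"
        unfolding Rs \<delta>_def V'_def by (simp add: algebra_simps power2_eq_square)
    qed
    \<comment> \<open>Each tail takes at most a quarter of the tilted mass, so at least half of it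
      is left for the window.\<close>
    have "\<Psi> s \<le> exp (s * V') * P + 1 / 4 * \<Psi> s + 1 / 4 * \<Psi> s"
      using tilt[of s \<delta> V'] s0 \<delta>(1) t1 t2 by linarith
    hence "exp (R s - Lg) / 4 \<le> exp (s * V') * P" using lower by linarith
    hence "exp (- (s * V')) * (exp (R s - Lg) / 4) \<le> exp (- (s * V')) * (exp (s * V') * P)"
      by (rule mult_left_mono) simp
    also have "\<dots> = P" by (simp only: mult.assoc[symmetric] exp_minus_inverse[of "s * V'"] mult.commute[of "exp (- (s * V'))"] mult_1)
    finally have P: "exp (- (s * V')) * (exp (R s - Lg) / 4) \<le> P" .
    have "exp (- (s * V')) * (exp (R s - Lg) / 4) = exp (R s - Lg - s * V' - ln 4)"
    proof -
      have alg: "inverse x * (y / 4) = y / x / 4" for x y :: real by (simp add: inverse_eq_divide)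
      have "exp (R s - Lg - s * V' - ln 4) = exp (R s - Lg) / exp (s * V') / 4"
        by (simp only: exp_diff[of "R s - Lg - s * V'"] exp_diff[of "R s - Lg"] exp_ln zero_less_numeral)
      thus ?thesis by (simp only: exp_minus[of "s * V'"] alg)
    qed
    moreover have "- (\<kappa> * \<sigma> * (1 + 9 / (2 * \<kappa>) * lam)) \<le> R s - Lg - s * V' - ln 4"
    proof -
      \<comment> \<open>The constant 9/2 collects three losses in units of
        \<open>\<sigma> * lam\<close>: 2 from \<open>s\<close> exceeding \<open>\<sigma>\<close>,
        3/2 from the upper end of the window, and 1 from the logarithmic terms.\<close>
      have 1: "R s - s * V' = - (\<kappa> * s) - s * lam" unfolding Rs V'_def by (simp add: algebra_simps)
      have 2: "\<kappa> * s \<le> \<kappa> * \<sigma> + 2 * (\<sigma> * lam)"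
        using mult_left_mono[OF s_hi, of \<kappa>] \<kappa> by (simp add: algebra_simps)
      have 3: "s * lam \<le> 3 / 2 * (\<sigma> * lam)" using mult_right_mono[OF s_hi2, of lam] lam by simp
      have "\<sigma> * lam = exp (- rc - 1) * V * exp (V / (2 * \<kappa>))"
      proof -
        have "exp (V / \<kappa> - rc - 1) * exp (- V / (2 * \<kappa>)) = exp (- rc - 1) * exp (V / (2 * \<kappa>))"
          unfolding exp_add[symmetric] by (simp add: field_simps)
        thus ?thesis by (simp add: \<sigma>_def lam_def s0_def w_def)
      qed
      hence 4: "Lg + ln 4 \<le> \<sigma> * lam" using c(4) by simp
      have 5: "\<kappa> * \<sigma> * (1 + 9 / (2 * \<kappa>) * lam) = \<kappa> * \<sigma> + 9 / 2 * (\<sigma> * lam)" using \<kappa> by (simp add: field_simps)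
      show ?thesis using 1 2 3 4 unfolding 5 by linarith
    qed
    ultimately have "exp (- (\<kappa> * \<sigma> * (1 + 9 / (2 * \<kappa>) * lam))) \<le> exp (- (s * V')) * (exp (R s - Lg) / 4)" by simp
    thus ?thesis using P unfolding \<sigma>_def lam_def by linarith
  qed
  show ?thesis
  proof (intro exI[of _ "max 1 V1"] conjI allI impI)
    fix V P and \<Psi> :: "real \<Rightarrow> real"
    assume "max 1 V1 \<le> V"
      and "\<forall>t. 4 \<le> t \<and> t \<le> 2 * s0 V \<longrightarrow> exp (R t - C * ln t) / 2 \<le> \<Psi> t \<and> \<Psi> t \<le> 2 * exp (R t + C * ln t)"
      and "\<forall>s \<delta> V'. 0 \<le> s \<longrightarrow> 0 \<le> \<delta> \<longrightarrow> \<Psi> s \<le> exp (s * V') * P + exp (\<delta> * V) * \<Psi> (s - \<delta>) + exp (- \<delta> * V') * \<Psi> (s + \<delta>)"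
    thus "exp (- (\<kappa> * s0 V * (1 + 9 / (2 * \<kappa>) * w V))) \<le> P"
      by (intro bound[where \<Psi> = \<Psi>]) blast+
  qed simp
qed


section \<open>Application of the saddle point estimate to the family\<close>

context trace_model
begin

abbreviation "trace_sum m \<phi> \<equiv> \<Sum>h\<in>freqs m. sine_coeff m h * Re (fourier_mod m \<phi> h)"

text \<open>The number 2400 is \<open>48 * 50\<close>: the transfer needs an exponential moment at
  48 times the largest parameter, and the factor 50 keeps the logarithm of that moment below
  \<open>K\<close>.\<close>

definition tilt_max :: "nat \<Rightarrow> real" where
  "tilt_max m = ln (real m) / (2400 * (N / pi) * (ln (ln (real m)))\<^sup>2)"

lemma filterlim_ln_real: "filterlim (\<lambda>m::nat. ln (real m)) at_top sequentially"
  by real_asymp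

text \<open>The set \<open>T\<close> is chosen before \<open>s\<close>, as tilting compares the sums
  over the same set at three parameters. An absolute error 1/2 is good enough because the model
  transform is at least 1.\<close>

lemma mgf_transfer:
  fixes \<eta> C1 D :: real
  assumes \<eta>: "\<eta> \<ge> 1 / 2" and C1: "C1 > 1"
  shows "\<forall>\<^sub>F m in sequentially. \<forall>(\<Omega> :: 'a set) \<phi>.
     periodic_family m \<Omega> \<phi> \<longrightarrow> fourier_bounded N m \<Omega> \<phi> \<longrightarrow> moments_match M X \<eta> C1 D m \<Omega> \<phi> \<longrightarrow>
     (\<exists>T\<subseteq>\<Omega>. \<forall>s. 0 \<le> s \<and> s \<le> tilt_max m \<longrightarrow>
       \<bar>(\<Sum>a\<in>T. exp (s * trace_sum m (\<phi> a))) / card \<Omega> - exp (\<Sum>h\<in>freqs m. cgf (s * sine_coeff m h))\<bar> \<le> 1 / 2)"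
proof -
  define \<kappa> where "\<kappa> = N / pi"
  have \<kappa>: "\<kappa> > 0" using N_pos by (simp add: \<kappa>_def)
  obtain C where C: "\<forall>\<^sub>F m in sequentially. \<forall>s \<sigma>. 4 \<le> s \<and> s \<le> ln (real m) \<and> \<sigma> \<in> {1, -1} \<longrightarrow>
     \<bar>(\<Sum>h\<in>freqs m. cgf (\<sigma> * s * sine_coeff m h)) - rate s\<bar> \<le> C * ln s"
    using cgf_sum_asymptotics by auto
  note ev = transfer_range_asymptotics[OF \<kappa> C1, THEN eventually_compose_filterlim[OF _ filterlim_ln_real]]
  show ?thesis
    using C ev(1,2,3,4) ev(5)[of rate_const C] ev(6,7,8) ev(9)[of D] eventually_ge_at_top[of 2]
  proof eventually_elim
    case (elim m)
    define l where "l = ln (real m)"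
    define z where "z = l / (50 * \<kappa> * (ln l)\<^sup>2)"
    \<comment> \<open>Even by construction, and at most \<open>l / (4 * ln l)\<close>, so that
      \<open>l ^ K \<le> exp (l / 4)\<close>, a quarter power of \<open>m\<close>.\<close>
    define K where "K = 2 * nat \<lfloor>l / (8 * ln l)\<rfloor>"
    define \<beta> where "\<beta> = C1 * (4 * (l + 1))"
    define s1 where "s1 = tilt_max m"
    define \<epsilon> where "\<epsilon> = \<bar>D\<bar> / real m powr \<eta>"
    have s1: "s1 = l / (2400 * \<kappa> * (ln l)\<^sup>2)" by (simp add: s1_def tilt_max_def l_def \<kappa>_def)
    have z: "48 * s1 = z" by (simp add: s1 z_def)
    have a: "\<And>s \<sigma>. 4 \<le> s \<Longrightarrow> s \<le> l \<Longrightarrow> \<sigma> \<in> {1, -1} \<Longrightarrow>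
        \<bar>(\<Sum>h\<in>freqs m. cgf (\<sigma> * s * sine_coeff m h)) - rate s\<bar> \<le> C * ln s"
      and l: "0 < ln l" and Kpos: "2 < l / (4 * ln l) - 2" and z4: "4 \<le> z" and zl: "z \<le> l"
      and rz: "\<kappa> * z * (ln z + rate_const) + C * ln z \<le> l / (4 * ln l) - 2"
      and x0: "l / (4 * ln l) / 6 \<le> s1 * \<beta>"
      and e1: "5 * exp (- (l / (4 * ln l) - 2) / 2) \<le> 1 / 4"
      and rat: "6 * s1 * \<beta> / (l / (4 * ln l) - 2) \<le> l"
      and e2: "2 * (\<bar>D\<bar> * exp (- l / 2) * (exp (l / (4 * ln l) / 6) * exp (l / 4))) \<le> 1 / 4"
      and m: "m \<ge> 2"
      using elim unfolding l_def[symmetric] z_def[symmetric] s1[symmetric] \<beta>_def[symmetric] by blast+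
    have "0 \<le> l / (8 * ln l)" using Kpos by simp
    hence fl: "real_of_int \<lfloor>l / (8 * ln l)\<rfloor> = real (nat \<lfloor>l / (8 * ln l)\<rfloor>)" by simp
    have K: "l / (4 * ln l) - 2 \<le> real K" "real K \<le> l / (4 * ln l)"
      using floor_correct[of "l / (8 * ln l)"] unfolding K_def fl by (auto simp: field_simps)
    have K0: "even K" "0 < K" using K(1) Kpos by (auto simp: K_def intro: Nat.gr0I)
    have l0: "0 \<le> l" using m by (simp add: l_def)
    have s1pos: "0 < s1" using z z4 by linarith
    have \<beta>0: "0 \<le> \<beta>" using C1 l0 by (simp add: \<beta>_def)
    have "rate z + C * ln z \<le> real K" using rz K(1) by (simp add: rate_def \<kappa>_def)
    hence sum_le: "(\<Sum>h\<in>freqs m. cgf (\<sigma> * z * sine_coeff m h)) \<le> real K" if "\<sigma> \<in> {1, -1}" for \<sigma>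
      using a[OF z4 zl that] by linarith
    have mgf1: "(LINT \<omega>|M. exp (48 * s1 * rand_sum m \<omega>)) \<le> exp (real K)"
      using sum_le[of 1] by (simp only: z lint_exp_rand_sum) simp
    have mgf2: "(LINT \<omega>|M. exp (- (48 * s1 * rand_sum m \<omega>))) \<le> exp (real K)"
      using sum_le[of "-1"] lint_exp_rand_sum[of "- z" m] by (simp add: z)
    have err: "2 * (\<epsilon> * (exp (real K / 6) * (6 * s1 * \<beta> / real K) ^ K)) \<le> 1 / 4"
    proof -
      have "6 * s1 * \<beta> / real K \<le> 6 * s1 * \<beta> / (l / (4 * ln l) - 2)"
        using K Kpos s1pos \<beta>0 K0 by (intro divide_left_mono mult_pos_pos) auto
      hence "(6 * s1 * \<beta> / real K) ^ K \<le> l ^ K"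
        using rat s1pos \<beta>0 by (intro power_mono) auto
      also have "\<dots> = exp (real K * ln l)"
      proof -
        have "l > 0" using l0 l by (cases "l = 0") auto
        thus ?thesis by (simp add: exp_of_nat_mult)
      qed
      also have "\<dots> \<le> exp (l / 4)"
      proof -
        have "real K * ln l \<le> l / (4 * ln l) * ln l" using K l by (intro mult_right_mono) auto
        thus ?thesis using l by simp
      qed
      finally have p: "(6 * s1 * \<beta> / real K) ^ K \<le> exp (l / 4)" .
      have "real m powr (1 / 2) \<le> real m powr \<eta>" using m \<eta> by (intro powr_mono) auto
      hence "\<epsilon> \<le> \<bar>D\<bar> / real m powr (1 / 2)" unfolding \<epsilon>_def using m by (intro divide_left_mono mult_pos_pos) auto
      also have "\<dots> = \<bar>D\<bar> * exp (- l / 2)" using m by (simp add: powr_def l_def exp_minus field_simps)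
      finally have "2 * (\<epsilon> * (exp (real K / 6) * (6 * s1 * \<beta> / real K) ^ K))
         \<le> 2 * (\<bar>D\<bar> * exp (- l / 2) * (exp (l / (4 * ln l) / 6) * exp (l / 4)))"
        using p K s1pos \<beta>0 by (intro mult_left_mono mult_mono) auto
      thus ?thesis using e2 by linarith
    qed
    have e1': "5 * exp (- real K / 2) \<le> 1 / 4"
    proof -
      have "exp (- real K / 2) \<le> exp (- (l / (4 * ln l) - 2) / 2)" using K by simp
      thus ?thesis using e1 by linarith
    qed
    have Kl: "l / (4 * ln l) \<le> l / ln l" using l l0 by (intro divide_left_mono mult_pos_pos) auto
    show ?case
    proof (intro allI impI)
      fix \<Omega> :: "'a set" and \<phi> :: "'a \<Rightarrow> int \<Rightarrow> complex"
      assume fam: "periodic_family m \<Omega> \<phi>" "fourier_bounded N m \<Omega> \<phi>" "moments_match M X \<eta> C1 D m \<Omega> \<phi>"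
      have \<Omega>: "finite \<Omega>" "\<Omega> \<noteq> {}" using fam by (auto simp: periodic_family_def)
      define T where "T = {a\<in>\<Omega>. \<bar>trace_sum m (\<phi> a)\<bar> \<le> real K / (6 * s1)}"
      have mom: "\<bar>(\<Sum>a\<in>\<Omega>. trace_sum m (\<phi> a) ^ j) / card \<Omega> - (LINT \<omega>|M. rand_sum m \<omega> ^ j)\<bar> \<le> \<epsilon> * \<beta> ^ j" if "j \<le> K" for j
        unfolding \<epsilon>_def \<beta>_def
      proof (rule moment_transfer[OF fam _ C1])
        have "real j \<le> real K" using that by simp
        thus "real j \<le> ln (real m) / ln (ln (real m))" using K Kl unfolding l_def by linarith
        show "(\<Sum>h\<in>freqs m. \<bar>sine_coeff m h\<bar>) \<le> 4 * (l + 1)" unfolding l_def using m by (intro sum_abs_sine_coeff_le) auto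
      qed
      have x0': "real K / 6 \<le> s1 * \<beta>" using K by (intro order_trans[OF _ x0] divide_right_mono) auto
      have \<epsilon>0: "0 \<le> \<epsilon>" by (simp add: \<epsilon>_def)
      have "\<bar>(\<Sum>a\<in>T. exp (s * trace_sum m (\<phi> a))) / card \<Omega> - exp (\<Sum>h\<in>freqs m. cgf (s * sine_coeff m h))\<bar> \<le> 1 / 2"
        if s: "0 \<le> s" "s \<le> s1" for s
        using truncated_mgf_transfer[OF \<Omega> rv_rand_sum rand_sum_bounded K0 s s1pos \<epsilon>0 \<beta>0 x0' mom mgf1 mgf2] e1' err
        unfolding T_def lint_exp_rand_sum by linarith
      moreover have "T \<subseteq> \<Omega>" by (auto simp: T_def)
      ultimately show "\<exists>T\<subseteq>\<Omega>. \<forall>s. 0 \<le> s \<and> s \<le> tilt_max m \<longrightarrow>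
         \<bar>(\<Sum>a\<in>T. exp (s * trace_sum m (\<phi> a))) / card \<Omega> - exp (\<Sum>h\<in>freqs m. cgf (s * sine_coeff m h))\<bar> \<le> 1 / 2"
        unfolding s1_def[symmetric] by blast
    qed
  qed
qed

text \<open>Identifies the exponent \<open>\<kappa> * s0\<close> found at the saddle point, with
  \<open>\<kappa> = N / pi\<close>, as the one in the theorem: the \<open>2 / pi\<close> inside
  \<open>rate_const\<close> turns \<open>N / pi\<close> into \<open>N / 2\<close>.\<close>

lemma A0_const_eq: "A0_const M Y N * exp (pi / N * V) = N / pi * exp (V / (N / pi) - rate_const - 1)"
proof -
  have eq1: "exp (- rate_const) = pi / 2 * exp (- euler_mascheroni - 1 / (2 * N) * (LINT u|lborel. f_cgf M Y N u / u\<^sup>2))"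
    using pi_gt_zero by (simp add: rate_const_def exp_diff exp_minus exp_add field_simps)
  have eq2: "exp (V / (N / pi) - rate_const - 1) = exp (- rate_const) * exp (-1) * exp (pi / N * V)"
    by (simp flip: exp_add add: mult.commute)
  have eq3: "exp (- euler_mascheroni - 1 - 1 / (2 * N) * (LINT u|lborel. f_cgf M Y N u / u\<^sup>2))
     = exp (- euler_mascheroni - 1 / (2 * N) * (LINT u|lborel. f_cgf M Y N u / u\<^sup>2)) * exp (-1)"
    by (simp flip: exp_add add: algebra_simps)
  show ?thesis unfolding A0_const_def eq2 eq1 eq3 by simp
qed

lemma A0_const_pos: "A0_const M Y N > 0"
  using N_pos by (simp add: A0_const_def)

definition gap :: "real \<Rightarrow> real" where "gap V = V * exp (- pi * V / (2 * N))"

definition V_max :: "nat \<Rightarrow> real" where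
  "V_max m = N / pi * (ln (ln (real m)) - 2 * ln (ln (ln (real m))) - B_const M Y N)"

lemma large_V_bound:
  fixes \<eta> C1 D :: real
  assumes \<eta>: "\<eta> \<ge> 1 / 2" and C1: "C1 > 1"
  shows "\<exists>V0\<ge>1. \<forall>\<^sub>F m in sequentially. \<forall>(\<Omega> :: 'a set) \<phi>.
     periodic_family m \<Omega> \<phi> \<longrightarrow> fourier_bounded N m \<Omega> \<phi> \<longrightarrow> moments_match M X \<eta> C1 D m \<Omega> \<phi> \<longrightarrow>
     (\<forall>V. V0 \<le> V \<and> V \<le> V_max m \<longrightarrow>
        exp (- (A0_const M Y N * exp (pi / N * V) * (1 + 9 * pi / (2 * N) * gap V))) \<le> large_proportion m \<Omega> \<phi> V)"
proof -
  define \<kappa> where "\<kappa> = N / pi"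
  have \<kappa>: "\<kappa> > 0" using N_pos by (simp add: \<kappa>_def)
  obtain C where C: "\<forall>\<^sub>F m in sequentially. \<forall>s \<sigma>. 4 \<le> s \<and> s \<le> ln (real m) \<and> \<sigma> \<in> {1, -1} \<longrightarrow>
     \<bar>(\<Sum>h\<in>freqs m. cgf (\<sigma> * s * sine_coeff m h)) - rate s\<bar> \<le> C * ln s"
    using cgf_sum_asymptotics by auto
  define s0 where "s0 = (\<lambda>V. exp (V / \<kappa> - rate_const - 1))"
  define w where "w = (\<lambda>V. V * exp (- V / (2 * \<kappa>)))"
  have rate: "rate = (\<lambda>t. \<kappa> * t * (ln t + rate_const))" by (simp add: fun_eq_iff rate_def \<kappa>_def)
  have "\<exists>V0\<ge>1. \<forall>V\<ge>V0. \<forall>\<Psi> P.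
     (\<forall>t. 4 \<le> t \<and> t \<le> 2 * s0 V \<longrightarrow> exp (rate t - \<bar>C\<bar> * ln t) / 2 \<le> \<Psi> t \<and> \<Psi> t \<le> 2 * exp (rate t + \<bar>C\<bar> * ln t)) \<longrightarrow>
     (\<forall>s \<delta> V'. 0 \<le> s \<longrightarrow> 0 \<le> \<delta> \<longrightarrow> \<Psi> s \<le> exp (s * V') * P + exp (\<delta> * V) * \<Psi> (s - \<delta>) + exp (- \<delta> * V') * \<Psi> (s + \<delta>)) \<longrightarrow>
     exp (- (\<kappa> * s0 V * (1 + 9 / (2 * \<kappa>) * w V))) \<le> P"
    unfolding s0_def w_def rate by (rule tilting_bound[OF \<kappa> abs_ge_zero])
  then obtain V0 where V0: "V0 \<ge> 1" and key: "\<forall>V\<ge>V0. \<forall>\<Psi> P.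
     (\<forall>t. 4 \<le> t \<and> t \<le> 2 * s0 V \<longrightarrow> exp (rate t - \<bar>C\<bar> * ln t) / 2 \<le> \<Psi> t \<and> \<Psi> t \<le> 2 * exp (rate t + \<bar>C\<bar> * ln t)) \<longrightarrow>
     (\<forall>s \<delta> V'. 0 \<le> s \<longrightarrow> 0 \<le> \<delta> \<longrightarrow> \<Psi> s \<le> exp (s * V') * P + exp (\<delta> * V) * \<Psi> (s - \<delta>) + exp (- \<delta> * V') * \<Psi> (s + \<delta>)) \<longrightarrow>
     exp (- (\<kappa> * s0 V * (1 + 9 / (2 * \<kappa>) * w V))) \<le> P"
    by (elim exE conjE) (rule that)
  have e: "\<forall>\<^sub>F m in sequentially. ln (ln (real m)) > 0 \<and> ln (real m) > 0 \<and> ln (ln (ln (real m))) > 0 \<and> m \<ge> 2 \<and> tilt_max m \<le> ln (real m)"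
    unfolding tilt_max_def using N_pos by (intro eventually_conj; real_asymp)
  show ?thesis
  proof (intro exI[of _ V0] conjI V0)
    show "\<forall>\<^sub>F m in sequentially. \<forall>(\<Omega> :: 'a set) \<phi>.
     periodic_family m \<Omega> \<phi> \<longrightarrow> fourier_bounded N m \<Omega> \<phi> \<longrightarrow> moments_match M X \<eta> C1 D m \<Omega> \<phi> \<longrightarrow>
     (\<forall>V. V0 \<le> V \<and> V \<le> V_max m \<longrightarrow>
        exp (- (A0_const M Y N * exp (pi / N * V) * (1 + 9 * pi / (2 * N) * gap V))) \<le> large_proportion m \<Omega> \<phi> V)"
      using C e mgf_transfer[OF \<eta> C1, of D]
    proof (eventually_elim, intro allI impI, elim conjE)
      fix m \<Omega> V and \<phi> :: "'a \<Rightarrow> int \<Rightarrow> complex"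
      assume as: "\<forall>s \<sigma>. 4 \<le> s \<and> s \<le> ln (real m) \<and> \<sigma> \<in> {1, -1} \<longrightarrow>
           \<bar>(\<Sum>h\<in>freqs m. cgf (\<sigma> * s * sine_coeff m h)) - rate s\<bar> \<le> C * ln s"
        and tr: "\<forall>(\<Omega> :: 'a set) \<phi>.
           periodic_family m \<Omega> \<phi> \<longrightarrow> fourier_bounded N m \<Omega> \<phi> \<longrightarrow> moments_match M X \<eta> C1 D m \<Omega> \<phi> \<longrightarrow>
           (\<exists>T\<subseteq>\<Omega>. \<forall>s. 0 \<le> s \<and> s \<le> tilt_max m \<longrightarrow>
             \<bar>(\<Sum>a\<in>T. exp (s * trace_sum m (\<phi> a))) / card \<Omega> - exp (\<Sum>h\<in>freqs m. cgf (s * sine_coeff m h))\<bar> \<le> 1 / 2)"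
        and fam: "periodic_family m \<Omega> \<phi>" "fourier_bounded N m \<Omega> \<phi>" "moments_match M X \<eta> C1 D m \<Omega> \<phi>"
        and V: "V0 \<le> V" "V \<le> V_max m"
        and m: "ln (ln (real m)) > 0" "ln (real m) > 0" "ln (ln (ln (real m))) > 0" "m \<ge> 2" "tilt_max m \<le> ln (real m)"
      obtain T where T: "T \<subseteq> \<Omega>" and
        Tb: "\<forall>s. 0 \<le> s \<and> s \<le> tilt_max m \<longrightarrow>
             \<bar>(\<Sum>a\<in>T. exp (s * trace_sum m (\<phi> a))) / card \<Omega> - exp (\<Sum>h\<in>freqs m. cgf (s * sine_coeff m h))\<bar> \<le> 1 / 2"
        using tr[rule_format, OF fam] by (elim exE conjE) (rule that)
      have \<Omega>: "finite \<Omega>" "\<Omega> \<noteq> {}" using fam by (auto simp: periodic_family_def)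
      define \<Psi> where "\<Psi> = (\<lambda>s. (\<Sum>a\<in>T. exp (s * trace_sum m (\<phi> a))) / card \<Omega>)"
      define P where "P = real (card {a\<in>\<Omega>. V < trace_sum m (\<phi> a)}) / card \<Omega>"
      define l where "l = ln (real m)"
      have A0: "A0_const M Y N * exp (pi / N * V) = \<kappa> * s0 V" by (simp only: A0_const_eq \<kappa>_def s0_def)
      \<comment> \<open>Origin of the 9 in \<open>B_const\<close>: the upper limit for
        \<open>V\<close> bounds \<open>\<kappa> * s0 V\<close> by
        \<open>exp (- 9) * l / (ln l)\<^sup>2\<close>, and
        \<open>2 * 2400 = 4800 \<le> exp 9\<close>.\<close>
      have rng: "2 * s0 V \<le> tilt_max m"
      proof -
        have "pi / N * V \<le> pi / N * V_max m" using V N_pos by (intro mult_left_mono) auto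
        also have "\<dots> = ln l - 2 * ln (ln l) - ln (A0_const M Y N) - 9"
          using N_pos by (simp add: V_max_def B_const_def l_def)
        finally have "exp (pi / N * V) \<le> exp (ln l - 2 * ln (ln l) - ln (A0_const M Y N) - 9)" by simp
        also have "\<dots> = l / (ln l)\<^sup>2 / A0_const M Y N / exp 9"
        proof -
          have "exp (2 * ln (ln l)) = (ln l)\<^sup>2"
            using m exp_of_nat_mult[of 2 "ln (ln l)"] by (simp add: l_def)
          thus ?thesis using m A0_const_pos by (simp add: exp_diff l_def)
        qed
        finally have "A0_const M Y N * exp (pi / N * V) * exp 9 \<le> l / (ln l)\<^sup>2"
          by (simp only: pos_le_divide_eq exp_gt_zero A0_const_pos mult_ac)
        moreover have "(4800::real) \<le> exp 9"
        proof -
          have "(13 / 8 :: real) \<le> exp (1 / 2)"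
            using exp_lower_Taylor_quadratic[of "1 / 2 :: real"] by (simp add: power2_eq_square)
          hence "(13 / 8 :: real) ^ 18 \<le> exp (1 / 2) ^ 18" by (intro power_mono) auto
          also have "exp (1 / 2 :: real) ^ 18 = exp 9" by (simp add: exp_of_nat_mult[symmetric])
          finally show ?thesis by (simp add: power_divide)
        qed
        hence "\<kappa> * s0 V * 4800 \<le> \<kappa> * s0 V * exp 9" using \<kappa> by (intro mult_left_mono) (auto simp: s0_def)
        ultimately have "\<kappa> * s0 V * 4800 \<le> l / (ln l)\<^sup>2" unfolding A0 by (rule order_trans[rotated])
        moreover have "2 * s0 V * (2400 * \<kappa>) = \<kappa> * s0 V * 4800" by simp
        ultimately have "2 * s0 V * (2400 * \<kappa>) \<le> l / (ln l)\<^sup>2" by (simp only:)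
        hence "2 * s0 V \<le> l / (ln l)\<^sup>2 / (2400 * \<kappa>)" using \<kappa> by (subst pos_le_divide_eq) auto
        thus ?thesis by (simp add: tilt_max_def l_def \<kappa>_def mult_ac)
      qed
      have "exp (- (\<kappa> * s0 V * (1 + 9 / (2 * \<kappa>) * w V))) \<le> P"
      proof (rule key[rule_format, OF V(1), of \<Psi> P])
        fix t :: real assume "4 \<le> t \<and> t \<le> 2 * s0 V"
        hence t: "4 \<le> t" "t \<le> 2 * s0 V" by auto
        define La where "La = (\<Sum>h\<in>freqs m. cgf (t * sine_coeff m h))"
        \<comment> \<open>Nonnegativity of the cumulants turns the absolute error 1/2 into a factor
          2 on either side.\<close>
        have "0 \<le> La" unfolding La_def by (intro sum_nonneg pos.cgf_nonneg)
        hence "1 \<le> exp La" by simp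
        moreover have "\<bar>\<Psi> t - exp La\<bar> \<le> 1 / 2" unfolding \<Psi>_def La_def using t rng by (intro Tb[rule_format]) auto
        ultimately have b: "exp La / 2 \<le> \<Psi> t" "\<Psi> t \<le> 2 * exp La" by linarith+
        have "\<bar>La - rate t\<bar> \<le> C * ln t" using as[rule_format, of t 1] t rng m by (simp add: La_def)
        also have "\<dots> \<le> \<bar>C\<bar> * ln t" using t by (intro mult_right_mono) auto
        finally have "exp (rate t - \<bar>C\<bar> * ln t) \<le> exp La" "exp La \<le> exp (rate t + \<bar>C\<bar> * ln t)" by auto
        thus "exp (rate t - \<bar>C\<bar> * ln t) / 2 \<le> \<Psi> t \<and> \<Psi> t \<le> 2 * exp (rate t + \<bar>C\<bar> * ln t)" using b by linarith
      next
        fix s \<delta> V' :: real assume "0 \<le> s" "0 \<le> \<delta>"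
        thus "\<Psi> s \<le> exp (s * V') * P + exp (\<delta> * V) * \<Psi> (s - \<delta>) + exp (- \<delta> * V') * \<Psi> (s + \<delta>)"
          unfolding \<Psi>_def P_def by (intro exp_tilt_count[OF \<Omega>(1) T])
      qed
      also have "P \<le> large_proportion m \<Omega> \<phi> V"
        unfolding P_def large_proportion_def
      proof (intro divide_right_mono of_nat_mono card_mono subsetI)
        fix a assume "a \<in> {a\<in>\<Omega>. V < trace_sum m (\<phi> a)}"
        hence a: "a \<in> \<Omega>" "V < trace_sum m (\<phi> a)" by auto
        have "fourier_mod m (\<phi> a) h \<in> \<real>" for h
        proof -
          have "fourier_mod m (\<phi> a) h \<in> complex_of_real ` {-N..N}"
            using fam(2) a unfolding fourier_bounded_def by blast
          thus ?thesis by auto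
        qed
        hence "trace_sum m (\<phi> a) \<le> max_partial_sum m (\<phi> a) / sqrt (real m)"
          by (rule max_partial_sum_ge_sine_sum[OF m(4)])
        thus "a \<in> {a\<in>\<Omega>. max_partial_sum m (\<phi> a) / sqrt (real m) > V}" using a by auto
      qed (use \<Omega> in auto)
      finally have "exp (- (\<kappa> * s0 V * (1 + 9 / (2 * \<kappa>) * w V))) \<le> large_proportion m \<Omega> \<phi> V" .
      moreover have "9 / (2 * \<kappa>) * w V = 9 * pi / (2 * N) * gap V"
        by (simp add: w_def gap_def \<kappa>_def mult.commute)
      ultimately show "exp (- (A0_const M Y N * exp (pi / N * V) * (1 + 9 * pi / (2 * N) * gap V))) \<le> large_proportion m \<Omega> \<phi> V"
        unfolding A0 by simp
    qed
  qed
qed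

end

section \<open>Extension to small \<open>V\<close> and the final statement\<close>

lemma large_proportion_antimono:
  assumes "finite \<Omega>" "V \<le> V'"
  shows "large_proportion m \<Omega> \<phi> V' \<le> large_proportion m \<Omega> \<phi> V"
  unfolding large_proportion_def using assms
  by (intro divide_right_mono of_nat_mono card_mono) auto

text \<open>The implied constant \<open>K\<close> and the threshold for \<open>m\<close> precede the
  family and \<open>V\<close>, which expresses uniformity; they may depend on the model and on
  \<open>\<eta>\<close>, \<open>C\<^sub>1\<close> and \<open>D\<close>.\<close>

theorem theorem1p3:
  fixes M :: "'b measure" and X :: "int \<Rightarrow> 'b \<Rightarrow> real" and Y :: "'b \<Rightarrow> real"
    and N \<eta> C\<^sub>1 D :: real
  assumes "N > 0" and "\<eta> \<ge> 1 / 2" and "C\<^sub>1 > 1"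
    and "random_model M X Y N"
  shows "\<exists>(K::real) (m\<^sub>0::nat). \<forall>m\<ge>m\<^sub>0. \<forall>(\<Omega> :: 'a set) (\<phi> :: 'a \<Rightarrow> int \<Rightarrow> complex).
           m \<ge> 2 \<longrightarrow> periodic_family m \<Omega> \<phi> \<longrightarrow> fourier_bounded N m \<Omega> \<phi> \<longrightarrow>
           moments_match M X \<eta> C\<^sub>1 D m \<Omega> \<phi> \<longrightarrow>
           (\<forall>V::real. 1 \<le> V \<and>
              V \<le> N / pi * (ln (ln (real m)) - 2 * ln (ln (ln (real m))) - B_const M Y N) \<longrightarrow>
              (\<exists>E::real. \<bar>E\<bar> \<le> K * (V * exp (- pi * V / (2 * N))) \<and>
                 large_proportion m \<Omega> \<phi> V
                   \<ge> exp (- A0_const M Y N * exp (pi / N * V) * (1 + E))))"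
proof -
  interpret trace_model M X Y N using assms by unfold_locales
  define A0 where "A0 = A0_const M Y N"
  have A0: "A0 > 0" using A0_const_pos by (simp add: A0_def)
  define c where "c = 9 * pi / (2 * N)"
  have c: "c > 0" using assms by (simp add: c_def)
  obtain V0 where V0: "V0 \<ge> 1" and ev: "\<forall>\<^sub>F m in sequentially. \<forall>(\<Omega> :: 'a set) \<phi>.
     periodic_family m \<Omega> \<phi> \<longrightarrow> fourier_bounded N m \<Omega> \<phi> \<longrightarrow> moments_match M X \<eta> C\<^sub>1 D m \<Omega> \<phi> \<longrightarrow>
     (\<forall>V. V0 \<le> V \<and> V \<le> V_max m \<longrightarrow>
        exp (- (A0 * exp (pi / N * V) * (1 + c * gap V))) \<le> large_proportion m \<Omega> \<phi> V)"
    using large_V_bound[OF assms(2,3), of D] unfolding A0_def c_def by blast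
  have ev2: "\<forall>\<^sub>F m in sequentially. V0 \<le> V_max m"
    unfolding V_max_def using assms(1) by (intro V_range_asymptotics) simp
  obtain m0 where m0: "\<And>m (\<Omega> :: 'a set) \<phi> V. m \<ge> m0 \<Longrightarrow> periodic_family m \<Omega> \<phi> \<Longrightarrow> fourier_bounded N m \<Omega> \<phi> \<Longrightarrow>
      moments_match M X \<eta> C\<^sub>1 D m \<Omega> \<phi> \<Longrightarrow> V0 \<le> V \<Longrightarrow> V \<le> V_max m \<Longrightarrow>
      exp (- (A0 * exp (pi / N * V) * (1 + c * gap V))) \<le> large_proportion m \<Omega> \<phi> V"
    and m0': "\<And>m. m \<ge> m0 \<Longrightarrow> V0 \<le> V_max m"
    using eventually_conj[OF ev ev2] unfolding eventually_sequentially by blast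
  \<comment> \<open>For \<open>1 \<le> V < V0\<close> monotonicity in \<open>V\<close> gives the
    lower bound \<open>exp (- Q)\<close> from the value at \<open>V0\<close>, admissible once
    \<open>V_max m \<ge> V0\<close>. As \<open>exp (pi / N * V) * gap V = V * exp (pi * V / (2 * N))
    \<ge> 1\<close>, adding \<open>Q / A0\<close> to the constant lets the error term absorb
    \<open>Q\<close>.\<close>
  define Q where "Q = A0 * exp (pi / N * V0) * (1 + c * gap V0)"
  define K where "K = c + Q / A0"
  have Q: "Q \<ge> 0" using A0 c V0 by (simp add: Q_def gap_def)
  have main: "exp (- A0 * exp (pi / N * V) * (1 + K * gap V)) \<le> large_proportion m \<Omega> \<phi> V"
    if m: "m \<ge> m0" and fam: "periodic_family m \<Omega> \<phi>" "fourier_bounded N m \<Omega> \<phi>" "moments_match M X \<eta> C\<^sub>1 D m \<Omega> \<phi>"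
      and V: "1 \<le> V" "V \<le> V_max m" for m V and \<Omega> :: "'a set" and \<phi>
  proof (cases "V0 \<le> V")
    case True
    have "c * gap V \<le> K * gap V" using V Q A0 by (intro mult_right_mono) (auto simp: K_def gap_def)
    hence "A0 * exp (pi / N * V) * (1 + c * gap V) \<le> A0 * exp (pi / N * V) * (1 + K * gap V)"
      using A0 by (intro mult_left_mono) auto
    hence "exp (- A0 * exp (pi / N * V) * (1 + K * gap V)) \<le> exp (- (A0 * exp (pi / N * V) * (1 + c * gap V)))" by simp
    also have "\<dots> \<le> large_proportion m \<Omega> \<phi> V" using m0[OF m fam True V(2)] .
    finally show ?thesis .
  next
    case False
    have "exp (pi / N * V) * exp (- pi * V / (2 * N)) = exp (pi * V / (2 * N))"
      using assms(1) by (simp flip: exp_add add: field_simps)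
    hence g: "exp (pi / N * V) * gap V = V * exp (pi * V / (2 * N))" by (simp add: gap_def mult_ac)
    have "1 * 1 \<le> V * exp (pi * V / (2 * N))"
      using V(1) assms(1) by (intro mult_mono) auto
    hence "Q * 1 \<le> Q * (exp (pi / N * V) * gap V)" unfolding g using Q by (intro mult_left_mono) auto
    also have "\<dots> = A0 * exp (pi / N * V) * (Q / A0 * gap V)" using A0 by simp
    also have "\<dots> \<le> A0 * exp (pi / N * V) * (1 + K * gap V)"
      using A0 c V(1) by (intro mult_left_mono) (auto simp: K_def gap_def algebra_simps)
    finally have "exp (- A0 * exp (pi / N * V) * (1 + K * gap V)) \<le> exp (- Q)" by simp
    also have "\<dots> \<le> large_proportion m \<Omega> \<phi> V0"
      using m0[OF m fam order_refl m0'[OF m]] unfolding Q_def .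
    also have "\<dots> \<le> large_proportion m \<Omega> \<phi> V"
      using False fam(1) by (intro large_proportion_antimono) (auto simp: periodic_family_def)
    finally show ?thesis .
  qed
  have K: "K \<ge> 0" using c Q A0 by (simp add: K_def)
  show ?thesis
  proof (rule exI[of _ K], rule exI[of _ m0], intro allI impI, elim conjE)
    fix m \<Omega> V and \<phi> :: "'a \<Rightarrow> int \<Rightarrow> complex"
    assume "m \<ge> m0" "periodic_family m \<Omega> \<phi>" "fourier_bounded N m \<Omega> \<phi>" "moments_match M X \<eta> C\<^sub>1 D m \<Omega> \<phi>"
      and V: "1 \<le> V" "V \<le> N / pi * (ln (ln (real m)) - 2 * ln (ln (ln (real m))) - B_const M Y N)"
    hence "exp (- A0 * exp (pi / N * V) * (1 + K * gap V)) \<le> large_proportion m \<Omega> \<phi> V"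
      by (intro main) (auto simp: V_max_def)
    moreover have "\<bar>K * gap V\<bar> \<le> K * (V * exp (- pi * V / (2 * N)))"
      using K V by (simp add: gap_def)
    ultimately show "\<exists>E. \<bar>E\<bar> \<le> K * (V * exp (- pi * V / (2 * N))) \<and>
        exp (- A0_const M Y N * exp (pi / N * V) * (1 + E)) \<le> large_proportion m \<Omega> \<phi> V"
      unfolding A0_def by blast
  qed
qed

end
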